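(* Let $\Gamma$ be a finite graph and let $\mathcal{D}$ be its set of dimer coverings. The fundamental groupoid $\pi_1(X_{\mathcal{D}},\mathcal{D})$ of the dimer complex is presented by generators $\{z_{A,B}:A\to B\}_{A,B\in\mathcal{D}}$ and relations $z_{A,C}=z_{A,B}\,z_{B,C}$ for every flat triple $A,B,C\in\mathcal{D}$.
   Context: A graph is a 1-dimensional CW-complex without loops (multiple edges are allowed); finite means finitely many vertices and edges. Let $E$ be the set of edges of $\Gamma$ and let $G=2^E$ be the power group of $E$: the set of subsets of $E$ with multiplication $AB=(A\cup B)\setminus(A\cap B)$. A dimer covering is a set of edges such that every vertex of $\Gamma$ is incident to exactly one edge in the set; $\mathcal{D}\subset G$ is the set of dimer coverings. For $A\in\mathcal{D}$ and a vertex $v$ of $\Gamma$, $A_v$ denotes the only edge of $A$ incident to $v$. A triple $A,B,C\in\mathcal{D}$ is flat if for any vertex $v$ of $\Gamma$, at least two of the edges $A_v,B_v,C_v$ are equal. The dimer complex $X_{\mathcal{D}}$ is defined as follows. A set $s\subset E$ is cyclic if it is finite and each vertex of $\Gamma$ is either incident to exactly two distinct edges belonging to $s$ or not incident to any edge belonging to $s$. A cyclic set is a cycle if the union of its edges is a single circle; a cycle is even if it has an even number of elements. Two sets of edges $s,t$ are independent if no edge in $s$ has a common vertex with an edge in $t$. For a finite set $S$ of pairwise independent even cycles, put $[S]=\prod_{s\in S}s\in G$, $[\emptyset]=\emptyset$. A based cube is a pair $(A,S)$ with $A\in G$ and $S$ a finite set of pairwise independent even cycles; its vertices are the elements $[T]A$,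 $T\subset S$, and its dimension is $\mathrm{card}(S)$. Based cubes $(A,S)$ and $([T]A,S)$ with $T\subset S$ are equivalent; equivalence classes of $k$-dimensional based cubes are called $k$-cubes. The cubed complex $X_G$ consists of triples $(A,S,x)$ with $(A,S)$ a based cube and $x:S\to[0,1]$, modulo the equivalence relation generated by: $(A,S,x)\sim(A,S',x')$ if $S\subset S'$, $x=x'|_S$, $x'(S'\setminus S)=0$; and $(A,S,x)\sim([T]A,S,x')$ if $T\subset S$, $x'=x$ on $S\setminus T$, $x'(t)=1-x(t)$ for $t\in T$. The dimer complex $X_{\mathcal{D}}\subset X_G$ is the subcomplex formed by the cubes all of whose vertices lie in $\mathcal{D}$; its $0$-skeleton is $\mathcal{D}$. The groupoid $\pi_1(X_{\mathcal{D}},\mathcal{D})$ is the category (all of whose morphisms are invertible) whose objects are the elements of $\mathcal{D}$ and whose morphisms are homotopy classes (relative to endpoints) of paths in $X_{\mathcal{D}}$ with endpoints in $\mathcal{D}$. Composition is written in the order of multiplication of paths, so $z_{A,B}\,z_{B,C}$ is a morphism $A\to C$. The presentation is as a groupoid with object set $\mathcal{D}$. *)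

theory Defs
  imports "HOL-Analysis.Analysis" "HOL-Algebra.FiniteProduct"
begin

section \<open>Finite graphs and dimer coverings\<close>

text \<open>
  Undirected multigraphs without loops. A 1-dimensional CW-complex without loops is recorded by its
  0-cells, its 1-cells and the pair of endpoints of each 1-cell; distinct edges may have the same
  endpoints, and isolated vertices are allowed.
\<close>

record ('v, 'e) mgraph =
  verts :: "'v set"
  edges :: "'e set"
  ends :: "'e \<Rightarrow> 'v set"

definition finite_graph :: "('v, 'e) mgraph \<Rightarrow> bool" where
  "finite_graph \<Gamma> \<longleftrightarrow> finite (verts \<Gamma>) \<and> finite (edges \<Gamma>) \<and>
     (\<forall>e\<in>edges \<Gamma>. ends \<Gamma> e \<subseteq> verts \<Gamma> \<and> card (ends \<Gamma> e) = 2)"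

definition power_group :: "'e set \<Rightarrow> 'e set monoid" where
  "power_group E = \<lparr>carrier = Pow E, mult = (\<lambda>A B. (A \<union> B) - (A \<inter> B)), one = {}\<rparr>"

definition dimer_coverings :: "('v, 'e) mgraph \<Rightarrow> 'e set set" where
  "dimer_coverings \<Gamma> =
     {A. A \<subseteq> edges \<Gamma> \<and> (\<forall>v\<in>verts \<Gamma>. \<exists>!e. e \<in> A \<and> v \<in> ends \<Gamma> e)}"

definition edge_at :: "('v, 'e) mgraph \<Rightarrow> 'e set \<Rightarrow> 'v \<Rightarrow> 'e" where
  "edge_at \<Gamma> A v = (THE e. e \<in> A \<and> v \<in> ends \<Gamma> e)"

definition flat_triple :: "('v, 'e) mgraph \<Rightarrow> 'e set \<Rightarrow> 'e set \<Rightarrow> 'e set \<Rightarrow> bool" where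
  "flat_triple \<Gamma> A B C \<longleftrightarrow>
     A \<in> dimer_coverings \<Gamma> \<and> B \<in> dimer_coverings \<Gamma> \<and> C \<in> dimer_coverings \<Gamma> \<and>
     (\<forall>v\<in>verts \<Gamma>. edge_at \<Gamma> A v = edge_at \<Gamma> B v \<or> edge_at \<Gamma> B v = edge_at \<Gamma> C v \<or>
        edge_at \<Gamma> A v = edge_at \<Gamma> C v)"


section \<open>Cycles\<close>

definition cyclic_set :: "('v, 'e) mgraph \<Rightarrow> 'e set \<Rightarrow> bool" where
  "cyclic_set \<Gamma> s \<longleftrightarrow> s \<subseteq> edges \<Gamma> \<and> finite s \<and>
     (\<forall>v\<in>verts \<Gamma>. card {e \<in> s. v \<in> ends \<Gamma> e} = 2 \<or> {e \<in> s. v \<in> ends \<Gamma> e} = {})"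

text \<open>
  The union of the edges in \<open>s\<close> is a circle: the edges can be listed cyclically, successive edges
  being glued along successive, pairwise distinct vertices. Two parallel edges form a circle.
\<close>

definition is_circle :: "('v, 'e) mgraph \<Rightarrow> 'e set \<Rightarrow> bool" where
  "is_circle \<Gamma> s \<longleftrightarrow> (\<exists>vs es. length vs = length es \<and> 2 \<le> length es \<and> distinct vs \<and> distinct es \<and>
     set es = s \<and> (\<forall>i<length es. ends \<Gamma> (es ! i) = {vs ! i, vs ! (Suc i mod length vs)}))"

definition even_cycle :: "('v, 'e) mgraph \<Rightarrow> 'e set \<Rightarrow> bool" where
  "even_cycle \<Gamma> s \<longleftrightarrow> cyclic_set \<Gamma> s \<and> is_circle \<Gamma> s \<and> even (card s)"

definition independent_edges :: "('v, 'e) mgraph \<Rightarrow> 'e set \<Rightarrow> 'e set \<Rightarrow> bool" where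
  "independent_edges \<Gamma> s t \<longleftrightarrow> (\<forall>e\<in>s. \<forall>f\<in>t. ends \<Gamma> e \<inter> ends \<Gamma> f = {})"


section \<open>Quotient spaces\<close>

text \<open>Quotient topology on the set of classes of a relation (meant to be an equivalence relation).\<close>

definition quotient_space :: "'a topology \<Rightarrow> ('a \<times> 'a) set \<Rightarrow> 'a set topology" where
  "quotient_space X r =
     topology (\<lambda>U. U \<subseteq> topspace X // r \<and> openin X {x \<in> topspace X. r `` {x} \<in> U})"

lemma openin_quotient_space:
  "openin (quotient_space X r) U \<longleftrightarrow>
     U \<subseteq> topspace X // r \<and> openin X {x \<in> topspace X. r `` {x} \<in> U}"
proof -
  have 1: "{x \<in> topspace X. r `` {x} \<in> S \<inter> T} =
      {x \<in> topspace X. r `` {x} \<in> S} \<inter> {x \<in> topspace X. r `` {x} \<in> T}" for S T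
    by auto
  have 2: "{x \<in> topspace X. r `` {x} \<in> \<Union>\<K>} = (\<Union>K\<in>\<K>. {x \<in> topspace X. r `` {x} \<in> K})" for \<K>
    by auto
  have "istopology (\<lambda>U. U \<subseteq> topspace X // r \<and> openin X {x \<in> topspace X. r `` {x} \<in> U})"
    unfolding istopology_def 1 2 by blast
  then show ?thesis
    unfolding quotient_space_def by (simp add: topology_inverse')
qed

lemma topspace_quotient_space: "topspace (quotient_space X r) = topspace X // r"
proof -
  have "{x \<in> topspace X. r `` {x} \<in> topspace X // r} = topspace X"
    by (auto intro: quotientI)
  then have "openin (quotient_space X r) (topspace X // r)"
    by (simp add: openin_quotient_space)
  then show ?thesis
    by (meson openin_quotient_space openin_subset openin_topspace subset_antisym)
qed

lemma quotient_map_quotient_space: "quotient_map X (quotient_space X r) (\<lambda>x. r `` {x})"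
  unfolding quotient_map_def topspace_quotient_space openin_quotient_space
  by (auto simp: quotient_def)


section \<open>The dimer complex\<close>

definition cycle_prod :: "('v, 'e) mgraph \<Rightarrow> 'e set set \<Rightarrow> 'e set" where
  "cycle_prod \<Gamma> S = finprod (power_group (edges \<Gamma>)) (\<lambda>s. s) S"

definition glide :: "('v, 'e) mgraph \<Rightarrow> 'e set set \<Rightarrow> 'e set \<Rightarrow> 'e set" where
  "glide \<Gamma> T A = cycle_prod \<Gamma> T \<otimes>\<^bsub>power_group (edges \<Gamma>)\<^esub> A"

definition based_cubes :: "('v, 'e) mgraph \<Rightarrow> ('e set \<times> 'e set set) set" where
  "based_cubes \<Gamma> = {(A, S). A \<in> carrier (power_group (edges \<Gamma>)) \<and> finite S \<and>
     (\<forall>s\<in>S. even_cycle \<Gamma> s) \<and> pairwise (independent_edges \<Gamma>) S}"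

text \<open>
  The disjoint union of the cubes \<open>[0,1]\<^sup>S\<close> over all based cubes \<open>(A, S)\<close>: a triple \<open>(A, S, x)\<close> is
  rendered as \<open>((A, S), x)\<close> with \<open>x\<close> extensional on \<open>S\<close>.
\<close>

type_synonym 'e cube_point = "('e set \<times> 'e set set) \<times> ('e set \<Rightarrow> real)"

definition cubes_space :: "('v, 'e) mgraph \<Rightarrow> 'e cube_point topology" where
  "cubes_space \<Gamma> =
     sum_topology (\<lambda>(A, S). product_topology (\<lambda>_. top_of_set {0..1}) S) (based_cubes \<Gamma>)"

inductive_set cube_gluing :: "('v, 'e) mgraph \<Rightarrow> 'e cube_point rel"
  for \<Gamma> :: "('v, 'e) mgraph" where
  face: "\<lbrakk>(A, S) \<in> based_cubes \<Gamma>; (A, S') \<in> based_cubes \<Gamma>; S \<subseteq> S';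
      x \<in> S \<rightarrow>\<^sub>E {0..1}; x' \<in> S' \<rightarrow>\<^sub>E {0..1};
      \<And>s. s \<in> S \<Longrightarrow> x s = x' s; \<And>s. s \<in> S' - S \<Longrightarrow> x' s = 0\<rbrakk>
    \<Longrightarrow> (((A, S), x), ((A, S'), x')) \<in> cube_gluing \<Gamma>"
| rebase: "\<lbrakk>(A, S) \<in> based_cubes \<Gamma>; T \<subseteq> S;
      x \<in> S \<rightarrow>\<^sub>E {0..1}; x' \<in> S \<rightarrow>\<^sub>E {0..1};
      \<And>s. s \<in> S - T \<Longrightarrow> x' s = x s; \<And>t. t \<in> T \<Longrightarrow> x' t = 1 - x t\<rbrakk>
    \<Longrightarrow> (((A, S), x), ((glide \<Gamma> T A, S), x')) \<in> cube_gluing \<Gamma>"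

definition cube_equiv :: "('v, 'e) mgraph \<Rightarrow> 'e cube_point rel" where
  "cube_equiv \<Gamma> = (cube_gluing \<Gamma> \<union> (cube_gluing \<Gamma>)\<inverse>)\<^sup>*"

definition cubed_complex :: "('v, 'e) mgraph \<Rightarrow> 'e cube_point set topology" where
  "cubed_complex \<Gamma> = quotient_space (cubes_space \<Gamma>) (cube_equiv \<Gamma>)"

definition dimer_complex :: "('v, 'e) mgraph \<Rightarrow> 'e cube_point set topology" where
  "dimer_complex \<Gamma> = subtopology (cubed_complex \<Gamma>)
     {cube_equiv \<Gamma> `` {((A, S), x)} | A S x. (A, S) \<in> based_cubes \<Gamma> \<and> x \<in> S \<rightarrow>\<^sub>E {0..1} \<and>
        (\<forall>T\<subseteq>S. glide \<Gamma> T A \<in> dimer_coverings \<Gamma>)}"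

text \<open>The 0-cell of the cubed complex given by \<open>A\<close>; \<open>\<lambda>_. undefined\<close> is the point of \<open>[0,1]\<^sup>\<emptyset>\<close>.\<close>

definition zero_cell :: "('v, 'e) mgraph \<Rightarrow> 'e set \<Rightarrow> 'e cube_point set" where
  "zero_cell \<Gamma> A = cube_equiv \<Gamma> `` {((A, {}), \<lambda>_. undefined)}"


section \<open>Groupoids\<close>

text \<open>\<open>gcomp G a b c f g\<close> composes \<open>f : a \<rightarrow> b\<close> with \<open>g : b \<rightarrow> c\<close>, in this order.\<close>

record ('o, 'm) groupoid =
  gobj :: "'o set"
  ghom :: "'o \<Rightarrow> 'o \<Rightarrow> 'm set"
  gcomp :: "'o \<Rightarrow> 'o \<Rightarrow> 'o \<Rightarrow> 'm \<Rightarrow> 'm \<Rightarrow> 'm"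
  gid :: "'o \<Rightarrow> 'm"

definition is_groupoid :: "('o, 'm) groupoid \<Rightarrow> bool" where
  "is_groupoid G \<longleftrightarrow>
     (\<forall>a\<in>gobj G. gid G a \<in> ghom G a a) \<and>
     (\<forall>a\<in>gobj G. \<forall>b\<in>gobj G. \<forall>c\<in>gobj G. \<forall>f\<in>ghom G a b. \<forall>g\<in>ghom G b c.
        gcomp G a b c f g \<in> ghom G a c) \<and>
     (\<forall>a\<in>gobj G. \<forall>b\<in>gobj G. \<forall>f\<in>ghom G a b.
        gcomp G a a b (gid G a) f = f \<and> gcomp G a b b f (gid G b) = f) \<and>
     (\<forall>a\<in>gobj G. \<forall>b\<in>gobj G. \<forall>c\<in>gobj G. \<forall>d\<in>gobj G.
        \<forall>f\<in>ghom G a b. \<forall>g\<in>ghom G b c. \<forall>h\<in>ghom G c d.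
        gcomp G a c d (gcomp G a b c f g) h = gcomp G a b d f (gcomp G b c d g h)) \<and>
     (\<forall>a\<in>gobj G. \<forall>b\<in>gobj G. \<forall>f\<in>ghom G a b. \<exists>g\<in>ghom G b a.
        gcomp G a b a f g = gid G a \<and> gcomp G b a b g f = gid G b)"

text \<open>Isomorphisms that are the identity on objects.\<close>

definition groupoid_iso :: "('o, 'm) groupoid \<Rightarrow> ('o, 'n) groupoid \<Rightarrow> ('o \<Rightarrow> 'o \<Rightarrow> 'm \<Rightarrow> 'n) \<Rightarrow> bool"
  where "groupoid_iso G H F \<longleftrightarrow> gobj G = gobj H \<and>
     (\<forall>a\<in>gobj G. \<forall>b\<in>gobj G. bij_betw (F a b) (ghom G a b) (ghom H a b)) \<and>
     (\<forall>a\<in>gobj G. F a a (gid G a) = gid H a) \<and>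
     (\<forall>a\<in>gobj G. \<forall>b\<in>gobj G. \<forall>c\<in>gobj G. \<forall>f\<in>ghom G a b. \<forall>g\<in>ghom G b c.
        F a c (gcomp G a b c f g) = gcomp H a b c (F a b f) (F b c g))"


section \<open>Presentations of groupoids\<close>

text \<open>
  Words in generators \<open>g : src g \<rightarrow> tgt g\<close> and their formal inverses; the letter \<open>(g, True)\<close> stands
  for \<open>g\<close> and \<open>(g, False)\<close> for its inverse.
\<close>

fun is_word :: "'o set \<Rightarrow> 'g set \<Rightarrow> ('g \<Rightarrow> 'o) \<Rightarrow> ('g \<Rightarrow> 'o) \<Rightarrow> 'o \<Rightarrow> ('g \<times> bool) list \<Rightarrow> 'o \<Rightarrow> bool"
  where
  "is_word Ob I src tgt a [] b \<longleftrightarrow> a \<in> Ob \<and> a = b"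
| "is_word Ob I src tgt a ((g, p) # w) b \<longleftrightarrow> g \<in> I \<and> a \<in> Ob \<and>
     a = (if p then src g else tgt g) \<and> is_word Ob I src tgt (if p then tgt g else src g) w b"

text \<open>The smallest congruence that makes \<open>(g, False)\<close> inverse to \<open>(g, True)\<close> and contains \<open>R\<close>.\<close>

inductive word_cong ::
  "'o set \<Rightarrow> 'g set \<Rightarrow> ('g \<Rightarrow> 'o) \<Rightarrow> ('g \<Rightarrow> 'o) \<Rightarrow> (('g \<times> bool) list \<times> ('g \<times> bool) list) set \<Rightarrow>
   'o \<Rightarrow> 'o \<Rightarrow> ('g \<times> bool) list \<Rightarrow> ('g \<times> bool) list \<Rightarrow> bool"
  for Ob I src tgt R where
  refl: "is_word Ob I src tgt a u b \<Longrightarrow> word_cong Ob I src tgt R a b u u"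
| sym: "word_cong Ob I src tgt R a b u v \<Longrightarrow> word_cong Ob I src tgt R a b v u"
| trans: "\<lbrakk>word_cong Ob I src tgt R a b u v; word_cong Ob I src tgt R a b v w\<rbrakk>
    \<Longrightarrow> word_cong Ob I src tgt R a b u w"
| append: "\<lbrakk>word_cong Ob I src tgt R a b u u'; word_cong Ob I src tgt R b c v v'\<rbrakk>
    \<Longrightarrow> word_cong Ob I src tgt R a c (u @ v) (u' @ v')"
| cancel: "is_word Ob I src tgt a [(g, p), (g, \<not> p)] a
    \<Longrightarrow> word_cong Ob I src tgt R a a [(g, p), (g, \<not> p)] []"
| relation: "\<lbrakk>(u, v) \<in> R; is_word Ob I src tgt a u b; is_word Ob I src tgt a v b\<rbrakk>
    \<Longrightarrow> word_cong Ob I src tgt R a b u v"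

definition presented_groupoid ::
  "'o set \<Rightarrow> 'g set \<Rightarrow> ('g \<Rightarrow> 'o) \<Rightarrow> ('g \<Rightarrow> 'o) \<Rightarrow> (('g \<times> bool) list \<times> ('g \<times> bool) list) set \<Rightarrow>
   ('o, ('g \<times> bool) list set) groupoid" where
  "presented_groupoid Ob I src tgt R =
    (let cls = (\<lambda>a b. {(u, v). word_cong Ob I src tgt R a b u v}) in
     \<lparr>gobj = Ob,
      ghom = (\<lambda>a b. {w. is_word Ob I src tgt a w b} // cls a b),
      gcomp = (\<lambda>a b c U V. \<Union>u\<in>U. \<Union>v\<in>V. cls a c `` {u @ v}),
      gid = (\<lambda>a. cls a a `` {[]})\<rparr>)"

text \<open>
  The groupoid \<open>G\<close> is presented, over its set of objects, by the generators \<open>z g : src g \<rightarrow> tgt g\<close>,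
  \<open>g \<in> I\<close>, and the relations \<open>R\<close>.
\<close>

definition groupoid_presentation ::
  "('o, 'm) groupoid \<Rightarrow> 'g set \<Rightarrow> ('g \<Rightarrow> 'o) \<Rightarrow> ('g \<Rightarrow> 'o) \<Rightarrow> ('g \<Rightarrow> 'm) \<Rightarrow>
   (('g \<times> bool) list \<times> ('g \<times> bool) list) set \<Rightarrow> bool" where
  "groupoid_presentation G I src tgt z R \<longleftrightarrow> is_groupoid G \<and>
     (\<forall>g\<in>I. src g \<in> gobj G \<and> tgt g \<in> gobj G \<and> z g \<in> ghom G (src g) (tgt g)) \<and>
     (\<forall>(u, v)\<in>R. \<exists>a b. is_word (gobj G) I src tgt a u b \<and> is_word (gobj G) I src tgt a v b) \<and>
     (\<exists>F. groupoid_iso (presented_groupoid (gobj G) I src tgt R) G F \<and>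
        (\<forall>g\<in>I. F (src g) (tgt g)
           {w. word_cong (gobj G) I src tgt R (src g) (tgt g) [(g, True)] w} = z g))"


section \<open>Fundamental groupoids\<close>

definition path_mult :: "(real \<Rightarrow> 'a) \<Rightarrow> (real \<Rightarrow> 'a) \<Rightarrow> real \<Rightarrow> 'a" where
  "path_mult p q = (\<lambda>t. if t \<le> 1/2 then p (2 * t) else q (2 * t - 1))"

definition paths_between :: "'a topology \<Rightarrow> 'a \<Rightarrow> 'a \<Rightarrow> (real \<Rightarrow> 'a) set" where
  "paths_between X x y = {p. pathin X p \<and> p 0 = x \<and> p 1 = y}"

definition path_homotopy :: "'a topology \<Rightarrow> 'a \<Rightarrow> 'a \<Rightarrow> (real \<Rightarrow> 'a) rel" where
  "path_homotopy X x y =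
     {(p, q). homotopic_with (\<lambda>r. r 0 = x \<and> r 1 = y) (top_of_set {0..1}) X p q}"

text \<open>
  The fundamental groupoid of \<open>X\<close> based at the points \<open>pt a\<close>, \<open>a \<in> Ob\<close>; its objects are the
  labels \<open>a\<close> of the base points.
\<close>

definition fundamental_groupoid ::
  "'a topology \<Rightarrow> 'o set \<Rightarrow> ('o \<Rightarrow> 'a) \<Rightarrow> ('o, (real \<Rightarrow> 'a) set) groupoid" where
  "fundamental_groupoid X Ob pt =
     \<lparr>gobj = Ob,
      ghom = (\<lambda>a b. paths_between X (pt a) (pt b) // path_homotopy X (pt a) (pt b)),
      gcomp = (\<lambda>a b c P Q.
        \<Union>p\<in>P. \<Union>q\<in>Q. path_homotopy X (pt a) (pt c) `` {path_mult p q}),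
      gid = (\<lambda>a. path_homotopy X (pt a) (pt a) `` {\<lambda>_. pt a})\<rparr>"

definition dimer_groupoid :: "('v, 'e) mgraph \<Rightarrow> ('e set, (real \<Rightarrow> 'e cube_point set) set) groupoid"
  where "dimer_groupoid \<Gamma> =
    fundamental_groupoid (dimer_complex \<Gamma>) (dimer_coverings \<Gamma>) (zero_cell \<Gamma>)"

end

theory Submission
  imports Defs
begin

text \<open>
  The dimer complex is a polyhedron of fractional matchings. Regard a dimer covering as a 0/1-valued
  weight on the edges. A point of a cube based at \<open>A\<close> becomes a weight as well: on a cycle with
  coordinate \<open>t\<close> the edges of \<open>A\<close> get weight \<open>1 - t\<close> and the other edges weight \<open>t\<close>. These weights
  have total 1 at every vertex of the graph, at most two edges at a vertex have positive weight, and
  the support contains a dimer covering. Let \<open>model\<close> be the set of all weights with these properties.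
  The edges of fractional weight of such a \<open>w\<close> form a cyclic set; it splits into independent circles
  (\<open>cyclic_set_decompose\<close>), which are even because a dimer covering inside the support alternates
  along them. So \<open>w\<close> comes from a cube (\<open>model_point\<close>), and circles and coordinates can be read off
  from \<open>w\<close> (\<open>interior_points_equiv\<close>). The resulting continuous bijection from the compact dimer
  complex onto the Hausdorff space \<open>model\<close> is a homeomorphism (\<open>homeomorphic_dimer_complex\<close>).

  Let \<open>star A\<close> be the set of \<open>w\<close> in \<open>model\<close> that are positive on the dimer covering \<open>A\<close>. The stars form
  an open cover. A straight segment from \<open>w\<close> to a point of \<open>model\<close> whose support is contained in that
  of \<open>w\<close> stays in every star that contains both ends; hence \<open>star A\<close> is star-shaped about \<open>A\<close>, and
  \<open>star A \<inter> star B\<close> about a point with support \<open>A \<union> B\<close>. Three stars have a common point exactly when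
  the triple is flat (\<open>flat_iff_stars_meet\<close>): at a vertex a common point has at most two edges of
  positive weight, and conversely the barycentre of a flat triple is a common point. Thus the
  generators and relations of the theorem are the edges and the triangles of the nerve of this cover.

  What remains is general topology (\<open>nerve_presentation\<close>). Let an open cover have pairwise
  intersections that are nonempty and path connected, and members in which paths with common end
  points are homotopic. Then \<open>z\<^bsub>a,b\<^esub>\<close>, the class of a path that runs from the base point of the member
  \<open>a\<close> to the base point of \<open>b\<close> by crossing over once in the intersection, generate the fundamental
  groupoid, and the relations of triangles suffice. Indeed, cut a path into pieces that lie in single
  members of the cover; the names of these members spell a word. Two cuttings of one path give
  congruent words, since at each cutting point at most three members are involved at a time
  (\<open>trace_word_unique\<close>). Along a homotopy the same cutting is valid for nearby paths, so the word does
  not change up to congruence (\<open>trace_word_homotopic\<close>). This inverts the map from words to classes of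
  paths.
\<close>


section \<open>Paths up to homotopy\<close>

text \<open>
  The unit interval is convex, so reparametrizations with equal end points are homotopic. Constant
  paths, inverses and subdivisions below are all instances; this keeps them valid in arbitrary
  topological spaces, without straight lines in the target.
\<close>

lemma homotopic_paths_in_interval:
  fixes p :: "real \<Rightarrow> 'a::topological_space"
  assumes p: "path p" "path_image p \<subseteq> S"
    and g: "path g" "path_image g \<subseteq> {0..1}" and h: "path h" "path_image h \<subseteq> {0..1}"
    and ends: "pathstart g = pathstart h" "pathfinish g = pathfinish h"
  shows "homotopic_paths S (p \<circ> g) (p \<circ> h)"
proof -
  have "homotopic_paths {0..1} g h"
  proof (rule homotopic_paths_linear)
    fix t :: real assume "t \<in> {0..1}"
    then have "g t \<in> {0..1}" "h t \<in> {0..1}"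
      using g(2) h(2) by (force simp: path_image_def)+
    then show "closed_segment (g t) (h t) \<subseteq> {0..1}"
      by (meson closed_segment_subset convex_real_interval(5))
  qed (use g h ends in auto)
  then show ?thesis
    using p by (intro homotopic_paths_continuous_image[where S = "{0..1}"])
      (auto simp: path_def path_image_def)
qed

lemma path_const: "path (\<lambda>_. x)" and path_image_const: "path_image (\<lambda>_. x) = {x}"
  and pathstart_const: "pathstart (\<lambda>_. x) = x" and pathfinish_const: "pathfinish (\<lambda>_. x) = x"
  by (auto simp: path_def path_image_def pathstart_def pathfinish_def)

lemma path_image_linepath_01:
  "0 \<le> s \<Longrightarrow> s \<le> 1 \<Longrightarrow> 0 \<le> t \<Longrightarrow> t \<le> 1 \<Longrightarrow> path_image (linepath s t) \<subseteq> {0..1::real}"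
  by (auto simp: closed_segment_eq_real_ivl split: if_splits)

definition path_in :: "'a::topological_space set \<Rightarrow> (real \<Rightarrow> 'a) \<Rightarrow> 'a \<Rightarrow> 'a \<Rightarrow> bool" where
  "path_in S p x y \<longleftrightarrow> path p \<and> path_image p \<subseteq> S \<and> pathstart p = x \<and> pathfinish p = y"

lemma path_in_join: "path_in S p x y \<Longrightarrow> path_in S q y z \<Longrightarrow> path_in S (p +++ q) x z"
  by (auto simp: path_in_def subset_path_image_join intro!: path_join_imp)

lemma path_in_reverse: "path_in S p x y \<Longrightarrow> path_in S (reversepath p) y x"
  by (auto simp: path_in_def)

lemma path_in_const: "x \<in> S \<Longrightarrow> path_in S (\<lambda>_. x) x x"
  by (auto simp: path_in_def path_const path_image_const pathstart_const pathfinish_const)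

lemma path_in_mono: "path_in S p x y \<Longrightarrow> S \<subseteq> T \<Longrightarrow> path_in T p x y"
  by (auto simp: path_in_def)

lemma path_in_segment:
  assumes "path p" "0 \<le> s" "s \<le> t" "t \<le> 1" "p ` {s..t} \<subseteq> S"
  shows "path_in S (p \<circ> linepath s t) (p s) (p t)"
proof -
  have "path (p \<circ> linepath s t)"
    using assms by (intro path_continuous_image path_linepath)
      (auto simp: path_def closed_segment_eq_real_ivl elim: continuous_on_subset)
  moreover have "path_image (p \<circ> linepath s t) \<subseteq> S"
    using assms by (auto simp: path_image_compose closed_segment_eq_real_ivl)
  ultimately show ?thesis
    by (simp add: path_in_def pathstart_compose pathfinish_compose)
qed

lemma path_in_homotopic:
  "homotopic_paths S p q \<Longrightarrow> path_in S p x y \<Longrightarrow> path_in S q x y"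
  by (metis homotopic_paths_imp_path homotopic_paths_imp_pathfinish homotopic_paths_imp_pathstart
      homotopic_paths_imp_subset path_in_def)

lemma path_in_refl: "path_in S p x y \<Longrightarrow> homotopic_paths S p p"
  by (simp add: path_in_def)

lemma homotopic_segment_split:
  assumes "path p" "path_image p \<subseteq> S" "0 \<le> s" "s \<le> t" "t \<le> u" "u \<le> 1"
  shows "homotopic_paths S (p \<circ> linepath s u) ((p \<circ> linepath s t) +++ (p \<circ> linepath t u))"
proof -
  have "homotopic_paths S (p \<circ> linepath s u) (p \<circ> (linepath s t +++ linepath t u))"
    using assms
    by (intro homotopic_paths_in_interval subset_path_image_join path_image_linepath_01 path_join_imp)
      auto
  then show ?thesis
    by (simp add: path_compose_join)
qed

lemma compose_linepath_01: "p \<circ> linepath 0 1 = (p :: real \<Rightarrow> 'a)"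
  by (auto simp: linepath_def)

lemma homotopic_join_const:
  assumes p: "path_in S p x y"
  shows "homotopic_paths S (p +++ (\<lambda>_. y)) p" "homotopic_paths S ((\<lambda>_. x) +++ p) p"
    "homotopic_paths S (p +++ reversepath p) (\<lambda>_. x)"
    "homotopic_paths S (reversepath p +++ p) (\<lambda>_. y)"
proof -
  have e: "p 0 = x" "p 1 = y"
    using p by (auto simp: path_in_def pathstart_def pathfinish_def)
  have c: "p \<circ> linepath 0 0 = (\<lambda>_. x)" "p \<circ> linepath 1 1 = (\<lambda>_. y)"
    "p \<circ> linepath 1 0 = reversepath p"
    using e by (auto simp: linepath_def reversepath_def)
  have main: "homotopic_paths S (p \<circ> (linepath r s +++ linepath s t)) (p \<circ> linepath r t)"
    if "r \<in> {0,1}" "s \<in> {0,1}" "t \<in> {0,1}" for r s t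
    using p that
    by (intro homotopic_paths_in_interval subset_path_image_join path_image_linepath_01 path_join_imp)
      (auto simp: path_in_def)
  show "homotopic_paths S (p +++ (\<lambda>_. y)) p"
    using main[of 0 1 1] by (simp add: path_compose_join c compose_linepath_01)
  show "homotopic_paths S ((\<lambda>_. x) +++ p) p"
    using main[of 0 0 1] by (simp add: path_compose_join c compose_linepath_01)
  show "homotopic_paths S (p +++ reversepath p) (\<lambda>_. x)"
    using main[of 0 1 0] by (simp add: path_compose_join c compose_linepath_01)
  show "homotopic_paths S (reversepath p +++ p) (\<lambda>_. y)"
    using main[of 1 0 1] by (simp add: path_compose_join c compose_linepath_01)
qed

lemma homotopic_assoc:
  "path_in S p x y \<Longrightarrow> path_in S q y z \<Longrightarrow> path_in S r z w \<Longrightarrow>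
    homotopic_paths S ((p +++ q) +++ r) (p +++ (q +++ r))"
  by (rule homotopic_paths_sym, rule homotopic_paths_assoc) (auto simp: path_in_def)

lemma homotopic_join:
  "homotopic_paths S p p' \<Longrightarrow> homotopic_paths S q q' \<Longrightarrow> path_in S p x y \<Longrightarrow> path_in S q y z \<Longrightarrow>
    homotopic_paths S (p +++ q) (p' +++ q')"
  by (rule homotopic_paths_join) (auto simp: path_in_def)

text \<open>This detour is the tool for moving the crossing points of edges and for cutting paths into pieces.\<close>

lemma homotopic_detour:
  assumes p: "path_in S p x y" and k: "path_in S k w y" and q: "path_in S q y z"
  shows "homotopic_paths S (p +++ q) ((p +++ reversepath k) +++ (k +++ q))"
proof -
  note rk = path_in_reverse[OF k]
  note kq = path_in_join[OF k q]
  have "homotopic_paths S ((p +++ reversepath k) +++ (k +++ q)) (p +++ (reversepath k +++ (k +++ q)))"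
    by (rule homotopic_assoc[OF p rk kq])
  also have "homotopic_paths S \<dots> (p +++ ((reversepath k +++ k) +++ q))"
    by (rule homotopic_join[OF path_in_refl[OF p] _ p path_in_join[OF rk kq]])
      (rule homotopic_paths_sym[OF homotopic_assoc[OF rk k q]])
  also have "homotopic_paths S \<dots> (p +++ ((\<lambda>_. y) +++ q))"
    by (rule homotopic_join[OF path_in_refl[OF p] _ p path_in_join[OF path_in_join[OF rk k] q]])
      (rule homotopic_join[OF homotopic_join_const(4)[OF k] path_in_refl[OF q] path_in_join[OF rk k] q])
  also have "homotopic_paths S \<dots> (p +++ q)"
  proof (rule homotopic_join[OF path_in_refl[OF p] homotopic_join_const(2)[OF q] p])
    show "path_in S ((\<lambda>_. y) +++ q) y z"
      using homotopic_join_const(2)[OF q] path_in_homotopic[OF homotopic_paths_sym q] by blast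
  qed
  finally show ?thesis
    by (rule homotopic_paths_sym)
qed

text \<open>
  A contraction to \<open>c\<close>, applied to a path, fills a square whose bottom edge is the path, whose top edge
  is constant, and whose vertical edges are the traces of the end points. The bottom edge is homotopic
  to the other three, which depend on the end points only.
\<close>

lemma homotopic_paths_contraction:
  fixes S :: "'a::topological_space set" and H :: "real \<times> 'a \<Rightarrow> 'a"
  assumes H: "continuous_on ({0..1} \<times> S) H" "H \<in> {0..1} \<times> S \<rightarrow> S"
    and H0: "\<And>x. x \<in> S \<Longrightarrow> H (0, x) = x" and H1: "\<And>x. x \<in> S \<Longrightarrow> H (1, x) = c"
    and p: "path_in S p x y" and q: "path_in S q x y"
  shows "homotopic_paths S p q"
proof -
  have main: "homotopic_paths S p ((\<lambda>t. H (t, x)) +++ (\<lambda>_. c) +++ reversepath (\<lambda>t. H (t, y)))"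
    if p: "path_in S p x y" for p
  proof -
    define Q :: "(real \<times> real) set" where "Q = {0..1} \<times> {0..1}"
    define G where "G = (\<lambda>(t, s). H (t, p s))"
    have e: "p 0 = x" "p 1 = y" and pS: "p s \<in> S" if "s \<in> {0..1}" for s
      using p that by (auto simp: path_in_def pathstart_def pathfinish_def path_image_def)
    have "convex Q"
      unfolding Q_def by (intro convex_Times) auto
    let ?b = "linepath (0::real,0::real) (0,1)"
    let ?r = "linepath (0::real,0::real) (1,0) +++ linepath (1,0) (1,1) +++ linepath (1,1) (0,1)"
    have in_Q: "path_image (linepath a b) \<subseteq> Q" if "a \<in> Q" "b \<in> Q" for a b
      using closed_segment_subset[OF that \<open>convex Q\<close>] by simp
    have 1: "homotopic_paths Q ?b ?r"
    proof (rule homotopic_paths_linear)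
      fix t :: real assume t: "t \<in> {0..1}"
      have "path_image ?b \<subseteq> Q" "path_image ?r \<subseteq> Q"
        by (intro subset_path_image_join in_Q; simp add: Q_def)+
      then have "?b t \<in> Q" "?r t \<in> Q"
        using t by (auto simp: path_image_def)
      then show "closed_segment (?b t) (?r t) \<subseteq> Q"
        using \<open>convex Q\<close> by (simp add: closed_segment_subset)
    qed (auto simp: path_join_imp)
    have "continuous_on Q (\<lambda>z. p (snd z))"
      by (rule continuous_on_compose2[of "{0..1}" p])
        (use p in \<open>auto simp: path_in_def path_def Q_def intro: continuous_on_snd\<close>)
    then have "continuous_on Q (\<lambda>z. (fst z, p (snd z)))"
      by (intro continuous_on_Pair continuous_on_fst continuous_on_id)
    then have contG: "continuous_on Q G"
      using continuous_on_compose2[OF H(1), of Q "\<lambda>z. (fst z, p (snd z))"] pS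
      by (force simp: G_def Q_def split_beta)
    have "homotopic_paths S (G \<circ> ?b) (G \<circ> ?r)"
      by (rule homotopic_paths_continuous_image[OF 1 contG])
        (use H(2) pS in \<open>auto simp: G_def Q_def\<close>)
    then have h: "homotopic_paths S (G \<circ> ?b)
        ((G \<circ> linepath (0,0) (1,0)) +++ (G \<circ> linepath (1,0) (1,1)) +++ (G \<circ> linepath (1,1) (0,1)))"
      by (simp add: path_compose_join)
    have pp: "path p" "path_image p \<subseteq> S"
      using p by (auto simp: path_in_def)
    have "homotopic_paths S p (G \<circ> ?b)"
      by (rule homotopic_paths_eq[OF pp]) (use pS H0 in \<open>auto simp: G_def linepath_def\<close>)
    moreover
    let ?m = "(\<lambda>t. H (t, x)) +++ (\<lambda>_. c) +++ reversepath (\<lambda>t. H (t, y))"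
    have "homotopic_paths S ((G \<circ> linepath (0,0) (1,0)) +++ (G \<circ> linepath (1,0) (1,1)) +++
        (G \<circ> linepath (1,1) (0,1))) ?m"
      by (rule homotopic_paths_eq)
       (use h in \<open>auto simp: homotopic_paths_imp_path dest: homotopic_paths_imp_subset,
         use e pS H1 in \<open>auto simp: G_def linepath_def joinpaths_def reversepath_def\<close>\<close>)
    ultimately show ?thesis
      using h homotopic_paths_trans by blast
  qed
  show ?thesis
    using main[OF p] main[OF q] homotopic_paths_sym homotopic_paths_trans by blast
qed


section \<open>Isomorphisms of groupoids\<close>

lemma UN_quotient_class:
  assumes "equiv A r" "equiv B s" "\<And>x y. (x, y) \<in> r \<Longrightarrow> (f x, f y) \<in> s" "a \<in> A"
  shows "(\<Union>x\<in>r `` {a}. s `` {f x}) = s `` {f a}"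
proof -
  have "s `` {f x} = s `` {f a}" if "x \<in> r `` {a}" for x
    using that assms(3) equiv_class_eq[OF assms(2)] by fastforce
  moreover have "a \<in> r `` {a}"
    using equiv_class_self[OF assms(1,4)] .
  ultimately show ?thesis by blast
qed

lemma UN_quotient_class2:
  assumes "equiv A r" "equiv B s" "equiv C t"
    "\<And>x x' y y'. (x, x') \<in> r \<Longrightarrow> (y, y') \<in> s \<Longrightarrow> (f x y, f x' y') \<in> t" "a \<in> A" "b \<in> B"
  shows "(\<Union>x\<in>r `` {a}. \<Union>y\<in>s `` {b}. t `` {f x y}) = t `` {f a b}"
proof -
  have "t `` {f x y} = t `` {f a b}" if "x \<in> r `` {a}" "y \<in> s `` {b}" for x y
    using that assms(4)[of a x b y] equiv_class_eq[OF assms(3), of "f a b" "f x y"] by simp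
  moreover have "a \<in> r `` {a}" "b \<in> s `` {b}"
    using equiv_class_self[OF assms(1,5)] equiv_class_self[OF assms(2,6)] by simp_all
  ultimately show ?thesis by blast
qed

text \<open>
  Both comparison maps below, from words to paths and from paths in one space to paths in another,
  are induced on classes by a map on representatives.
\<close>

lemma bij_betw_quotient:
  assumes A: "equiv A r" and B: "equiv B s" and f: "\<And>x. x \<in> A \<Longrightarrow> f x \<in> B"
    and iff: "\<And>x y. x \<in> A \<Longrightarrow> y \<in> A \<Longrightarrow> (x, y) \<in> r \<longleftrightarrow> (f x, f y) \<in> s"
    and onto: "\<And>y. y \<in> B \<Longrightarrow> \<exists>x\<in>A. (f x, y) \<in> s"
  shows "bij_betw (\<lambda>P. \<Union>x\<in>P. s `` {f x}) (A // r) (B // s)"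
proof -
  have rA: "x \<in> A \<and> y \<in> A" if "(x, y) \<in> r" for x y
    using that equiv_type[OF A] by blast
  have cls: "(\<Union>x\<in>r `` {a}. s `` {f x}) = s `` {f a}" if "a \<in> A" for a
    by (rule UN_quotient_class[OF A B _ that]) (use rA iff in blast)
  show ?thesis
  proof (rule bij_betwI')
    fix P Q assume "P \<in> A // r" "Q \<in> A // r"
    then obtain a b where P: "P = r `` {a}" "a \<in> A" and Q: "Q = r `` {b}" "b \<in> A"
      by (auto elim!: quotientE)
    show "(\<Union>x\<in>P. s `` {f x}) = (\<Union>x\<in>Q. s `` {f x}) \<longleftrightarrow> P = Q"
      using P Q cls iff f eq_equiv_class_iff[OF A] eq_equiv_class_iff[OF B] by simp
  next
    fix P assume "P \<in> A // r"
    then obtain a where "P = r `` {a}" "a \<in> A"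
      by (auto elim!: quotientE)
    then show "(\<Union>x\<in>P. s `` {f x}) \<in> B // s"
      using cls f by (simp add: quotientI)
  next
    fix Q assume "Q \<in> B // s"
    then obtain b where b: "Q = s `` {b}" "b \<in> B"
      by (auto elim!: quotientE)
    then obtain a where "a \<in> A" "(f a, b) \<in> s"
      using onto by blast
    then show "\<exists>P\<in>A // r. Q = (\<Union>x\<in>P. s `` {f x})"
      using b cls equiv_class_eq[OF B] by (metis quotientI)
  qed
qed

lemma groupoid_iso_bij:
  "groupoid_iso G H F \<Longrightarrow> a \<in> gobj G \<Longrightarrow> b \<in> gobj G \<Longrightarrow> bij_betw (F a b) (ghom G a b) (ghom H a b)"
  unfolding groupoid_iso_def by blast

lemma groupoid_iso_mem:
  "groupoid_iso G H F \<Longrightarrow> a \<in> gobj G \<Longrightarrow> b \<in> gobj G \<Longrightarrow> f \<in> ghom G a b \<Longrightarrow> F a b f \<in> ghom H a b"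
  by (rule bspec[OF bij_betwE[OF groupoid_iso_bij]])

lemma groupoid_iso_surj:
  assumes "groupoid_iso G H F" "a \<in> gobj G" "b \<in> gobj G" "h \<in> ghom H a b"
  obtains f where "f \<in> ghom G a b" "h = F a b f"
  using groupoid_iso_bij[OF assms(1-3)] assms(4) that unfolding bij_betw_def by blast

lemma groupoid_iso_gcomp:
  "groupoid_iso G H F \<Longrightarrow> a \<in> gobj G \<Longrightarrow> b \<in> gobj G \<Longrightarrow> c \<in> gobj G \<Longrightarrow>
    f \<in> ghom G a b \<Longrightarrow> g \<in> ghom G b c \<Longrightarrow>
    F a c (gcomp G a b c f g) = gcomp H a b c (F a b f) (F b c g)"
  unfolding groupoid_iso_def by blast

lemma is_groupoid_gcomp:
  "is_groupoid G \<Longrightarrow> a \<in> gobj G \<Longrightarrow> b \<in> gobj G \<Longrightarrow> c \<in> gobj G \<Longrightarrow>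
    f \<in> ghom G a b \<Longrightarrow> g \<in> ghom G b c \<Longrightarrow> gcomp G a b c f g \<in> ghom G a c"
  unfolding is_groupoid_def by blast

lemma is_groupoid_inverse:
  assumes "is_groupoid G" "a \<in> gobj G" "b \<in> gobj G" "f \<in> ghom G a b"
  obtains g where "g \<in> ghom G b a" "gcomp G a b a f g = gid G a" "gcomp G b a b g f = gid G b"
  using assms unfolding is_groupoid_def by meson

lemma is_groupoid_iso:
  assumes iso: "groupoid_iso G H F" and G: "is_groupoid G"
  shows "is_groupoid H"
proof -
  have ob: "gobj H = gobj G"
    using iso by (simp add: groupoid_iso_def)
  have id: "gid H a = F a a (gid G a)" if "a \<in> gobj G" for a
    using iso that by (simp add: groupoid_iso_def)
  note comp = groupoid_iso_gcomp[OF iso, symmetric]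
  note mem = groupoid_iso_mem[OF iso]
  have idG: "gid G a \<in> ghom G a a" if "a \<in> gobj G" for a
    using G that by (simp add: is_groupoid_def)
  note compG = is_groupoid_gcomp[OF G]
  show ?thesis
    unfolding is_groupoid_def ob
  proof (intro conjI ballI)
    fix a assume a: "a \<in> gobj G"
    show "gid H a \<in> ghom H a a"
      using a id idG mem by simp
  next
    fix a b c f g assume "a \<in> gobj G" "b \<in> gobj G" "c \<in> gobj G" "f \<in> ghom H a b" "g \<in> ghom H b c"
    then show "gcomp H a b c f g \<in> ghom H a c"
      by (metis groupoid_iso_surj[OF iso] comp compG mem)
  next
    fix a b f assume ab: "a \<in> gobj G" "b \<in> gobj G" and f: "f \<in> ghom H a b"
    obtain f' where f': "f' \<in> ghom G a b" "f = F a b f'"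
      using groupoid_iso_surj[OF iso ab f] .
    have "gcomp G a a b (gid G a) f' = f'" "gcomp G a b b f' (gid G b) = f'"
      using G ab f' by (auto simp: is_groupoid_def)
    then show "gcomp H a a b (gid H a) f = f" "gcomp H a b b f (gid H b) = f"
      using ab f' id idG comp[of a a b] comp[of a b b] by simp_all
    obtain g' where g': "g' \<in> ghom G b a" "gcomp G a b a f' g' = gid G a" "gcomp G b a b g' f' = gid G b"
      using is_groupoid_inverse[OF G ab f'(1)] .
    show "\<exists>g\<in>ghom H b a. gcomp H a b a f g = gid H a \<and> gcomp H b a b g f = gid H b"
      using ab f' g' id comp[of a b a f' g'] comp[of b a b g' f'] mem[of b a g']
      by (intro bexI[of _ "F b a g'"]) simp_all
  next
    fix a b c d f g h assume ob: "a \<in> gobj G" "b \<in> gobj G" "c \<in> gobj G" "d \<in> gobj G"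
      and fgh: "f \<in> ghom H a b" "g \<in> ghom H b c" "h \<in> ghom H c d"
    obtain f' g' h' where *: "f' \<in> ghom G a b" "f = F a b f'" "g' \<in> ghom G b c" "g = F b c g'"
      "h' \<in> ghom G c d" "h = F c d h'"
      using groupoid_iso_surj[OF iso] ob fgh by metis
    moreover have "gcomp G a c d (gcomp G a b c f' g') h' = gcomp G a b d f' (gcomp G b c d g' h')"
      using G ob * by (simp add: is_groupoid_def)
    ultimately show "gcomp H a c d (gcomp H a b c f g) h = gcomp H a b d f (gcomp H b c d g h)"
      using ob comp compG by simp
  qed
qed

lemma groupoid_iso_trans:
  assumes F: "groupoid_iso G H F" and E: "groupoid_iso H L E"
  shows "groupoid_iso G L (\<lambda>a b. E a b \<circ> F a b)"
proof -
  have ob: "gobj H = gobj G" "gobj L = gobj G"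
    using F E by (simp_all add: groupoid_iso_def)
  have id: "F a a (gid G a) = gid H a" "E a a (gid H a) = gid L a" if "a \<in> gobj G" for a
    using F E that ob unfolding groupoid_iso_def by auto
  have bij: "bij_betw (E a b \<circ> F a b) (ghom G a b) (ghom L a b)"
    if "a \<in> gobj G" "b \<in> gobj G" for a b
    using groupoid_iso_bij[OF F that] groupoid_iso_bij[OF E] that ob by (auto intro: bij_betw_trans)
  show ?thesis
    unfolding groupoid_iso_def ob
    using id bij groupoid_iso_mem[OF F] groupoid_iso_gcomp[OF F] groupoid_iso_gcomp[OF E] ob by simp
qed

lemma groupoid_presentation_iso:
  assumes P: "groupoid_presentation G I src tgt z R" and E: "groupoid_iso G H E"
  shows "groupoid_presentation H I src tgt (\<lambda>g. E (src g) (tgt g) (z g)) R"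
proof -
  have ob: "gobj H = gobj G"
    using E by (simp add: groupoid_iso_def)
  obtain F where F: "groupoid_iso (presented_groupoid (gobj G) I src tgt R) G F"
    "\<forall>g\<in>I. F (src g) (tgt g)
       {w. word_cong (gobj G) I src tgt R (src g) (tgt g) [(g, True)] w} = z g"
    using P by (auto simp: groupoid_presentation_def)
  have z: "src g \<in> gobj G" "tgt g \<in> gobj G" "z g \<in> ghom G (src g) (tgt g)" if "g \<in> I" for g
    using P that by (auto simp: groupoid_presentation_def)
  show ?thesis
    unfolding groupoid_presentation_def ob
  proof (intro conjI ballI exI[of _ "\<lambda>a b. E a b \<circ> F a b"])
    show "is_groupoid H"
      using P by (auto simp: groupoid_presentation_def intro: is_groupoid_iso[OF E])
    show "groupoid_iso (presented_groupoid (gobj G) I src tgt R) H (\<lambda>a b. E a b \<circ> F a b)"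
      by (rule groupoid_iso_trans[OF F(1) E])
  next
    fix g assume g: "g \<in> I"
    show "src g \<in> gobj G" "tgt g \<in> gobj G"
      using z g by auto
    show "E (src g) (tgt g) (z g) \<in> ghom H (src g) (tgt g)"
      by (rule groupoid_iso_mem[OF E]) (use z g in auto)
    show "(E (src g) (tgt g) \<circ> F (src g) (tgt g))
        {w. word_cong (gobj G) I src tgt R (src g) (tgt g) [(g, True)] w} = E (src g) (tgt g) (z g)"
      using F(2) g by simp
  next
    fix r assume "r \<in> R"
    then show "case r of (u, v) \<Rightarrow> \<exists>a b. is_word (gobj G) I src tgt a u b \<and> is_word (gobj G) I src tgt a v b"
      using P by (auto simp: groupoid_presentation_def)
  qed
qed

lemma equiv_word_cong:
  "equiv {w. is_word Ob I src tgt a w b} {(u, v). word_cong Ob I src tgt R a b u v}"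
proof (rule equivI)
  have append: "is_word Ob I src tgt a (u @ v) c"
    if "is_word Ob I src tgt a u b" "is_word Ob I src tgt b v c" for a b c u v
    using that by (induction Ob I src tgt a u b rule: is_word.induct) auto
  have "is_word Ob I src tgt a u b \<and> is_word Ob I src tgt a v b"
    if "word_cong Ob I src tgt R a b u v" for a b u v
    using that by (induction rule: word_cong.induct) (auto intro: append)
  then show "{(u, v). word_cong Ob I src tgt R a b u v} \<subseteq>
      {w. is_word Ob I src tgt a w b} \<times> {w. is_word Ob I src tgt a w b}"
    by auto
  show "refl_on {w. is_word Ob I src tgt a w b} {(u, v). word_cong Ob I src tgt R a b u v}"
    by (auto simp: refl_on_def intro: word_cong.refl)
  show "sym {(u, v). word_cong Ob I src tgt R a b u v}"
    by (auto simp: sym_def intro: word_cong.sym)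
  show "trans {(u, v). word_cong Ob I src tgt R a b u v}"
    by (auto simp: trans_def intro: word_cong.trans)
qed


section \<open>Fundamental groupoids\<close>

lemma equiv_path_homotopy: "equiv (paths_between X x y) (path_homotopy X x y)"
proof (rule equivI)
  show "path_homotopy X x y \<subseteq> paths_between X x y \<times> paths_between X x y"
  proof clarify
    fix p q assume "(p, q) \<in> path_homotopy X x y"
    then have "homotopic_with (\<lambda>r. r 0 = x \<and> r 1 = y) (top_of_set {0..1}) X p q"
      by (simp add: path_homotopy_def)
    from homotopic_with_imp_continuous_maps[OF this] homotopic_with_imp_property[OF this]
    show "p \<in> paths_between X x y \<and> q \<in> paths_between X x y"
      by (simp add: paths_between_def pathin_def)
  qed
  show "refl_on (paths_between X x y) (path_homotopy X x y)"
    by (auto simp: refl_on_def path_homotopy_def paths_between_def pathin_def)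
  show "sym (path_homotopy X x y)"
    by (auto simp: sym_def path_homotopy_def homotopic_with_sym)
  show "trans (path_homotopy X x y)"
    by (auto simp: trans_def path_homotopy_def intro: homotopic_with_trans)
qed

lemma path_homotopy_paths:
  "(p, q) \<in> path_homotopy X x y \<Longrightarrow> p \<in> paths_between X x y \<and> q \<in> paths_between X x y"
  using subsetD[OF equiv_type[OF equiv_path_homotopy]] by (metis mem_Sigma_iff)

lemma paths_between_iff: "p \<in> paths_between (top_of_set S) x y \<longleftrightarrow> path_in S p x y"
  by (auto simp: paths_between_def path_in_def pathin_def path_def path_image_def pathstart_def
      pathfinish_def)

lemma path_homotopy_iff:
  "(p, q) \<in> path_homotopy (top_of_set S) x y \<longleftrightarrow> homotopic_paths S p q \<and> path_in S p x y"
proof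
  assume pq: "(p, q) \<in> path_homotopy (top_of_set S) x y"
  then have "p \<in> paths_between (top_of_set S) x y"
    using path_homotopy_paths[OF pq] by simp
  then have "path_in S p x y"
    by (simp add: paths_between_iff)
  then show "homotopic_paths S p q \<and> path_in S p x y"
    using pq by (auto simp: path_homotopy_def homotopic_paths_def path_in_def pathstart_def pathfinish_def)
next
  assume "homotopic_paths S p q \<and> path_in S p x y"
  then show "(p, q) \<in> path_homotopy (top_of_set S) x y"
    by (auto simp: path_homotopy_def homotopic_paths_def path_in_def pathstart_def pathfinish_def)
qed

lemma path_mult_eq_joinpaths: "path_mult p q = p +++ q"
  by (simp add: path_mult_def joinpaths_def)

lemma path_homotopy_mult:
  assumes "(p, p') \<in> path_homotopy (top_of_set S) x y" "(q, q') \<in> path_homotopy (top_of_set S) y z"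
  shows "(path_mult p q, path_mult p' q') \<in> path_homotopy (top_of_set S) x z"
  using assms unfolding path_homotopy_iff path_mult_eq_joinpaths
  by (blast intro: homotopic_join path_in_join)

lemma gcomp_fundamental:
  assumes "path_in S p (pt a) (pt b)" "path_in S q (pt b) (pt c)"
  shows "gcomp (fundamental_groupoid (top_of_set S) Ob pt) a b c
      (path_homotopy (top_of_set S) (pt a) (pt b) `` {p})
      (path_homotopy (top_of_set S) (pt b) (pt c) `` {q}) =
    path_homotopy (top_of_set S) (pt a) (pt c) `` {p +++ q}"
  unfolding fundamental_groupoid_def groupoid.simps path_mult_eq_joinpaths[symmetric]
  by (rule UN_quotient_class2[OF equiv_path_homotopy equiv_path_homotopy equiv_path_homotopy])
    (use assms in \<open>auto intro: path_homotopy_mult simp: paths_between_iff\<close>)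

lemma is_groupoid_fundamental:
  fixes S :: "'x::topological_space set"
  assumes pt: "\<And>a. a \<in> Ob \<Longrightarrow> pt a \<in> S"
  shows "is_groupoid (fundamental_groupoid (top_of_set S) Ob pt)" (is "is_groupoid ?G")
proof -
  let ?r = "\<lambda>a b. path_homotopy (top_of_set S) (pt a) (pt b)"
  have simps: "gobj ?G = Ob" "gid ?G a = ?r a a `` {\<lambda>_. pt a}" for a
    by (simp_all add: fundamental_groupoid_def)
  have hom: "P \<in> ghom ?G a b \<longleftrightarrow> (\<exists>p. path_in S p (pt a) (pt b) \<and> P = ?r a b `` {p})" for P a b
    by (auto simp: fundamental_groupoid_def quotient_def paths_between_iff)
  have eq: "?r a b `` {p} = ?r a b `` {q}" if "homotopic_paths S p q" "path_in S p (pt a) (pt b)" for a b p q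
    by (rule equiv_class_eq[OF equiv_path_homotopy]) (use that in \<open>simp add: path_homotopy_iff\<close>)
  have const: "path_in S (\<lambda>_. pt a) (pt a) (pt a)" if "a \<in> Ob" for a
    using pt[OF that] by (rule path_in_const)
  show ?thesis
    unfolding is_groupoid_def simps
  proof (intro conjI ballI)
    fix a assume "a \<in> Ob"
    then show "?r a a `` {\<lambda>_. pt a} \<in> ghom ?G a a"
      using const hom by blast
  next
    fix a b c P Q assume "P \<in> ghom ?G a b" "Q \<in> ghom ?G b c"
    then obtain p q where "path_in S p (pt a) (pt b)" "P = ?r a b `` {p}"
      "path_in S q (pt b) (pt c)" "Q = ?r b c `` {q}"
      unfolding hom by blast
    then have "gcomp ?G a b c P Q = ?r a c `` {p +++ q}" "path_in S (p +++ q) (pt a) (pt c)"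
      by (simp_all only: gcomp_fundamental path_in_join)
    then show "gcomp ?G a b c P Q \<in> ghom ?G a c"
      unfolding hom by blast
  next
    fix a b P assume ab: "a \<in> Ob" "b \<in> Ob" and "P \<in> ghom ?G a b"
    then obtain p where p: "path_in S p (pt a) (pt b)" "P = ?r a b `` {p}"
      unfolding hom by blast
    note rp = path_in_reverse[OF p(1)]
    have "gcomp ?G a a b (?r a a `` {\<lambda>_. pt a}) P = ?r a b `` {(\<lambda>_. pt a) +++ p}"
      unfolding p(2) by (rule gcomp_fundamental[where pt = pt, OF const[OF ab(1)] p(1)])
    also have "\<dots> = P"
      unfolding p(2)
      by (rule eq[OF homotopic_join_const(2)[OF p(1)] path_in_join[OF const[OF ab(1)] p(1)]])
    finally show "gcomp ?G a a b (?r a a `` {\<lambda>_. pt a}) P = P" .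
    have "gcomp ?G a b b P (?r b b `` {\<lambda>_. pt b}) = ?r a b `` {p +++ (\<lambda>_. pt b)}"
      unfolding p(2) by (rule gcomp_fundamental[where pt = pt, OF p(1) const[OF ab(2)]])
    also have "\<dots> = P"
      unfolding p(2)
      by (rule eq[OF homotopic_join_const(1)[OF p(1)] path_in_join[OF p(1) const[OF ab(2)]]])
    finally show "gcomp ?G a b b P (?r b b `` {\<lambda>_. pt b}) = P" .
    have "gcomp ?G a b a P (?r b a `` {reversepath p}) = ?r a a `` {\<lambda>_. pt a}"
      unfolding p(2) gcomp_fundamental[where pt = pt, OF p(1) rp]
      by (rule eq[OF homotopic_join_const(3)[OF p(1)] path_in_join[OF p(1) rp]])
    moreover have "gcomp ?G b a b (?r b a `` {reversepath p}) P = ?r b b `` {\<lambda>_. pt b}"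
      unfolding p(2) gcomp_fundamental[where pt = pt, OF rp p(1)]
      by (rule eq[OF homotopic_join_const(4)[OF p(1)] path_in_join[OF rp p(1)]])
    ultimately show "\<exists>Q\<in>ghom ?G b a. gcomp ?G a b a P Q = ?r a a `` {\<lambda>_. pt a} \<and>
        gcomp ?G b a b Q P = ?r b b `` {\<lambda>_. pt b}"
      using rp hom by blast
  next
    fix a b c d P Q R assume "P \<in> ghom ?G a b" "Q \<in> ghom ?G b c" "R \<in> ghom ?G c d"
    then obtain p q r where p: "path_in S p (pt a) (pt b)" "P = ?r a b `` {p}"
      and q: "path_in S q (pt b) (pt c)" "Q = ?r b c `` {q}"
      and r: "path_in S r (pt c) (pt d)" "R = ?r c d `` {r}"
      unfolding hom by blast
    note pq = path_in_join[OF p(1) q(1)] and qr = path_in_join[OF q(1) r(1)]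
    have "?r a d `` {(p +++ q) +++ r} = ?r a d `` {p +++ (q +++ r)}"
      by (rule eq[OF homotopic_assoc[OF p(1) q(1) r(1)] path_in_join[OF pq r(1)]])
    then show "gcomp ?G a c d (gcomp ?G a b c P Q) R = gcomp ?G a b d P (gcomp ?G b c d Q R)"
      unfolding p(2) q(2) r(2)
      by (simp add: gcomp_fundamental p(1) q(1) r(1) pq qr)
  qed
qed

lemma path_homotopy_compose:
  assumes "continuous_map X Y f" "(p, q) \<in> path_homotopy X x y"
  shows "(f \<circ> p, f \<circ> q) \<in> path_homotopy Y (f x) (f y)"
  using assms unfolding path_homotopy_def
  by (auto intro: homotopic_with_compose_continuous_map_left)

lemma paths_between_compose:
  assumes "continuous_map X Y f" "p \<in> paths_between X x y"
  shows "f \<circ> p \<in> paths_between Y (f x) (f y)"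
  using assms by (auto simp: paths_between_def pathin_def intro: continuous_map_compose)

lemma path_homotopy_inverse:
  assumes fg: "homeomorphic_maps X Y f g" and p: "p \<in> paths_between X x y"
  shows "(g \<circ> (f \<circ> p), p) \<in> path_homotopy X x y"
proof -
  have c: "continuous_map (top_of_set {0..1}) X p" and e: "p 0 = x" "p 1 = y"
    using p by (auto simp: paths_between_def pathin_def)
  have gf: "g (f (p t)) = p t" if "t \<in> {0..1}" for t
    using fg that continuous_map_image_subset_topspace[OF c] by (force simp: homeomorphic_maps_def)
  have "homotopic_with (\<lambda>r. r 0 = x \<and> r 1 = y) (top_of_set {0..1}) X p (g \<circ> (f \<circ> p))"
    by (rule homotopic_with_equal) (use e gf[of 0] gf[of 1] gf c in auto)
  then show ?thesis
    by (simp add: path_homotopy_def homotopic_with_sym)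
qed

text \<open>
  Concatenation respects homotopy in \<open>X\<close> because it does so in \<open>S\<close>, and \<open>f\<close> and \<open>g\<close> commute with
  concatenation.
\<close>

lemma path_homotopy_mult_homeomorphic:
  assumes fg: "homeomorphic_maps (top_of_set S) X f g" and xyz: "x \<in> S" "y \<in> S" "z \<in> S"
    and p: "(p, p') \<in> path_homotopy X (f x) (f y)" and q: "(q, q') \<in> path_homotopy X (f y) (f z)"
  shows "(path_mult p q, path_mult p' q') \<in> path_homotopy X (f x) (f z)"
proof -
  let ?s = "path_homotopy X (f x) (f z)"
  have cont: "continuous_map (top_of_set S) X f" "continuous_map X (top_of_set S) g"
    and gf: "\<And>x. x \<in> S \<Longrightarrow> g (f x) = x"
    using fg by (auto simp: homeomorphic_maps_def)
  let ?m = "f \<circ> (g \<circ> path_mult p q)" and ?m' = "f \<circ> (g \<circ> path_mult p' q')"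
  have mult: "g \<circ> path_mult r r' = path_mult (g \<circ> r) (g \<circ> r')" for r r'
    by (auto simp: path_mult_def)
  have "(path_mult (g \<circ> p) (g \<circ> q), path_mult (g \<circ> p') (g \<circ> q')) \<in> path_homotopy (top_of_set S) x z"
    using path_homotopy_mult path_homotopy_compose[OF cont(2) p] path_homotopy_compose[OF cont(2) q]
      gf xyz by metis
  then have 1: "(?m, ?m') \<in> ?s"
    unfolding mult[symmetric] by (rule path_homotopy_compose[OF cont(1)])
  have 2: "homotopic_with (\<lambda>r. r 0 = f x \<and> r 1 = f z) (top_of_set {0..1}) X (f \<circ> (g \<circ> path_mult r r')) (path_mult r r')"
    if r: "r \<in> paths_between X (f x) (f y)" "r' \<in> paths_between X (f y) (f z)"
      and c: "continuous_map (top_of_set {0..1}) X (f \<circ> (g \<circ> path_mult r r'))" for r r'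
  proof (rule homotopic_with_equal)
    have im: "r t \<in> topspace X" "r' t \<in> topspace X" if "t \<in> {0..1}" for t
      using r that by (auto simp: paths_between_def pathin_def dest!: continuous_map_image_subset_topspace)
    show e: "(f \<circ> (g \<circ> path_mult r r')) t = path_mult r r' t" if "t \<in> topspace (top_of_set {0..1})" for t
      using that im fg by (auto simp: path_mult_def homeomorphic_maps_def)
    show "path_mult r r' 0 = f x \<and> path_mult r r' 1 = f z"
      using r by (auto simp: path_mult_def paths_between_def)
    then show "(f \<circ> (g \<circ> path_mult r r')) 0 = f x \<and> (f \<circ> (g \<circ> path_mult r r')) 1 = f z"
      using e[of 0] e[of 1] by simp
    show "continuous_map (top_of_set {0..1}) X (f \<circ> (g \<circ> path_mult r r'))"
      by (rule c)
  qed
  have pb: "p \<in> paths_between X (f x) (f y)" "p' \<in> paths_between X (f x) (f y)"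
    "q \<in> paths_between X (f y) (f z)" "q' \<in> paths_between X (f y) (f z)"
    using path_homotopy_paths[OF p] path_homotopy_paths[OF q] by simp_all
  have c: "continuous_map (top_of_set {0..1}) X ?m" "continuous_map (top_of_set {0..1}) X ?m'"
    using homotopic_with_imp_continuous_maps[OF 1[unfolded path_homotopy_def mem_Collect_eq prod.case]]
    by simp_all
  have "(?m, path_mult p q) \<in> ?s" "(?m', path_mult p' q') \<in> ?s"
    using 2[OF pb(1,3) c(1)] 2[OF pb(2,4) c(2)] by (auto simp: path_homotopy_def)
  with 1 show ?thesis
    using equiv_path_homotopy[of X "f x" "f z"] by (meson equivE symD transD)
qed

text \<open>
  Everything about paths is proved for subsets of a topological type; a homeomorphism carries it over
  to the dimer complex, which is a topology on a set of equivalence classes.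
\<close>

lemma fundamental_groupoid_homeomorphic:
  assumes fg: "homeomorphic_maps (top_of_set S) X f g" and pt: "\<And>a. a \<in> Ob \<Longrightarrow> pt a \<in> S"
  shows "groupoid_iso (fundamental_groupoid (top_of_set S) Ob pt) (fundamental_groupoid X Ob (f \<circ> pt))
    (\<lambda>a b P. \<Union>p\<in>P. path_homotopy X (f (pt a)) (f (pt b)) `` {f \<circ> p})" (is "groupoid_iso ?G ?H ?F")
proof -
  let ?r = "\<lambda>a b. path_homotopy (top_of_set S) (pt a) (pt b)"
  let ?s = "\<lambda>a b. path_homotopy X (f (pt a)) (f (pt b))"
  have cont: "continuous_map (top_of_set S) X f" "continuous_map X (top_of_set S) g"
    and gf: "\<And>x. x \<in> S \<Longrightarrow> g (f x) = x"
    using fg by (auto simp: homeomorphic_maps_def)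
  have fg': "homeomorphic_maps X (top_of_set S) g f"
    using fg homeomorphic_maps_sym by blast
  have cls: "?F a b (?r a b `` {p}) = ?s a b `` {f \<circ> p}" if "path_in S p (pt a) (pt b)" for a b p
    by (rule UN_quotient_class[OF equiv_path_homotopy equiv_path_homotopy path_homotopy_compose[OF cont(1)]])
      (use that in \<open>auto simp: paths_between_iff\<close>)
  have fp: "f \<circ> p \<in> paths_between X (f (pt a)) (f (pt b))" if "path_in S p (pt a) (pt b)" for a b p
    using paths_between_compose[OF cont(1)] that paths_between_iff by blast
  show ?thesis
    unfolding groupoid_iso_def
  proof (intro conjI ballI)
    show "gobj ?G = gobj ?H"
      by (simp add: fundamental_groupoid_def)
  next
    fix a b assume "a \<in> gobj ?G" "b \<in> gobj ?G"
    then have ab: "pt a \<in> S" "pt b \<in> S"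
      using pt by (auto simp: fundamental_groupoid_def)
    have "bij_betw (?F a b) (paths_between (top_of_set S) (pt a) (pt b) // ?r a b)
        (paths_between X (f (pt a)) (f (pt b)) // ?s a b)"
    proof (rule bij_betw_quotient[OF equiv_path_homotopy equiv_path_homotopy])
      fix p q assume p: "p \<in> paths_between (top_of_set S) (pt a) (pt b)"
        and q: "q \<in> paths_between (top_of_set S) (pt a) (pt b)"
      show "f \<circ> p \<in> paths_between X (f (pt a)) (f (pt b))"
        using p fp paths_between_iff by blast
      show "(p, q) \<in> ?r a b \<longleftrightarrow> (f \<circ> p, f \<circ> q) \<in> ?s a b"
      proof
        assume "(f \<circ> p, f \<circ> q) \<in> ?s a b"
        then have "(g \<circ> (f \<circ> p), g \<circ> (f \<circ> q)) \<in> ?r a b"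
          using path_homotopy_compose[OF cont(2)] gf ab by metis
        then show "(p, q) \<in> ?r a b"
          using path_homotopy_inverse[OF fg p] path_homotopy_inverse[OF fg q]
            equiv_path_homotopy[of "top_of_set S" "pt a" "pt b"] by (meson equivE symD transD)
      qed (rule path_homotopy_compose[OF cont(1)])
    next
      fix q assume q: "q \<in> paths_between X (f (pt a)) (f (pt b))"
      then have "g \<circ> q \<in> paths_between (top_of_set S) (pt a) (pt b)"
        using paths_between_compose[OF cont(2)] gf ab by metis
      then show "\<exists>p\<in>paths_between (top_of_set S) (pt a) (pt b). (f \<circ> p, q) \<in> ?s a b"
        using path_homotopy_inverse[OF fg' q] by blast
    qed
    then show "bij_betw (?F a b) (ghom ?G a b) (ghom ?H a b)"
      by (simp add: fundamental_groupoid_def)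
  next
    fix a assume "a \<in> gobj ?G"
    then have "path_in S (\<lambda>_. pt a) (pt a) (pt a)"
      using pt by (auto simp: fundamental_groupoid_def intro: path_in_const)
    then show "?F a a (gid ?G a) = gid ?H a"
      using cls[of "\<lambda>_. pt a" a a] by (simp add: fundamental_groupoid_def o_def)
  next
    fix a b c P Q assume ob: "a \<in> gobj ?G" "b \<in> gobj ?G" "c \<in> gobj ?G"
      and PQ: "P \<in> ghom ?G a b" "Q \<in> ghom ?G b c"
    then have S: "pt a \<in> S" "pt b \<in> S" "pt c \<in> S"
      using pt by (auto simp: fundamental_groupoid_def)
    obtain p q where p: "path_in S p (pt a) (pt b)" "P = ?r a b `` {p}"
      and q: "path_in S q (pt b) (pt c)" "Q = ?r b c `` {q}"
      using PQ by (auto simp: fundamental_groupoid_def quotient_def paths_between_iff)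
    have "?F a c (gcomp ?G a b c P Q) = ?s a c `` {f \<circ> (p +++ q)}"
      unfolding p(2) q(2) gcomp_fundamental[where pt = pt, OF p(1) q(1)] by (rule cls[OF path_in_join[OF p(1) q(1)]])
    also have "f \<circ> (p +++ q) = path_mult (f \<circ> p) (f \<circ> q)"
      by (auto simp: joinpaths_def path_mult_def)
    also have "?s a c `` {\<dots>} = gcomp ?H a b c (?s a b `` {f \<circ> p}) (?s b c `` {f \<circ> q})"
      unfolding fundamental_groupoid_def groupoid.simps o_apply[of f pt]
      by (rule UN_quotient_class2[OF equiv_path_homotopy equiv_path_homotopy equiv_path_homotopy
            path_homotopy_mult_homeomorphic[OF fg S] fp[OF p(1)] fp[OF q(1)], symmetric])
    also have "\<dots> = gcomp ?H a b c (?F a b P) (?F b c Q)"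
      unfolding p(2) q(2) cls[OF p(1)] cls[OF q(1)] ..
    finally show "?F a c (gcomp ?G a b c P Q) = gcomp ?H a b c (?F a b P) (?F b c Q)" .
  qed
qed

text \<open>
  The record contains hom-sets for all labels, while an isomorphism compares those with labels in \<open>Ob\<close>.
\<close>

lemma groupoid_iso_base_cong:
  assumes "groupoid_iso G (fundamental_groupoid X Ob pt) F" "\<And>a. a \<in> Ob \<Longrightarrow> pt a = pt' a"
  shows "groupoid_iso G (fundamental_groupoid X Ob pt') F"
proof -
  have "gobj G = Ob"
    using assms(1) by (simp add: groupoid_iso_def fundamental_groupoid_def)
  then show ?thesis
    using assms(1) unfolding groupoid_iso_def fundamental_groupoid_def groupoid.simps
    by (simp add: assms(2)[symmetric])
qed


section \<open>The nerve theorem for fundamental groupoids\<close>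

subsection \<open>Words in the nerve\<close>

text \<open>
  Path connected pairwise intersections make the crossing from one member to another unique up to
  homotopy; a common point of three members gives a triangle relation.
\<close>

locale nerve_cover =
  fixes K :: "'x::topological_space set" and D :: "'a set"
    and U :: "'a \<Rightarrow> 'x set" and pt :: "'a \<Rightarrow> 'x"
  assumes open_U: "a \<in> D \<Longrightarrow> openin (top_of_set K) (U a)"
    and cover: "K \<subseteq> (\<Union>a\<in>D. U a)"
    and pt_in: "a \<in> D \<Longrightarrow> pt a \<in> U a"
    and null_U: "\<lbrakk>a \<in> D; path_in (U a) p x y; path_in (U a) q x y\<rbrakk> \<Longrightarrow> homotopic_paths K p q"
    and connected_Int: "a \<in> D \<Longrightarrow> b \<in> D \<Longrightarrow> path_connected (U a \<inter> U b)"
    and nonempty_Int: "a \<in> D \<Longrightarrow> b \<in> D \<Longrightarrow> U a \<inter> U b \<noteq> {}"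
begin

lemma U_subset: "a \<in> D \<Longrightarrow> U a \<subseteq> K"
  using open_U openin_imp_subset by blast

definition triangle_rel :: "((('a \<times> 'a) \<times> bool) list \<times> (('a \<times> 'a) \<times> bool) list) set" where
  "triangle_rel = {([((a, c), True)], [((a, b), True), ((b, c), True)]) | a b c.
     a \<in> D \<and> b \<in> D \<and> c \<in> D \<and> U a \<inter> U b \<inter> U c \<noteq> {}}"

abbreviation word :: "'a \<Rightarrow> (('a \<times> 'a) \<times> bool) list \<Rightarrow> 'a \<Rightarrow> bool" where
  "word \<equiv> is_word D (D \<times> D) fst snd"

abbreviation wcong ::
  "'a \<Rightarrow> 'a \<Rightarrow> (('a \<times> 'a) \<times> bool) list \<Rightarrow> (('a \<times> 'a) \<times> bool) list \<Rightarrow> bool" where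
  "wcong \<equiv> word_cong D (D \<times> D) fst snd triangle_rel"

lemma word_append: "word a u b \<Longrightarrow> word b v c \<Longrightarrow> word a (u @ v) c"
  by (induction u arbitrary: a) auto

lemma word_objects: "word a u b \<Longrightarrow> a \<in> D \<and> b \<in> D"
  by (induction u arbitrary: a) auto

lemma wcong_word: "wcong a b u v \<Longrightarrow> word a u b \<and> word a v b"
  by (induction rule: word_cong.induct) (auto intro: word_append)

lemma wcong_trans [trans]: "wcong a b u v \<Longrightarrow> wcong a b v w \<Longrightarrow> wcong a b u w"
  by (rule word_cong.trans)

lemma wcong_Cons:
  assumes "a \<in> D" "c \<in> D" "wcong c b u v"
  shows "wcong a b (((a, c), True) # u) (((a, c), True) # v)"
  using word_cong.append[OF word_cong.refl assms(3), of a "[((a, c), True)]"] assms(1,2) by auto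

lemma wcong_triangle:
  assumes "a \<in> D" "b \<in> D" "c \<in> D" "x \<in> U a" "x \<in> U b" "x \<in> U c"
  shows "wcong a c [((a, c), True)] [((a, b), True), ((b, c), True)]"
  by (rule word_cong.relation) (use assms in \<open>auto simp: triangle_rel_def\<close>)

lemma wcong_triangle_append:
  assumes "a \<in> D" "b \<in> D" "c \<in> D" "x \<in> U a" "x \<in> U b" "x \<in> U c" "word c u d"
  shows "wcong a d (((a, c), True) # u) (((a, b), True) # ((b, c), True) # u)"
  using word_cong.append[OF wcong_triangle[OF assms(1-6)] word_cong.refl[OF assms(7)]] by simp

text \<open>
  The degenerate triangle \<open>(a, a, a)\<close> makes the generator from \<open>a\<close> to \<open>a\<close> idempotent, hence an identity;
  then the triangle \<open>(a, b, a)\<close> shows that the generators between \<open>a\<close> and \<open>b\<close> are mutually inverse.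
\<close>

lemma wcong_identity:
  assumes a: "a \<in> D"
  shows "wcong a a [((a, a), True)] []"
proof -
  let ?z = "((a, a), True)" and ?z' = "((a, a), False)"
  have c: "wcong a a [?z', ?z] []"
    using word_cong.cancel[of D "D \<times> D" fst snd a "(a, a)" False] a by simp
  have 1: "wcong a a [?z] [?z, ?z]"
    using a pt_in wcong_triangle by blast
  have r: "wcong a a [?z'] [?z']" "wcong a a [?z] [?z]"
    using a by (auto intro: word_cong.refl)
  have "wcong a a [] [?z', ?z]"
    by (rule word_cong.sym[OF c])
  also have "wcong a a [?z', ?z] [?z', ?z, ?z]"
    using word_cong.append[OF r(1) 1] by simp
  also have "wcong a a [?z', ?z, ?z] [?z]"
    using word_cong.append[OF c r(2)] by simp
  finally show ?thesis
    by (rule word_cong.sym)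
qed

lemma wcong_inverse:
  assumes a: "a \<in> D" and b: "b \<in> D"
  shows "wcong b a [((a, b), False)] [((b, a), True)]"
proof -
  let ?z = "((a, b), True)" and ?z' = "((a, b), False)" and ?y = "((b, a), True)"
  obtain x where x: "x \<in> U a" "x \<in> U b"
    using nonempty_Int[OF a b] by blast
  have "wcong a a [?z, ?y] [((a, a), True)]"
    by (rule word_cong.sym[OF wcong_triangle[OF a b a x x(1)]])
  also have "wcong a a \<dots> []"
    by (rule wcong_identity[OF a])
  finally have 1: "wcong a a [?z, ?y] []" .
  have r: "wcong b a [?z'] [?z']" "wcong b a [?y] [?y]"
    using a b by (auto intro: word_cong.refl)
  have c: "wcong b b [?z', ?z] []"
    using word_cong.cancel[of D "D \<times> D" fst snd b "(a, b)" False] a b by simp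
  have "wcong b a [?z'] [?z', ?z, ?y]"
    using word_cong.append[OF r(1) word_cong.sym[OF 1]] by simp
  also have "wcong b a \<dots> [?y]"
    using word_cong.append[OF c r(2)] by simp
  finally show ?thesis .
qed

subsection \<open>Tracking a path\<close>

text \<open>
  \<open>tracks p s u cs\<close>: there is a subdivision of the interval from \<open>s\<close> to \<open>u\<close> whose successive
  parts are mapped by \<open>p\<close> into the sets \<open>U c\<close>, \<open>c\<close> running through \<open>cs\<close>.
\<close>

fun tracks :: "(real \<Rightarrow> 'x) \<Rightarrow> real \<Rightarrow> real \<Rightarrow> 'a list \<Rightarrow> bool" where
  "tracks p s u [] \<longleftrightarrow> s = u"
| "tracks p s u (c # cs) \<longleftrightarrow> c \<in> D \<and> (\<exists>t\<ge>s. p ` {s..t} \<subseteq> U c \<and> tracks p t u cs)"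

fun trace_word :: "'a \<Rightarrow> 'a list \<Rightarrow> 'a \<Rightarrow> (('a \<times> 'a) \<times> bool) list" where
  "trace_word a [] b = [((a, b), True)]"
| "trace_word a (c # cs) b = ((a, c), True) # trace_word c cs b"

lemma tracks_le: "tracks p s u cs \<Longrightarrow> s \<le> u"
  by (induction cs arbitrary: s) force+

lemma tracks_in_D: "tracks p s u cs \<Longrightarrow> set cs \<subseteq> D"
  by (induction cs arbitrary: s) auto

lemma trace_word_word: "a \<in> D \<Longrightarrow> b \<in> D \<Longrightarrow> set cs \<subseteq> D \<Longrightarrow> word a (trace_word a cs b) b"
  by (induction cs arbitrary: a) auto

lemma trace_word_append: "trace_word a (cs @ b # cs') c = trace_word a cs b @ trace_word b cs' c"
  by (induction cs arbitrary: a) auto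

lemma tracks_append: "tracks p s t cs \<Longrightarrow> tracks p t u cs' \<Longrightarrow> tracks p s u (cs @ cs')"
  by (induction cs arbitrary: s) auto

lemma tracks_affine:
  assumes "tracks p s u cs" "m > 0" "\<And>r. s \<le> r \<Longrightarrow> r \<le> u \<Longrightarrow> q (m * r + d) = p r"
  shows "tracks q (m * s + d) (m * u + d) cs"
  using assms(1,3)
proof (induction cs arbitrary: s)
  case (Cons c cs)
  then obtain t where t: "c \<in> D" "s \<le> t" "p ` {s..t} \<subseteq> U c" "tracks p t u cs"
    by auto
  have tu: "t \<le> u"
    using t(4) by (rule tracks_le)
  have "q ` {m * s + d..m * t + d} \<subseteq> U c"
  proof clarify
    fix r assume "r \<in> {m * s + d..m * t + d}"
    then have r: "s \<le> (r - d) / m" "(r - d) / m \<le> t"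
      using \<open>m > 0\<close> by (auto simp: field_simps)
    then have "q r = p ((r - d) / m)"
      using Cons.prems(2)[of "(r - d) / m"] tu \<open>m > 0\<close> by simp
    then show "q r \<in> U c"
      using r t(3) by auto
  qed
  moreover have "tracks q (m * t + d) (m * u + d) cs"
    using Cons t by auto
  ultimately show ?case
    using t \<open>m > 0\<close> by (auto intro!: exI[of _ "m * t + d"])
qed simp

text \<open>
  The starting point lies in \<open>U a\<close>, \<open>U c\<close> and the first set of the track, or in \<open>U b\<close> if the track is
  empty: one triangle relation.
\<close>

lemma trace_word_relabel:
  assumes "tracks p s u cs" "a \<in> D" "c \<in> D" "b \<in> D" "p s \<in> U a" "p s \<in> U c" "p u \<in> U b"
  shows "wcong a b (trace_word a cs b) (((a, c), True) # trace_word c cs b)"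
proof (cases cs)
  case Nil
  then show ?thesis
    using assms by (auto intro: wcong_triangle)
next
  case (Cons d ds)
  then have "p s \<in> U d" "set cs \<subseteq> D"
    using assms(1) tracks_in_D[OF assms(1)] by auto
  then show ?thesis
    using assms Cons by (auto intro!: wcong_triangle_append trace_word_word)
qed

text \<open>
  Compare the first parts of the two tracks. The part that ends first, with label \<open>c\<close> say, is covered
  both by \<open>U c\<close> and by the first set of the other track, so it may be cut off from both after the start
  is relabelled to \<open>c\<close>. An empty track stands for a single point. The total length of the two lists decreases.
\<close>

lemma trace_word_unique:
  assumes "tracks p s u cs" "tracks p s u cs'" "a \<in> D" "b \<in> D" "p s \<in> U a" "p u \<in> U b"
  shows "wcong a b (trace_word a cs b) (trace_word a cs' b)"
  using assms
proof (induction "length cs + length cs'" arbitrary: cs cs' s a rule: less_induct)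
  case less
  \<comment> \<open>Cut off the first part of the list whose first part ends first.\<close>
  have cut: "wcong a b (trace_word a (c # ds) b) (trace_word a es b)"
    if len: "length (c # ds) + length es = length cs + length cs'" and c: "c \<in> D"
      and t: "s \<le> t" "p ` {s..t} \<subseteq> U c" "tracks p t u ds" "tracks p t u es"
      and es: "tracks p s u es" for c ds es t
  proof -
    have "p t \<in> U c" "p s \<in> U c"
      using t by auto
    then have "wcong c b (trace_word c ds b) (trace_word c es b)"
      using t c less.prems len by (intro less.hyps[of ds es t c]) auto
    then have "wcong a b (trace_word a (c # ds) b) (((a, c), True) # trace_word c es b)"
      using wcong_Cons c less.prems by simp
    also have "wcong a b \<dots> (trace_word a es b)"
      by (rule word_cong.sym, rule trace_word_relabel[OF es]) (use c less.prems \<open>p s \<in> U c\<close> in auto)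
    finally show ?thesis .
  qed
  have shorten: "tracks p t u (c' # ds')"
    if "c' \<in> D" "s \<le> t" "t \<le> t'" "p ` {s..t'} \<subseteq> U c'" "tracks p t' u ds'" for c' ds' t t'
    using that by (auto intro!: exI[of _ t'])
  show ?case
  proof (cases cs)
    case Nil
    show ?thesis
    proof (cases cs')
      case Nil
      with \<open>cs = []\<close> show ?thesis
        using less.prems by (auto intro: word_cong.refl)
    next
      case (Cons c ds)
      then obtain t where t: "c \<in> D" "s \<le> t" "p ` {s..t} \<subseteq> U c" "tracks p t u ds"
        using less.prems by auto
      moreover have "tracks p t u cs"
        using \<open>cs = []\<close> less.prems(1) t tracks_le[OF t(4)] by simp
      ultimately have "wcong a b (trace_word a cs' b) (trace_word a cs b)"
        using cut[of c ds cs t] Cons less.prems(1) by auto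
      then show ?thesis
        by (rule word_cong.sym)
    qed
  next
    case (Cons c ds)
    then obtain t where t: "c \<in> D" "s \<le> t" "p ` {s..t} \<subseteq> U c" "tracks p t u ds"
      using less.prems by auto
    show ?thesis
    proof (cases cs')
      case Nil
      then have "tracks p t u cs'"
        using less.prems(2) t tracks_le[OF t(4)] by simp
      then show ?thesis
        using cut[of c ds cs' t] t Cons less.prems(2) by auto
    next
      case (Cons c' ds')
      then obtain t' where t': "c' \<in> D" "s \<le> t'" "p ` {s..t'} \<subseteq> U c'" "tracks p t' u ds'"
        using less.prems by auto
      show ?thesis
      proof (cases "t \<le> t'")
        case True
        then show ?thesis
          using cut[of c ds cs' t] shorten[OF t'(1) t(2) _ t'(3,4)] t \<open>cs = c # ds\<close>
            \<open>cs' = c' # ds'\<close> less.prems(2) by auto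
      next
        case False
        then have "wcong a b (trace_word a cs' b) (trace_word a cs b)"
          using cut[of c' ds' cs t'] shorten[OF t(1) t'(2) _ t(3,4)] t' \<open>cs = c # ds\<close>
            \<open>cs' = c' # ds'\<close> less.prems(1) by auto
        then show ?thesis
          by (rule word_cong.sym)
      qed
    qed
  qed
qed

lemma tracks_exists:
  assumes p: "path p" "path_image p \<subseteq> K"
  shows "\<exists>cs. tracks p 0 1 cs"
proof -
  have cont: "continuous_on {0..1} p"
    using p by (simp add: path_def)
  define P where "P s u \<longleftrightarrow> (0 \<le> s \<and> u \<le> 1 \<longrightarrow> (\<exists>cs. tracks p s u cs))" for s u
  have "P 0 1"
  proof (rule Bolzano)
    fix s t u assume "P s t" "P t u" "s \<le> t" "t \<le> u"
    then show "P s u"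
      unfolding P_def using tracks_append by (metis order_trans)
  next
    fix x :: real assume local: "0 \<le> x" "x \<le> 1"
    then have "p x \<in> K"
      using p by (auto simp: path_image_def)
    then obtain c where c: "c \<in> D" "p x \<in> U c"
      using cover by blast
    have "openin (top_of_set {0..1}) ({0..1} \<inter> p -` U c)"
      using p by (intro continuous_openin_preimage[OF cont _ open_U[OF c(1)]])
        (auto simp: path_image_def)
    moreover have "x \<in> {0..1} \<inter> p -` U c"
      using c(2) local by simp
    ultimately obtain d where "d > 0"
      "\<forall>y\<in>{0..1}. dist y x < d \<longrightarrow> y \<in> {0..1} \<inter> p -` U c"
      unfolding openin_euclidean_subtopology_iff by blast
    then have d: "d > 0" "\<And>y. y \<in> {0..1} \<Longrightarrow> dist y x < d \<Longrightarrow> p y \<in> U c"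
      by auto
    have "\<exists>cs. tracks p s u cs" if "s \<le> x" "x \<le> u" "u - s < d" "0 \<le> s" "u \<le> 1" for s u
    proof -
      have "p ` {s..u} \<subseteq> U c"
        using that d(2) by (auto simp: dist_real_def)
      then have "tracks p s u [c]"
        using c that by simp
      then show ?thesis ..
    qed
    with d(1) show "\<exists>d>0. \<forall>s u. s \<le> x \<and> x \<le> u \<and> u - s < d \<longrightarrow> P s u"
      unfolding P_def by blast
  qed simp
  then show ?thesis by (simp add: P_def)
qed

text \<open>
  On each compact part of the subdivision the condition to stay inside an open set is open in the
  parameter of the homotopy, by the tube lemma.
\<close>

lemma eventually_tracks:
  fixes H :: "real \<times> real \<Rightarrow> 'x"
  assumes H: "continuous_on ({0..1} \<times> {0..1}) H" "H \<in> {0..1} \<times> {0..1} \<rightarrow> K"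
    and v: "v \<in> {0..1}"
  shows "tracks (\<lambda>t. H (v, t)) s u cs \<Longrightarrow> 0 \<le> s \<Longrightarrow> u \<le> 1 \<Longrightarrow>
    \<exists>d>0. \<forall>w\<in>{0..1}. dist w v < d \<longrightarrow> tracks (\<lambda>t. H (w, t)) s u cs"
proof (induction cs arbitrary: s)
  case Nil
  then have "\<forall>w\<in>{0..1}. dist w v < 1 \<longrightarrow> tracks (\<lambda>t. H (w, t)) s u []"
    by simp
  then show ?case
    using zero_less_one by blast
next
  case (Cons c cs)
  then obtain t where t: "c \<in> D" "s \<le> t" "(\<lambda>t. H (v, t)) ` {s..t} \<subseteq> U c" "tracks (\<lambda>t. H (v, t)) t u cs"
    by auto
  have tu: "t \<le> u"
    using t(4) by (rule tracks_le)
  obtain d1 where d1: "d1 > 0"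
    "\<And>w. w \<in> {0..1} \<Longrightarrow> dist w v < d1 \<Longrightarrow> tracks (\<lambda>t. H (w, t)) t u cs"
    using Cons.IH[OF t(4)] Cons.prems t by auto
  have "openin (top_of_set ({0..1} \<times> {0..1})) (({0..1} \<times> {0..1}) \<inter> H -` U c)"
    using H by (intro continuous_openin_preimage[OF _ _ open_U[OF t(1)]])
  then obtain W where W: "open W" "({0..1} \<times> {0..1}) \<inter> H -` U c = ({0..1} \<times> {0..1}) \<inter> W"
    by (auto simp: openin_open)
  have "{v} \<times> {s..t} \<subseteq> W"
  proof
    fix z assume "z \<in> {v} \<times> {s..t}"
    then have "z \<in> ({0..1} \<times> {0..1}) \<inter> H -` U c"
      using v t Cons.prems tu by auto
    then show "z \<in> W"
      using W(2) by blast
  qed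
  then obtain V where V: "open V" "v \<in> V" "V \<times> {s..t} \<subseteq> W"
    using Elementary_Topology.tube_lemma[OF _ W(1)] by (metis compact_Icc)
  then obtain d2 where d2: "d2 > 0" "ball v d2 \<subseteq> V"
    using open_contains_ball by blast
  have "tracks (\<lambda>t. H (w, t)) s u (c # cs)" if w: "w \<in> {0..1}" "dist w v < min d1 d2" for w
  proof -
    have "w \<in> V"
      using d2 w by (auto simp: dist_commute)
    have "H (w, r) \<in> U c" if r: "r \<in> {s..t}" for r
    proof -
      have "(w, r) \<in> ({0..1} \<times> {0..1}) \<inter> W"
        using \<open>w \<in> V\<close> V w r Cons.prems tu by auto
      then show ?thesis
        using W(2) by blast
    qed
    then show ?thesis
      using t d1(2)[of w] w by auto
  qed
  then show ?case
    using d1(1) d2(1) by (intro exI[of _ "min d1 d2"]) auto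
qed

text \<open>
  Nearby paths of the homotopy have a common track, so the word is locally constant up to congruence;
  bisection of the parameter interval gives the claim.
\<close>

lemma trace_word_homotopic:
  assumes h: "homotopic_paths K p q" and p: "path_in K p (pt a) (pt b)" and ab: "a \<in> D" "b \<in> D"
    and cs: "tracks p 0 1 cs" "tracks q 0 1 cs'"
  shows "wcong a b (trace_word a cs b) (trace_word a cs' b)"
proof -
  obtain H :: "real \<times> real \<Rightarrow> 'x" where H: "continuous_on ({0..1} \<times> {0..1}) H" "H \<in> {0..1} \<times> {0..1} \<rightarrow> K"
    and H0: "\<forall>t\<in>{0..1}. H (0, t) = p t" and H1: "\<forall>t\<in>{0..1}. H (1, t) = q t"
    and ends: "\<forall>v\<in>{0..1}. pathstart (H \<circ> Pair v) = pathstart p \<and> pathfinish (H \<circ> Pair v) = pathfinish p"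
    using h unfolding homotopic_paths by blast
  have H5: "H (v, 0) = pt a" "H (v, 1) = pt b" if "v \<in> {0..1}" for v
    using bspec[OF ends that] p by (simp_all add: path_in_def pathstart_def pathfinish_def)
  have Hpath: "path (\<lambda>t. H (v, t))" "path_image (\<lambda>t. H (v, t)) \<subseteq> K" if "v \<in> {0..1}" for v
    using that H(1,2) unfolding path_def path_image_def
    by (auto intro!: continuous_on_compose2[OF H(1)] continuous_intros)
  define P where "P v w \<longleftrightarrow> (\<forall>cs cs'. tracks (\<lambda>t. H (v, t)) 0 1 cs \<longrightarrow>
    tracks (\<lambda>t. H (w, t)) 0 1 cs' \<longrightarrow> wcong a b (trace_word a cs b) (trace_word a cs' b))" for v w
  have uniq: "wcong a b (trace_word a cs b) (trace_word a cs' b)"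
    if "v \<in> {0..1}" "tracks (\<lambda>t. H (v, t)) 0 1 cs" "tracks (\<lambda>t. H (v, t)) 0 1 cs'" for v cs cs'
    by (rule trace_word_unique[OF that(2,3) ab]) (use H5[OF that(1)] pt_in ab in auto)
  define P' where "P' v w \<longleftrightarrow> (0 \<le> v \<and> w \<le> 1 \<longrightarrow> P v w)" for v w
  have "P' 0 1"
  proof (rule Bolzano)
    fix u v w assume trans: "P' u v" "P' v w" "u \<le> v" "v \<le> w"
    show "P' u w"
      unfolding P'_def
    proof
      assume "0 \<le> u \<and> w \<le> 1"
      then have v: "v \<in> {0..1}" and "P u v" "P v w"
        using trans by (auto simp: P'_def)
      moreover obtain ds where "tracks (\<lambda>t. H (v, t)) 0 1 ds"
        using tracks_exists Hpath[OF v] by blast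
      ultimately show "P u w"
        unfolding P_def by (meson word_cong.trans)
    qed
  next
    fix v :: real assume "0 \<le> v" "v \<le> 1"
    then have v: "v \<in> {0..1}" by simp
    then obtain ds where ds: "tracks (\<lambda>t. H (v, t)) 0 1 ds"
      using tracks_exists Hpath by blast
    obtain d where d: "d > 0" "\<And>w. w \<in> {0..1} \<Longrightarrow> dist w v < d \<Longrightarrow> tracks (\<lambda>t. H (w, t)) 0 1 ds"
      using eventually_tracks[OF H(1,2) v ds] by auto
    have "P w w'" if "w \<le> v" "v \<le> w'" "w' - w < d" "0 \<le> w" "w' \<le> 1" for w w'
    proof -
      have w: "w \<in> {0..1}" "w' \<in> {0..1}" "dist w v < d" "dist w' v < d"
        using that by (auto simp: dist_real_def)
      show ?thesis
        unfolding P_def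
        by (intro allI impI word_cong.trans[OF uniq[OF w(1) _ d(2)[OF w(1,3)]]
              uniq[OF w(2) d(2)[OF w(2,4)]]])
    qed
    then show "\<exists>d>0. \<forall>w w'. w \<le> v \<and> v \<le> w' \<and> w' - w < d \<longrightarrow> P' w w'"
      unfolding P'_def using d(1) by blast
  qed simp
  then have P: "P 0 1" by (simp add: P'_def)
  have "tracks (\<lambda>t. H (0, t)) 0 1 cs" "tracks (\<lambda>t. H (1, t)) 0 1 cs'"
    using tracks_affine[of p 0 1 cs 1 "\<lambda>t. H (0, t)" 0] tracks_affine[of q 0 1 cs' 1 "\<lambda>t. H (1, t)" 0]
      cs H0 H1 by auto
  then show ?thesis
    using P unfolding P_def by blast
qed

subsection \<open>Words as paths\<close>

text \<open>
  A crossing from \<open>U a\<close> to \<open>U b\<close>; by \<open>edge_homotopic\<close> its homotopy class does not depend on the choice.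
\<close>

definition edge :: "'a \<Rightarrow> 'a \<Rightarrow> real \<Rightarrow> 'x" where
  "edge a b = (SOME e. \<exists>x g h. path_in (U a) g (pt a) x \<and> path_in (U b) h x (pt b) \<and> e = g +++ h)"

lemma path_in_U:
  assumes "a \<in> D" "x \<in> U a" "y \<in> U a"
  obtains g where "path_in (U a) g x y"
proof -
  have "path_connected (U a)"
    using connected_Int[OF assms(1) assms(1)] by simp
  then show ?thesis
    using assms(2,3) that unfolding path_connected_def path_in_def by blast
qed

lemma path_in_K: "a \<in> D \<Longrightarrow> path_in (U a) g x y \<Longrightarrow> path_in K g x y"
  using U_subset path_in_mono by blast

lemma edge_split:
  assumes "a \<in> D" "b \<in> D"
  obtains x g h where "x \<in> U a" "x \<in> U b" "path_in (U a) g (pt a) x" "path_in (U b) h x (pt b)"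
    "edge a b = g +++ h"
proof -
  obtain x where x: "x \<in> U a" "x \<in> U b"
    using nonempty_Int assms by blast
  obtain g h where "path_in (U a) g (pt a) x" "path_in (U b) h x (pt b)"
    using path_in_U[OF assms(1) pt_in[OF assms(1)] x(1)] path_in_U[OF assms(2) x(2) pt_in[OF assms(2)]]
    by metis
  then have "\<exists>e x g h. path_in (U a) g (pt a) x \<and> path_in (U b) h x (pt b) \<and> e = g +++ h"
    by blast
  then have "\<exists>x g h. path_in (U a) g (pt a) x \<and> path_in (U b) h x (pt b) \<and> edge a b = g +++ h"
    unfolding edge_def by (rule someI_ex)
  then obtain x g h where "path_in (U a) g (pt a) x" "path_in (U b) h x (pt b)" "edge a b = g +++ h"
    by blast
  moreover from this have "x \<in> U a" "x \<in> U b"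
    by (auto simp: path_in_def)
  ultimately show ?thesis
    using that by blast
qed

lemma path_in_edge: "a \<in> D \<Longrightarrow> b \<in> D \<Longrightarrow> path_in K (edge a b) (pt a) (pt b)"
  by (metis edge_split path_in_K path_in_join)

text \<open>
  Independence of the crossing point: a path inside the connected set \<open>U a \<inter> U b\<close> from one crossing
  point to another can be absorbed on either side.
\<close>

lemma edge_homotopic:
  assumes ab: "a \<in> D" "b \<in> D" and g: "path_in (U a) g (pt a) x" and h: "path_in (U b) h x (pt b)"
  shows "homotopic_paths K (edge a b) (g +++ h)"
proof -
  obtain x' g' h' where e: "x' \<in> U a" "x' \<in> U b" "path_in (U a) g' (pt a) x'"
    "path_in (U b) h' x' (pt b)" "edge a b = g' +++ h'"
    using edge_split[OF ab] .
  have "x \<in> U a" "x \<in> U b"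
    using g h by (auto simp: path_in_def)
  then obtain k where k: "path_in (U a \<inter> U b) k x x'"
    using connected_Int[OF ab] e(1,2) unfolding path_connected_def path_in_def by (metis IntI)
  have ka: "path_in (U a) k x x'" and kb: "path_in (U b) k x x'"
    using k path_in_mono by blast+
  have rk: "path_in (U a) (reversepath k) x' x"
    using ka path_in_reverse by blast
  have "homotopic_paths K (g' +++ h') ((g' +++ reversepath k) +++ (k +++ h'))"
    by (rule homotopic_detour[OF path_in_K path_in_K path_in_K]) (use ab e ka in auto)
  also have "homotopic_paths K \<dots> (g +++ h)"
  proof (rule homotopic_join)
    show "homotopic_paths K (g' +++ reversepath k) g"
      by (rule null_U[OF ab(1) path_in_join[OF e(3) rk] g])
    show "homotopic_paths K (k +++ h') h"
      by (rule null_U[OF ab(2) path_in_join[OF kb e(4)] h])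
    show "path_in K (g' +++ reversepath k) (pt a) x"
      by (rule path_in_K[OF ab(1) path_in_join[OF e(3) rk]])
    show "path_in K (k +++ h') x (pt b)"
      by (rule path_in_K[OF ab(2) path_in_join[OF kb e(4)]])
  qed
  finally show ?thesis
    using e by simp
qed

text \<open>
  Let all three edges cross at the common point \<open>x\<close>; then the detour from \<open>x\<close> to \<open>pt b\<close> and back cancels.
\<close>

lemma edge_triangle:
  assumes abc: "a \<in> D" "b \<in> D" "c \<in> D" and x: "x \<in> U a" "x \<in> U b" "x \<in> U c"
  shows "homotopic_paths K (edge a c) (edge a b +++ edge b c)"
proof -
  obtain f g h where f: "path_in (U a) f (pt a) x" and g: "path_in (U b) g (pt b) x"
    and h: "path_in (U c) h (pt c) x"
    using path_in_U pt_in abc x by metis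
  note K = path_in_K[OF abc(1) f] path_in_K[OF abc(2) g] path_in_K[OF abc(3) h]
  note rg = path_in_reverse[OF g] and rh = path_in_reverse[OF h]
  have "homotopic_paths K (edge a c) (f +++ reversepath h)"
    by (rule edge_homotopic[OF abc(1,3) f rh])
  also have "homotopic_paths K \<dots> ((f +++ reversepath g) +++ (g +++ reversepath h))"
    by (rule homotopic_detour[OF K(1,2) path_in_reverse[OF K(3)]])
  also have "homotopic_paths K \<dots> (edge a b +++ edge b c)"
    by (rule homotopic_join[OF homotopic_paths_sym[OF edge_homotopic[OF abc(1,2) f rg]]
          homotopic_paths_sym[OF edge_homotopic[OF abc(2,3) g rh]]
          path_in_join[OF K(1) path_in_reverse[OF K(2)]]
          path_in_join[OF K(2) path_in_reverse[OF K(3)]]])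
  finally show ?thesis .
qed

fun word_path :: "'a \<Rightarrow> (('a \<times> 'a) \<times> bool) list \<Rightarrow> real \<Rightarrow> 'x" where
  "word_path a [] = (\<lambda>_. pt a)"
| "word_path a (((b, c), True) # w) = edge b c +++ word_path c w"
| "word_path a (((b, c), False) # w) = reversepath (edge b c) +++ word_path b w"

lemma path_in_word_path: "word a w b \<Longrightarrow> path_in K (word_path a w) (pt a) (pt b)"
proof (induction a w rule: word_path.induct)
  case (1 a)
  then show ?case
    using pt_in U_subset by (auto intro!: path_in_const)
next
  case (2 a b c w)
  then show ?case
    by (auto intro!: path_in_join path_in_edge)
next
  case (3 a b c w)
  then show ?case
    by (auto intro!: path_in_join path_in_reverse path_in_edge)
qed

lemma word_path_append:
  "word a u b \<Longrightarrow> word b v c \<Longrightarrow> homotopic_paths K (word_path a (u @ v)) (word_path a u +++ word_path b v)"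
proof (induction a u rule: word_path.induct)
  case (1 a)
  then show ?case
    using homotopic_paths_sym homotopic_join_const(2) path_in_word_path by fastforce
next
  case (2 a d e w)
  then have de: "d \<in> D" "e \<in> D" "a = d" "word e w b"
    by auto
  have p: "path_in K (edge d e) (pt d) (pt e)" "path_in K (word_path e w) (pt e) (pt b)"
    "path_in K (word_path b v) (pt b) (pt c)" "path_in K (word_path e (w @ v)) (pt e) (pt c)"
    using de 2 by (auto intro!: path_in_edge path_in_word_path word_append)
  have "homotopic_paths K (edge d e +++ word_path e (w @ v)) (edge d e +++ (word_path e w +++ word_path b v))"
    by (rule homotopic_join[OF path_in_refl[OF p(1)] _ p(1,4)]) (use 2 de in auto)
  also have "homotopic_paths K \<dots> ((edge d e +++ word_path e w) +++ word_path b v)"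
    by (rule homotopic_paths_sym[OF homotopic_assoc[OF p(1-3)]])
  finally show ?case by simp
next
  case (3 a e d w)
  then have de: "d \<in> D" "e \<in> D" "a = d" "word e w b"
    by auto
  have p: "path_in K (reversepath (edge e d)) (pt d) (pt e)" "path_in K (word_path e w) (pt e) (pt b)"
    "path_in K (word_path b v) (pt b) (pt c)" "path_in K (word_path e (w @ v)) (pt e) (pt c)"
    using de 3 by (auto intro!: path_in_edge path_in_word_path path_in_reverse word_append)
  have "homotopic_paths K (reversepath (edge e d) +++ word_path e (w @ v))
      (reversepath (edge e d) +++ (word_path e w +++ word_path b v))"
    by (rule homotopic_join[OF path_in_refl[OF p(1)] _ p(1,4)]) (use 3 de in auto)
  also have "homotopic_paths K \<dots> ((reversepath (edge e d) +++ word_path e w) +++ word_path b v)"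
    by (rule homotopic_paths_sym[OF homotopic_assoc[OF p(1-3)]])
  finally show ?case by simp
qed

lemma word_path_single:
  assumes "a \<in> D" "b \<in> D"
  shows "homotopic_paths K (word_path a [((a, b), True)]) (edge a b)"
  using homotopic_join_const(1)[OF path_in_edge[OF assms]] by simp

text \<open>
  Cancellation of a letter against its inverse is cancellation of an edge path against its reverse;
  the triangle relations hold by \<open>edge_triangle\<close>.
\<close>

lemma word_path_wcong: "wcong a b u v \<Longrightarrow> homotopic_paths K (word_path a u) (word_path a v)"
proof (induction rule: word_cong.induct)
  case (refl a u b)
  then show ?case
    using path_in_word_path path_in_refl by blast
next
  case (sym a b u v)
  then show ?case
    by (rule_tac homotopic_paths_sym)
next
  case (trans a b u v w)
  then show ?case
    using homotopic_paths_trans by blast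
next
  case (append a b u u' c v v')
  then have w: "word a u b" "word a u' b" "word b v c" "word b v' c"
    using wcong_word by auto
  have "homotopic_paths K (word_path a (u @ v)) (word_path a u +++ word_path b v)"
    by (rule word_path_append[OF w(1,3)])
  also have "homotopic_paths K \<dots> (word_path a u' +++ word_path b v')"
    by (rule homotopic_join[OF append.IH path_in_word_path[OF w(1)] path_in_word_path[OF w(3)]])
  also have "homotopic_paths K \<dots> (word_path a (u' @ v'))"
    by (rule homotopic_paths_sym[OF word_path_append[OF w(2,4)]])
  finally show ?case .
next
  case (cancel a g p)
  obtain b c where g: "g = (b, c)"
    by fastforce
  then have bc: "b \<in> D" "c \<in> D"
    using cancel by (auto split: if_splits)
  have e: "path_in K (edge b c) (pt b) (pt c)"
    using bc by (rule path_in_edge)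
  have r: "path_in K (reversepath (edge b c)) (pt c) (pt b)"
    using e by (rule path_in_reverse)
  have re: "homotopic_paths K (reversepath (edge b c) +++ (\<lambda>_. pt b)) (reversepath (edge b c))"
    "homotopic_paths K (edge b c +++ (\<lambda>_. pt c)) (edge b c)"
    by (rule homotopic_join_const(1)[OF r] homotopic_join_const(1)[OF e])+
  have k: "path_in K (\<lambda>_. pt b) (pt b) (pt b)" "path_in K (\<lambda>_. pt c) (pt c) (pt c)"
    using bc pt_in U_subset by (auto intro!: path_in_const)
  show ?case
  proof (cases p)
    case True
    with cancel g have "a = b"
      by (simp only: is_word.simps if_True fst_conv)
    have "homotopic_paths K (edge b c +++ (reversepath (edge b c) +++ (\<lambda>_. pt b)))
        (edge b c +++ reversepath (edge b c))"
      by (rule homotopic_join[OF path_in_refl[OF e] re(1) e path_in_join[OF r k(1)]])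
    also have "homotopic_paths K \<dots> (\<lambda>_. pt b)"
      by (rule homotopic_join_const(3)[OF e])
    finally show ?thesis
      using True g \<open>a = b\<close> by simp
  next
    case False
    with cancel g have "a = c"
      by (simp only: is_word.simps if_False snd_conv)
    have "homotopic_paths K (reversepath (edge b c) +++ (edge b c +++ (\<lambda>_. pt c)))
        (reversepath (edge b c) +++ edge b c)"
      by (rule homotopic_join[OF path_in_refl[OF r] re(2) r path_in_join[OF e k(2)]])
    also have "homotopic_paths K \<dots> (\<lambda>_. pt c)"
      by (rule homotopic_join_const(4)[OF e])
    finally show ?thesis
      using False g \<open>a = c\<close> by simp
  qed
next
  case (relation u v a b)
  obtain d e f where "u = [((d, f), True)]" "v = [((d, e), True), ((e, f), True)]"
    "d \<in> D" "e \<in> D" "f \<in> D" "U d \<inter> U e \<inter> U f \<noteq> {}"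
    using relation.hyps(1) unfolding triangle_rel_def mem_Collect_eq prod.inject by metis
  then obtain x where d: "u = [((d, f), True)]" "v = [((d, e), True), ((e, f), True)]"
    "d \<in> D" "e \<in> D" "f \<in> D" "x \<in> U d" "x \<in> U e" "x \<in> U f"
    by blast
  note p = path_in_edge[OF d(3,4)] path_in_edge[OF d(4,5)]
  have a: "a = d" "word d u f" "word e [((e, f), True)] f"
    using relation d by auto
  have "homotopic_paths K (word_path a u) (edge d f)"
    using word_path_single d a by simp
  also have "homotopic_paths K \<dots> (edge d e +++ edge e f)"
    using edge_triangle d by blast
  also have "homotopic_paths K \<dots> (edge d e +++ word_path e [((e, f), True)])"
    by (rule homotopic_join[OF path_in_refl[OF p(1)] homotopic_paths_sym[OF word_path_single[OF d(4,5)]] p])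
  finally show ?case
    using d by simp
qed

text \<open>
  At each subdivision point insert a detour to the base point of the current set. The statement carries
  a path \<open>g\<close> that leads from the current base point to \<open>p s\<close>; in the induction step the part of \<open>p\<close> in
  \<open>U c\<close>, preceded by a path from the base point of \<open>U c\<close>, takes over its role.
\<close>

lemma tracks_word_path:
  assumes "path p" "path_image p \<subseteq> K" "b \<in> D" "path_in (U b) h (p u) (pt b)" "u \<le> 1"
  shows "tracks p s u cs \<Longrightarrow> 0 \<le> s \<Longrightarrow> a \<in> D \<Longrightarrow> path_in (U a) g (pt a) (p s) \<Longrightarrow>
    homotopic_paths K (g +++ ((p \<circ> linepath s u) +++ h)) (word_path a (trace_word a cs b))"
proof (induction cs arbitrary: s a g)
  case Nil
  then have "s = u" by simp
  have "linepath u u = (\<lambda>_. u)"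
    by (auto simp: linepath_def algebra_simps)
  then have c: "p \<circ> linepath u u = (\<lambda>_. p u)"
    by auto
  note h = path_in_K[OF assms(3,4)] and g = path_in_K[OF Nil(3,4)]
  have pu: "path_in K ((\<lambda>_. p u) +++ h) (p u) (pt b)"
    by (rule path_in_join[OF path_in_const h]) (use h in \<open>auto simp: path_in_def\<close>)
  have "homotopic_paths K (g +++ ((p \<circ> linepath s u) +++ h)) (g +++ h)"
    unfolding \<open>s = u\<close> c
    by (rule homotopic_join[OF path_in_refl[OF g] homotopic_join_const(2)[OF h] _ pu])
      (use g \<open>s = u\<close> in auto)
  also have "homotopic_paths K \<dots> (edge a b)"
    by (rule homotopic_paths_sym[OF edge_homotopic]) (use Nil assms \<open>s = u\<close> in auto)
  also have "homotopic_paths K \<dots> (word_path a (trace_word a [] b))"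
    using homotopic_paths_sym[OF word_path_single] Nil assms by simp
  finally show ?case .
next
  case (Cons c cs)
  then obtain t where t: "c \<in> D" "s \<le> t" "p ` {s..t} \<subseteq> U c" "tracks p t u cs"
    by auto
  have tu: "t \<le> u"
    using t(4) by (rule tracks_le)
  have "p s \<in> U c"
    using t by auto
  then obtain k where k: "path_in (U c) k (pt c) (p s)"
    using path_in_U[OF t(1) pt_in[OF t(1)]] by blast
  let ?st = "p \<circ> linepath s t" and ?tu = "p \<circ> linepath t u"
  have st: "path_in (U c) ?st (p s) (p t)"
    using t Cons.prems assms tu by (intro path_in_segment) auto
  have seg: "path_in K (p \<circ> linepath s u) (p s) (p u)" "path_in K ?tu (p t) (p u)"
    using t(2) Cons.prems(2) assms(1,2,5) tu by (intro path_in_segment; force simp: path_image_def)+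
  note h = path_in_K[OF assms(3,4)] and g = path_in_K[OF Cons.prems(3,4)]
    and kK = path_in_K[OF t(1) k] and stK = path_in_K[OF t(1) st]
  note ks = path_in_join[OF k st] and su_h = path_in_join[OF seg(1) h] and tu_h = path_in_join[OF seg(2) h]
  have IH: "homotopic_paths K ((k +++ ?st) +++ (?tu +++ h)) (word_path c (trace_word c cs b))"
    by (rule Cons.IH[OF t(4) _ t(1) ks]) (use Cons.prems t in auto)
  have "homotopic_paths K (k +++ ((p \<circ> linepath s u) +++ h)) (k +++ (?st +++ (?tu +++ h)))"
  proof (rule homotopic_join[OF path_in_refl[OF kK] _ kK su_h])
    have "homotopic_paths K ((p \<circ> linepath s u) +++ h) ((?st +++ ?tu) +++ h)"
      by (rule homotopic_join[OF homotopic_segment_split path_in_refl[OF h] seg(1) h])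
        (use assms Cons.prems t tu in auto)
    also have "homotopic_paths K \<dots> (?st +++ (?tu +++ h))"
      by (rule homotopic_assoc[OF stK seg(2) h])
    finally show "homotopic_paths K ((p \<circ> linepath s u) +++ h) (?st +++ (?tu +++ h))" .
  qed
  also have "homotopic_paths K \<dots> ((k +++ ?st) +++ (?tu +++ h))"
    by (rule homotopic_paths_sym[OF homotopic_assoc[OF kK stK tu_h]])
  also note IH
  finally have 1: "homotopic_paths K (k +++ ((p \<circ> linepath s u) +++ h)) (word_path c (trace_word c cs b))" .
  have 2: "homotopic_paths K (edge a c) (g +++ reversepath k)"
    by (rule edge_homotopic[OF Cons.prems(3) t(1) Cons.prems(4) path_in_reverse[OF k]])
  have "homotopic_paths K (g +++ ((p \<circ> linepath s u) +++ h))
      ((g +++ reversepath k) +++ (k +++ ((p \<circ> linepath s u) +++ h)))"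
    by (rule homotopic_detour[OF g kK su_h])
  also have "homotopic_paths K \<dots> (edge a c +++ word_path c (trace_word c cs b))"
    by (rule homotopic_join[OF homotopic_paths_sym[OF 2] 1 path_in_join[OF g path_in_reverse[OF kK]]
          path_in_join[OF kK su_h]])
  finally show ?case
    by (simp only: trace_word.simps word_path.simps)
qed

lemma path_homotopic_word_path:
  assumes p: "path_in K p (pt a) (pt b)" and ab: "a \<in> D" "b \<in> D"
  obtains w where "word a w b" "homotopic_paths K (word_path a w) p"
proof -
  obtain cs where cs: "tracks p 0 1 cs"
    using tracks_exists p by (auto simp: path_in_def)
  have c: "path_in (U a) (\<lambda>_. pt a) (pt a) (p 0)" "path_in (U b) (\<lambda>_. pt b) (p 1) (pt b)"
    using p ab pt_in path_in_const by (auto simp: path_in_def pathstart_def pathfinish_def)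
  have pb: "path_in K (p +++ (\<lambda>_. pt b)) (pt a) (pt b)"
    using p ab pt_in U_subset by (auto intro!: path_in_join path_in_const)
  have "homotopic_paths K ((\<lambda>_. pt a) +++ (p +++ (\<lambda>_. pt b))) (word_path a (trace_word a cs b))"
    using tracks_word_path[of p b _ 1 0 cs a] c cs ab p
    by (auto simp: path_in_def compose_linepath_01 simp del: o_apply)
  moreover have "homotopic_paths K ((\<lambda>_. pt a) +++ (p +++ (\<lambda>_. pt b))) p"
    using homotopic_join_const(2)[OF pb] homotopic_join_const(1)[OF p] homotopic_paths_trans by blast
  ultimately have "homotopic_paths K (word_path a (trace_word a cs b)) p"
    using homotopic_paths_sym homotopic_paths_trans by blast
  moreover have "word a (trace_word a cs b) b"
    using trace_word_word ab tracks_in_D[OF cs] by blast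
  ultimately show ?thesis
    using that by blast
qed

lemma tracks_join:
  assumes "tracks p 0 1 cs" "tracks q 0 1 cs'" "b \<in> D" "p 1 \<in> U b" "p 1 = q 0"
  shows "tracks (p +++ q) 0 1 (cs @ b # cs')"
proof -
  have "tracks (p +++ q) (1/2 * 0 + 0) (1/2 * 1 + 0) cs"
    by (rule tracks_affine[OF assms(1)]) (auto simp: joinpaths_def)
  moreover have "tracks (p +++ q) (1/2 * 0 + 1/2) (1/2 * 1 + 1/2) cs'"
    by (rule tracks_affine[OF assms(2)]) (use assms(5) in \<open>auto simp: joinpaths_def\<close>)
  moreover have "(p +++ q) ` {1/2..1/2} \<subseteq> U b"
    using assms by (simp add: joinpaths_def)
  ultimately have "tracks (p +++ q) 0 (1/2) cs" "(p +++ q) ` {1/2..1/2} \<subseteq> U b"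
    "tracks (p +++ q) (1/2) 1 cs'"
    by simp_all
  then show ?thesis
    using assms(3) tracks_append[of "p +++ q" 0 "1/2" cs 1 "b # cs'"] tracks.simps(2) by blast
qed

lemma tracks_edge:
  assumes ab: "a \<in> D" "b \<in> D"
  shows "tracks (edge a b) 0 1 [a, b]" "tracks (reversepath (edge a b)) 0 1 [b, a]"
proof -
  obtain x g h where e: "path_in (U a) g (pt a) x" "path_in (U b) h x (pt b)" "edge a b = g +++ h"
    using edge_split[OF ab] by metis
  have "g t \<in> U a" "h t \<in> U b" if "t \<in> {0..1}" for t
    using e that by (auto simp: path_in_def path_image_def)
  moreover have "g 1 = h 0"
    using e by (auto simp: path_in_def pathfinish_def pathstart_def)
  ultimately have "edge a b t \<in> U a" if "t \<in> {0..1/2}" for t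
    using e(3) that by (simp add: joinpaths_def)
  moreover have "edge a b t \<in> U b" if "t \<in> {1/2..1}" for t
  proof (cases "t = 1/2")
    case True
    show ?thesis
      unfolding True e(3) joinpaths_def
      using \<open>g 1 = h 0\<close> \<open>\<And>t. t \<in> {0..1} \<Longrightarrow> h t \<in> U b\<close>[of 0] by simp
  next
    case False
    then show ?thesis
      using e(3) that \<open>\<And>t. t \<in> {0..1} \<Longrightarrow> h t \<in> U b\<close> by (simp add: joinpaths_def)
  qed
  ultimately have 1: "edge a b ` {0..1/2} \<subseteq> U a" "edge a b ` {1/2..1} \<subseteq> U b"
    by blast+
  have halves: "tracks q 0 1 [c, d]"
    if "c \<in> D" "d \<in> D" "q ` {0..1/2} \<subseteq> U c" "q ` {1/2..1} \<subseteq> U d" for q c d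
  proof -
    have "tracks q (1/2) 1 [d]"
      using that by simp
    then show ?thesis
      using that tracks.simps(2)[of q 0 1 c "[d]"] by fastforce
  qed
  show "tracks (edge a b) 0 1 [a, b]"
    by (rule halves[OF ab 1])
  have "reversepath (edge a b) ` {0..1/2} \<subseteq> U b" "reversepath (edge a b) ` {1/2..1} \<subseteq> U a"
    using 1 by (auto simp: reversepath_def)
  then show "tracks (reversepath (edge a b)) 0 1 [b, a]"
    by (rule halves[OF ab(2,1)])
qed

lemma trace_word_edge:
  assumes ab: "a \<in> D" "b \<in> D"
  shows "wcong a b (trace_word a [a, b] b) [((a, b), True)]"
proof -
  have "wcong a b ([((a, a), True)] @ ([((a, b), True)] @ [((b, b), True)])) ([] @ ([((a, b), True)] @ []))"
    using ab by (intro word_cong.append[of _ _ _ _ _ a a] word_cong.append[of _ _ _ _ _ a b]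
        wcong_identity word_cong.refl) auto
  then show ?thesis by simp
qed

text \<open>
  Each letter is tracked by its two end labels, and a constant piece in the common label is put between
  successive letters: by \<open>trace_word_append\<close> the traced words then concatenate literally.
\<close>

lemma word_path_tracks:
  "word a w b \<Longrightarrow> \<exists>cs. tracks (word_path a w) 0 1 cs \<and> wcong a b (trace_word a cs b) w"
proof (induction a w rule: word_path.induct)
  case (1 a)
  then have a: "a = b" "b \<in> D"
    by auto
  have "wcong b b ([((b, b), True)] @ [((b, b), True)]) ([] @ [])"
    using a by (intro word_cong.append[of _ _ _ _ _ b b] wcong_identity)
  then have "wcong b b (trace_word b [b] b) []"
    by simp
  moreover have "tracks (word_path b []) 0 1 [b]"
    using a pt_in by (auto intro!: exI[of _ 1])
  ultimately show ?case
    using a by blast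
next
  case (2 a d e w)
  then have de: "d \<in> D" "e \<in> D" "a = d" "word e w b"
    by auto
  then obtain cs where cs: "tracks (word_path e w) 0 1 cs" "wcong e b (trace_word e cs b) w"
    using 2 by blast
  have ends: "edge d e 1 = pt e" "word_path e w 0 = pt e"
    using path_in_edge[OF de(1,2)] path_in_word_path[OF de(4)]
    by (auto simp: path_in_def pathfinish_def pathstart_def)
  have "tracks (edge d e +++ word_path e w) 0 1 ([d, e] @ e # cs)"
    using tracks_edge cs de ends pt_in by (intro tracks_join) auto
  moreover have "wcong d b (trace_word d ([d, e] @ e # cs) b) ([((d, e), True)] @ w)"
    unfolding trace_word_append using trace_word_edge cs de by (intro word_cong.append)
  ultimately show ?case
    using de by (intro exI[of _ "[d, e] @ e # cs"]) simp
next
  case (3 a e d w)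
  then have de: "d \<in> D" "e \<in> D" "a = d" "word e w b"
    by auto
  then obtain cs where cs: "tracks (word_path e w) 0 1 cs" "wcong e b (trace_word e cs b) w"
    using 3 by blast
  have ends: "reversepath (edge e d) 1 = pt e" "word_path e w 0 = pt e"
    using path_in_reverse[OF path_in_edge[OF de(2,1)]] path_in_word_path[OF de(4)]
    by (auto simp: path_in_def pathfinish_def pathstart_def)
  have "tracks (reversepath (edge e d) +++ word_path e w) 0 1 ([d, e] @ e # cs)"
    using tracks_edge cs de ends pt_in by (intro tracks_join) auto
  moreover have "wcong d e (trace_word d [d, e] e) [((e, d), False)]"
    by (rule word_cong.trans[OF trace_word_edge word_cong.sym[OF wcong_inverse]]) (use de in auto)
  then have "wcong d b (trace_word d ([d, e] @ e # cs) b) ([((e, d), False)] @ w)"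
    unfolding trace_word_append using cs by (intro word_cong.append)
  ultimately show ?case
    using de by (intro exI[of _ "[d, e] @ e # cs"]) simp
qed

lemma homotopic_word_paths:
  assumes w: "word a u b" "word a v b" and h: "homotopic_paths K (word_path a u) (word_path a v)"
  shows "wcong a b u v"
proof -
  have ab: "a \<in> D" "b \<in> D"
    using w word_objects by auto
  obtain cs where cs: "tracks (word_path a u) 0 1 cs" "wcong a b (trace_word a cs b) u"
    using word_path_tracks w by blast
  obtain ds where ds: "tracks (word_path a v) 0 1 ds" "wcong a b (trace_word a ds b) v"
    using word_path_tracks w by blast
  have "wcong a b u (trace_word a cs b)"
    using cs(2) by (rule word_cong.sym)
  also have "wcong a b \<dots> (trace_word a ds b)"
    by (rule trace_word_homotopic[OF h path_in_word_path[OF w(1)] ab cs(1) ds(1)])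
  also have "wcong a b \<dots> v"
    by (rule ds(2))
  finally show ?thesis .
qed

subsection \<open>The presentation by the nerve\<close>

text \<open>
  A word is sent to the class of its path. This is well defined by \<open>word_path_wcong\<close>, injective by
  \<open>homotopic_word_paths\<close> and surjective by \<open>path_homotopic_word_path\<close>.
\<close>

theorem nerve_presentation:
  "groupoid_presentation (fundamental_groupoid (top_of_set K) D pt) (D \<times> D) fst snd
    (\<lambda>(a, b). path_homotopy (top_of_set K) (pt a) (pt b) `` {edge a b}) triangle_rel"
proof -
  let ?P = "presented_groupoid D (D \<times> D) fst snd triangle_rel"
  let ?G = "fundamental_groupoid (top_of_set K) D pt"
  let ?c = "\<lambda>a b. {(u, v). wcong a b u v}"
  let ?r = "\<lambda>a b. path_homotopy (top_of_set K) (pt a) (pt b)"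
  let ?F = "\<lambda>a b W. \<Union>w\<in>W. ?r a b `` {word_path a w}"
  have ptK: "pt a \<in> K" if "a \<in> D" for a
    using that pt_in U_subset by blast
  have Psimps: "gobj ?P = D" "ghom ?P a b = {w. word a w b} // ?c a b" "gid ?P a = ?c a a `` {[]}"
    "gcomp ?P a b c V W = (\<Union>v\<in>V. \<Union>w\<in>W. ?c a c `` {v @ w})" for a b c V W
    by (simp_all add: presented_groupoid_def)
  have Gsimps: "gobj ?G = D" "ghom ?G a b = paths_between (top_of_set K) (pt a) (pt b) // ?r a b"
    "gid ?G a = ?r a a `` {\<lambda>_. pt a}" for a b
    by (simp_all add: fundamental_groupoid_def)
  have iff: "(u, v) \<in> ?c a b \<longleftrightarrow> (word_path a u, word_path a v) \<in> ?r a b"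
    if "word a u b" "word a v b" for a b u v
    using that word_path_wcong homotopic_word_paths path_in_word_path by (auto simp: path_homotopy_iff)
  have mono: "(word_path a u, word_path a v) \<in> ?r a b" if "(u, v) \<in> ?c a b" for a b u v
  proof -
    have "wcong a b u v"
      using that by simp
    then show ?thesis
      using word_path_wcong wcong_word path_in_word_path unfolding path_homotopy_iff by blast
  qed
  have cls: "?F a b (?c a b `` {w}) = ?r a b `` {word_path a w}" if "word a w b" for a b w
    by (rule UN_quotient_class[OF equiv_word_cong equiv_path_homotopy mono]) (use that in auto)
  have iso: "groupoid_iso ?P ?G ?F"
    unfolding groupoid_iso_def Psimps Gsimps
  proof (intro conjI ballI)
    show "D = D" ..
  next
    fix a b assume ab: "a \<in> D" "b \<in> D"
    show "bij_betw (?F a b) ({w. word a w b} // ?c a b)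
        (paths_between (top_of_set K) (pt a) (pt b) // ?r a b)"
    proof (rule bij_betw_quotient[OF equiv_word_cong equiv_path_homotopy])
      fix p assume "p \<in> paths_between (top_of_set K) (pt a) (pt b)"
      then obtain w where "word a w b" "homotopic_paths K (word_path a w) p"
        using path_homotopic_word_path ab by (metis paths_between_iff)
      then show "\<exists>w\<in>{w. word a w b}. (word_path a w, p) \<in> ?r a b"
        using path_in_word_path by (auto simp: path_homotopy_iff)
    qed (use iff path_in_word_path in \<open>auto simp: paths_between_iff\<close>)
  next
    fix a assume "a \<in> D"
    then show "?F a a (?c a a `` {[]}) = ?r a a `` {\<lambda>_. pt a}"
      using cls[of a "[]" a] by simp
  next
    fix a b c V W assume "V \<in> {w. word a w b} // ?c a b" "W \<in> {w. word b w c} // ?c b c"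
    then obtain v w where v: "word a v b" "V = ?c a b `` {v}" and w: "word b w c" "W = ?c b c `` {w}"
      by (auto simp: quotient_def)
    have "(\<Union>v\<in>V. \<Union>w\<in>W. ?c a c `` {v @ w}) = ?c a c `` {v @ w}"
      unfolding v(2) w(2)
      by (rule UN_quotient_class2[OF equiv_word_cong equiv_word_cong equiv_word_cong])
        (use v w in \<open>auto intro: word_cong.append\<close>)
    then have "?F a c (\<Union>v\<in>V. \<Union>w\<in>W. ?c a c `` {v @ w}) = ?r a c `` {word_path a (v @ w)}"
      using cls[OF word_append[OF v(1) w(1)]] by simp
    also have "\<dots> = ?r a c `` {word_path a v +++ word_path b w}"
      by (rule equiv_class_eq[OF equiv_path_homotopy])
        (use v w word_path_append path_in_word_path word_append in \<open>auto simp: path_homotopy_iff\<close>)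
    also have "\<dots> = gcomp ?G a b c (?r a b `` {word_path a v}) (?r b c `` {word_path b w})"
      by (rule gcomp_fundamental[where pt = pt, symmetric])
        (use v w path_in_word_path in auto)
    also have "\<dots> = gcomp ?G a b c (?F a b V) (?F b c W)"
      unfolding v(2) w(2) cls[OF v(1)] cls[OF w(1)] ..
    finally show "?F a c (\<Union>v\<in>V. \<Union>w\<in>W. ?c a c `` {v @ w}) = gcomp ?G a b c (?F a b V) (?F b c W)" .
  qed
  have gen: "?F a b {w. wcong a b [((a, b), True)] w} = ?r a b `` {edge a b}" if "a \<in> D" "b \<in> D" for a b
  proof -
    have "{w. wcong a b [((a, b), True)] w} = ?c a b `` {[((a, b), True)]}"
      by auto
    then have "?F a b {w. wcong a b [((a, b), True)] w} = ?r a b `` {word_path a [((a, b), True)]}"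
      using cls[of a "[((a, b), True)]" b] that by simp
    also have "\<dots> = ?r a b `` {edge a b}"
      by (rule equiv_class_eq[OF equiv_path_homotopy])
        (use that word_path_single path_in_word_path[of a "[((a, b), True)]" b] in \<open>simp add: path_homotopy_iff\<close>)
    finally show ?thesis .
  qed
  show ?thesis
    unfolding groupoid_presentation_def Gsimps
  proof (intro conjI ballI exI[of _ ?F] iso)
    show "is_groupoid ?G"
      by (rule is_groupoid_fundamental) (rule ptK)
  next
    fix g assume "g \<in> D \<times> D"
    then obtain a b where g: "g = (a, b)" "a \<in> D" "b \<in> D"
      by auto
    show "fst g \<in> D" "snd g \<in> D"
      using g by auto
    show "(case g of (a, b) \<Rightarrow> ?r a b `` {edge a b}) \<in>
        paths_between (top_of_set K) (pt (fst g)) (pt (snd g)) // ?r (fst g) (snd g)"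
      using g path_in_edge by (auto simp: paths_between_iff intro!: quotientI)
    show "?F (fst g) (snd g) {w. wcong (fst g) (snd g) [(g, True)] w} =
        (case g of (a, b) \<Rightarrow> ?r a b `` {edge a b})"
      using gen g by simp
  next
    fix e assume "e \<in> triangle_rel"
    then obtain a b c where "e = ([((a, c), True)], [((a, b), True), ((b, c), True)])"
      "a \<in> D" "b \<in> D" "c \<in> D"
      unfolding triangle_rel_def by blast
    then show "case e of (u, v) \<Rightarrow> \<exists>a b. word a u b \<and> word a v b"
      by auto
  qed
qed

end


section \<open>Dimer coverings and cycles\<close>

locale fin_graph =
  fixes \<Gamma> :: "('v, 'e) mgraph"
  assumes finite_graph: "finite_graph \<Gamma>"
begin

abbreviation "V \<equiv> verts \<Gamma>"
abbreviation "E \<equiv> edges \<Gamma>"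
abbreviation "D \<equiv> dimer_coverings \<Gamma>"

lemma finite_E: "finite E"
  using finite_graph by (auto simp: finite_graph_def)

lemma ends_V: "e \<in> E \<Longrightarrow> v \<in> ends \<Gamma> e \<Longrightarrow> v \<in> V"
  using finite_graph by (auto simp: finite_graph_def)

lemma ends_pair:
  assumes "e \<in> E" "v \<in> ends \<Gamma> e"
  obtains u where "ends \<Gamma> e = {v, u}" "u \<noteq> v"
proof -
  have "card (ends \<Gamma> e) = 2"
    using finite_graph assms(1) by (auto simp: finite_graph_def)
  then obtain a b where "ends \<Gamma> e = {a, b}" "a \<noteq> b"
    by (meson card_2_iff)
  then show ?thesis
    using that[of a] that[of b] assms(2) by (cases "v = a") auto
qed

lemma edge_vertex:
  assumes "e \<in> E"
  obtains v where "v \<in> ends \<Gamma> e" "v \<in> V"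
proof -
  have "card (ends \<Gamma> e) = 2"
    using finite_graph assms by (auto simp: finite_graph_def)
  then obtain v where "v \<in> ends \<Gamma> e"
    by (metis card.empty equals0I zero_neq_numeral)
  then show ?thesis
    using that ends_V assms by blast
qed

lemma dimer_subset: "A \<in> D \<Longrightarrow> A \<subseteq> E"
  by (simp add: dimer_coverings_def)

lemma dimer_unique:
  "A \<in> D \<Longrightarrow> v \<in> V \<Longrightarrow> e \<in> A \<Longrightarrow> f \<in> A \<Longrightarrow> v \<in> ends \<Gamma> e \<Longrightarrow> v \<in> ends \<Gamma> f \<Longrightarrow> e = f"
  by (auto simp: dimer_coverings_def)

lemma edge_at:
  assumes "A \<in> D" "v \<in> V"
  shows "edge_at \<Gamma> A v \<in> A" "v \<in> ends \<Gamma> (edge_at \<Gamma> A v)"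
proof -
  have "\<exists>!e. e \<in> A \<and> v \<in> ends \<Gamma> e"
    using assms by (auto simp: dimer_coverings_def)
  from theI'[OF this] show "edge_at \<Gamma> A v \<in> A" "v \<in> ends \<Gamma> (edge_at \<Gamma> A v)"
    by (auto simp: edge_at_def)
qed

lemma edge_at_eq: "A \<in> D \<Longrightarrow> v \<in> V \<Longrightarrow> e \<in> A \<Longrightarrow> v \<in> ends \<Gamma> e \<Longrightarrow> edge_at \<Gamma> A v = e"
  using edge_at dimer_unique by blast

lemma independent_disjoint:
  assumes "independent_edges \<Gamma> s t" "s \<subseteq> E"
  shows "s \<inter> t = {}"
proof (rule ccontr)
  assume "s \<inter> t \<noteq> {}"
  then obtain e where e: "e \<in> s" "e \<in> t"
    by blast
  then obtain v where "v \<in> ends \<Gamma> e"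
    using edge_vertex assms(2) by blast
  then show False
    using assms(1) e unfolding independent_edges_def by blast
qed

subsection \<open>Circles\<close>

lemma circle_subset_nonempty: "is_circle \<Gamma> s \<Longrightarrow> s \<noteq> {}"
  by (auto simp: is_circle_def)

text \<open>Connectedness of circles: successive edges of the cyclic list are adjacent.\<close>

lemma circle_induct:
  assumes circle: "is_circle \<Gamma> s" and ef: "e \<in> s" "P e" "f \<in> s"
    and step: "\<And>f g v. f \<in> s \<Longrightarrow> g \<in> s \<Longrightarrow> v \<in> ends \<Gamma> f \<Longrightarrow> v \<in> ends \<Gamma> g \<Longrightarrow> P f \<Longrightarrow> P g"
  shows "P f"
proof -
  obtain vs es where c: "length vs = length es" "set es = s"
    "\<And>i. i < length es \<Longrightarrow> ends \<Gamma> (es ! i) = {vs ! i, vs ! (Suc i mod length vs)}"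
    using circle by (auto simp: is_circle_def)
  have adj: "P (es ! i) \<longleftrightarrow> P (es ! Suc i)" if "Suc i < length es" for i
  proof -
    have "vs ! Suc i \<in> ends \<Gamma> (es ! i)" "vs ! Suc i \<in> ends \<Gamma> (es ! Suc i)"
      using c(3)[of i] c(3)[of "Suc i"] that c(1) by auto
    then show ?thesis
      using step[of "es ! i" "es ! Suc i"] step[of "es ! Suc i" "es ! i"] that c(2) by (metis Suc_lessD nth_mem)
  qed
  have "P (es ! i) \<longleftrightarrow> P (es ! 0)" if "i < length es" for i
    using that by (induction i) (use adj in auto)
  then show ?thesis
    using ef c(2) by (metis in_set_conv_nth)
qed

text \<open>Independent circles are the connected components of their union.\<close>

lemma independent_circles_subset:
  assumes S: "\<And>s. s \<in> S \<Longrightarrow> is_circle \<Gamma> s" "pairwise (independent_edges \<Gamma>) S"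
    and S': "\<And>s. s \<in> S' \<Longrightarrow> is_circle \<Gamma> s" "pairwise (independent_edges \<Gamma>) S'"
    and eq: "\<Union>S = \<Union>S'"
  shows "S \<subseteq> S'"
proof
  fix s assume s: "s \<in> S"
  then obtain e where e: "e \<in> s"
    using S(1) circle_subset_nonempty by blast
  then obtain t where t: "t \<in> S'" "e \<in> t"
    using eq s by blast
  have closed: "g \<in> r"
    if "pairwise (independent_edges \<Gamma>) R" "r \<in> R" "f \<in> r" "v \<in> ends \<Gamma> f" "v \<in> ends \<Gamma> g" "g \<in> \<Union>R"
    for R r f g v
    using that unfolding pairwise_def independent_edges_def by blast
  have "s \<subseteq> t"
  proof
    fix f assume "f \<in> s"
    show "f \<in> t"
      by (rule circle_induct[OF S(1)[OF s] e, of "\<lambda>f. f \<in> t"])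
        (use t \<open>f \<in> s\<close> s eq closed[OF S'(2) t(1)] in blast)+
  qed
  moreover have "t \<subseteq> s"
  proof
    fix f assume "f \<in> t"
    show "f \<in> s"
      by (rule circle_induct[OF S'(1)[OF t(1)] t(2), of "\<lambda>f. f \<in> s"])
        (use e t \<open>f \<in> t\<close> eq closed[OF S(2) s] in blast)+
  qed
  ultimately show "s \<in> S'"
    using t by simp
qed

lemma cyclic_set_pair:
  assumes s: "cyclic_set \<Gamma> s" and e: "e \<in> s" "v \<in> ends \<Gamma> e"
  obtains f where "f \<in> s" "f \<noteq> e" "v \<in> ends \<Gamma> f" "{g \<in> s. v \<in> ends \<Gamma> g} = {e, f}"
proof -
  have "v \<in> V"
    using s e ends_V by (auto simp: cyclic_set_def)
  then have "card {g \<in> s. v \<in> ends \<Gamma> g} = 2"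
    using s e by (auto simp: cyclic_set_def)
  then obtain a b where ab: "{g \<in> s. v \<in> ends \<Gamma> g} = {a, b}" "a \<noteq> b"
    by (meson card_2_iff)
  moreover have "e \<in> {a, b}"
    using ab(1) e by blast
  ultimately show ?thesis
    using that[of a] that[of b] by blast
qed

text \<open>Follow a longest path inside the cyclic set. It cannot be prolonged, so the next edge leads back
  to an earlier vertex; this is the first one, because the inner vertices already have two edges.\<close>

lemma cyclic_set_contains_circle:
  assumes s: "cyclic_set \<Gamma> s" "s \<noteq> {}"
  shows "\<exists>c\<subseteq>s. is_circle \<Gamma> c \<and> (\<forall>e\<in>c. \<forall>f\<in>s. ends \<Gamma> e \<inter> ends \<Gamma> f \<noteq> {} \<longrightarrow> f \<in> c)"
proof -
  \<comment> \<open>\<open>Q\<close> holds for the edge lists of paths with distinct vertices and at least one edge; one of greatest length is taken.\<close>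
  define trail where "trail vs es \<longleftrightarrow> length vs = Suc (length es) \<and> distinct vs \<and> distinct es \<and>
    set es \<subseteq> s \<and> (\<forall>i<length es. ends \<Gamma> (es ! i) = {vs ! i, vs ! Suc i})" for vs es
  have sE: "s \<subseteq> E" and fin: "finite s"
    using s(1) by (auto simp: cyclic_set_def)
  define Q where "Q es \<longleftrightarrow> es \<noteq> [] \<and> (\<exists>vs. trail vs es)" for es
  have bound: "length es < Suc (card s)" if "Q es" for es
  proof -
    have "distinct es" "set es \<subseteq> s"
      using that by (auto simp: Q_def trail_def)
    then show ?thesis
      by (metis card_mono distinct_card fin less_Suc_eq_le)
  qed
  obtain e0 where e0: "e0 \<in> s"
    using s(2) by blast
  obtain a where "a \<in> ends \<Gamma> e0"
    using edge_vertex e0 sE by blast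
  then obtain b where "ends \<Gamma> e0 = {a, b}" "b \<noteq> a"
    using ends_pair e0 sE by blast
  then have "trail [a, b] [e0]"
    using e0 by (simp add: trail_def)
  then have "Q [e0]"
    unfolding Q_def by blast
  from Lattices_Big.ex_has_greatest_nat[of Q, OF this, of length "Suc (card s)"] bound
  have "\<exists>es. Q es \<and> (\<forall>fs. Q fs \<longrightarrow> length fs \<le> length es)"
    by blast
  then obtain es where es: "Q es" "\<And>fs. Q fs \<Longrightarrow> length fs \<le> length es"
    by blast
  then obtain vs where t: "trail vs es" and ne: "es \<noteq> []"
    by (auto simp: Q_def)
  let ?n = "length es"
  have len: "length vs = Suc ?n" and dist: "distinct vs" "distinct es" and es_s: "set es \<subseteq> s"
    and ends: "\<And>i. i < ?n \<Longrightarrow> ends \<Gamma> (es ! i) = {vs ! i, vs ! Suc i}"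
    using t by (auto simp: trail_def)
  have npos: "0 < ?n"
    using ne by simp
  have vs_eq: "vs ! i = vs ! j \<longleftrightarrow> i = j" if "i \<le> ?n" "j \<le> ?n" for i j
    using nth_eq_iff_index_eq[OF dist(1)] len that by simp
  have es_in: "es ! i \<in> s" if "i < ?n" for i
    using es_s that by auto
  have last: "vs ! ?n \<in> ends \<Gamma> (es ! (?n - 1))"
    using ends[of "?n - 1"] npos by simp
  obtain f where f: "f \<in> s" "f \<noteq> es ! (?n - 1)" "vs ! ?n \<in> ends \<Gamma> f"
    using cyclic_set_pair[OF s(1) es_in[of "?n - 1"] last] npos by auto
  obtain u where u: "ends \<Gamma> f = {vs ! ?n, u}" "u \<noteq> vs ! ?n"
    using ends_pair[of f "vs ! ?n"] f sE by blast
  have f_new: "f \<notin> set es"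
  proof
    assume "f \<in> set es"
    then obtain i where i: "i < ?n" "f = es ! i"
      by (metis in_set_conv_nth)
    then have "vs ! ?n = vs ! i \<or> vs ! ?n = vs ! Suc i"
      using ends[of i] f(3) by auto
    then have "Suc i = ?n"
      using vs_eq[of ?n i] vs_eq[of ?n "Suc i"] i by auto
    then have "i = ?n - 1"
      by simp
    then show False
      using f(2) i(2) by simp
  qed
  have "u \<in> set vs"
  proof (rule ccontr)
    assume "u \<notin> set vs"
    have "trail (vs @ [u]) (es @ [f])"
      unfolding trail_def
    proof (intro conjI allI impI)
      fix i assume "i < length (es @ [f])"
      then consider "i < ?n" | "i = ?n"
        by fastforce
      then show "ends \<Gamma> ((es @ [f]) ! i) = {(vs @ [u]) ! i, (vs @ [u]) ! Suc i}"
      proof cases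
        case 1
        then show ?thesis
          using ends[of i] len by (simp add: nth_append)
      next
        case 2
        then show ?thesis
          using u len by (simp add: nth_append)
      qed
    qed (use len dist es_s \<open>u \<notin> set vs\<close> f f_new in auto)
    then have "Q (es @ [f])"
      by (auto simp: Q_def)
    then show False
      using es(2)[of "es @ [f]"] by simp
  qed
  then obtain i where i: "i \<le> ?n" "u = vs ! i"
    using len by (metis in_set_conv_nth less_Suc_eq_le)
  have "i < ?n"
    using i u by (metis le_neq_implies_less)
  have "i = 0"
  proof (rule ccontr)
    assume "i \<noteq> 0"
    then obtain j where j: "i = Suc j"
      by (cases i) auto
    have ij: "vs ! i \<in> ends \<Gamma> (es ! j)" "vs ! i \<in> ends \<Gamma> (es ! i)" "es ! j \<noteq> es ! i"
      using ends[of i] ends[of j] j \<open>i < ?n\<close> nth_eq_iff_index_eq[OF dist(2), of j i] by auto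
    obtain g where g: "{g \<in> s. vs ! i \<in> ends \<Gamma> g} = {es ! j, g}"
      using cyclic_set_pair[OF s(1) es_in[of j] ij(1)] j \<open>i < ?n\<close> by auto
    have "es ! i \<in> {g \<in> s. vs ! i \<in> ends \<Gamma> g}" "f \<in> {g \<in> s. vs ! i \<in> ends \<Gamma> g}"
      using ij es_in[OF \<open>i < ?n\<close>] f u i by auto
    then have "f = es ! j \<or> f = es ! i"
      using g ij(3) by auto
    then show False
      using f_new j \<open>i < ?n\<close> by (metis Suc_lessD nth_mem)
  qed
  let ?es = "es @ [f]"
  have ends': "ends \<Gamma> (?es ! k) = {vs ! k, vs ! (Suc k mod length vs)}" if "k \<le> ?n" for k
  proof (cases "k = ?n")
    case True
    then show ?thesis
      using u i \<open>i = 0\<close> len by (auto simp: nth_append)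
  next
    case False
    then show ?thesis
      using ends[of k] that len by (simp add: nth_append)
  qed
  have dist': "distinct ?es"
    using dist f_new by simp
  have circle: "is_circle \<Gamma> (set ?es)"
    unfolding is_circle_def
    by (rule exI[of _ vs], rule exI[of _ ?es])
      (use len npos dist dist' ends' in \<open>auto simp: Suc_le_eq simp del: set_append\<close>)
  have two: "\<exists>e1\<in>set ?es. \<exists>e2\<in>set ?es. e1 \<noteq> e2 \<and> vs ! k \<in> ends \<Gamma> e1 \<and> vs ! k \<in> ends \<Gamma> e2"
    if k: "k \<le> ?n" for k
  proof (cases k)
    case 0
    have "?es ! 0 \<noteq> ?es ! ?n"
      using nth_eq_iff_index_eq[OF dist', of 0 ?n] npos by simp
    moreover have "vs ! 0 \<in> ends \<Gamma> (?es ! 0)" "vs ! 0 \<in> ends \<Gamma> (?es ! ?n)"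
      using ends'[of 0] ends'[of ?n] len by auto
    moreover have "?es ! 0 \<in> set ?es" "?es ! ?n \<in> set ?es"
      by (rule nth_mem; simp)+
    ultimately show ?thesis
      using 0 by blast
  next
    case (Suc j)
    have "?es ! j \<noteq> ?es ! k"
      using nth_eq_iff_index_eq[OF dist', of j k] Suc k by simp
    moreover have "vs ! k \<in> ends \<Gamma> (?es ! j)" "vs ! k \<in> ends \<Gamma> (?es ! k)"
      using ends'[of j] ends'[of k] len Suc k by auto
    moreover have "?es ! j \<in> set ?es" "?es ! k \<in> set ?es"
      by (rule nth_mem; use Suc k in simp)+
    ultimately show ?thesis
      by blast
  qed
  have sub: "set ?es \<subseteq> s"
    using es_s f by simp
  have closed: "h \<in> set ?es"
    if e: "e \<in> set ?es" "v \<in> ends \<Gamma> e" and h: "h \<in> s" "v \<in> ends \<Gamma> h" for e h v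
  proof -
    obtain k where "k < length ?es" "e = ?es ! k"
      using e(1) by (metis in_set_conv_nth)
    then have k: "k \<le> ?n" "e = ?es ! k"
      by simp_all
    then have "v = vs ! k \<or> v = vs ! (Suc k mod length vs)"
      using ends'[OF k(1)] e(2) by auto
    moreover have "Suc k mod length vs \<le> ?n"
      using len by (metis less_Suc_eq_le mod_less_divisor zero_less_Suc)
    ultimately obtain l where "l \<le> ?n" "v = vs ! l"
      using k(1) by blast
    then obtain e1 e2 where e12: "e1 \<in> set ?es" "e2 \<in> set ?es" "e1 \<noteq> e2" "v \<in> ends \<Gamma> e1" "v \<in> ends \<Gamma> e2"
      using two by metis
    obtain g where g: "{g \<in> s. v \<in> ends \<Gamma> g} = {e1, g}"
      using cyclic_set_pair[OF s(1) _ e12(4)] e12(1) sub by (metis subsetD)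
    have "e2 \<in> {e1, g}" "h \<in> {e1, g}"
      unfolding g[symmetric] using e12 h sub by auto
    then show ?thesis
      using e12 by auto
  qed
  then have "\<forall>e\<in>set ?es. \<forall>f\<in>s. ends \<Gamma> e \<inter> ends \<Gamma> f \<noteq> {} \<longrightarrow> f \<in> set ?es"
    by blast
  with sub circle show ?thesis
    by blast
qed

lemma cyclic_set_restrict:
  assumes s: "cyclic_set \<Gamma> s" and c: "c \<subseteq> s"
    and closed: "\<forall>e\<in>c. \<forall>f\<in>s. ends \<Gamma> e \<inter> ends \<Gamma> f \<noteq> {} \<longrightarrow> f \<in> c"
  shows "cyclic_set \<Gamma> c"
proof -
  have 1: "{e \<in> c. v \<in> ends \<Gamma> e} = {e \<in> s. v \<in> ends \<Gamma> e} \<or> {e \<in> c. v \<in> ends \<Gamma> e} = {}" for v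
    using c closed by blast
  have "card {e \<in> s. v \<in> ends \<Gamma> e} = 2 \<or> {e \<in> s. v \<in> ends \<Gamma> e} = {}" if "v \<in> V" for v
    using s that unfolding cyclic_set_def by blast
  then have "card {e \<in> c. v \<in> ends \<Gamma> e} = 2 \<or> {e \<in> c. v \<in> ends \<Gamma> e} = {}" if "v \<in> V" for v
    using 1[of v] that by (elim disjE) (simp_all only:, blast+)
  moreover have "c \<subseteq> E" "finite c"
    using s c finite_subset unfolding cyclic_set_def by auto
  ultimately show ?thesis
    unfolding cyclic_set_def by blast
qed

text \<open>
  Remove one circle after the other. A circle contains both edges at each of its vertices, so it is
  independent of the rest, and the rest is cyclic again.
\<close>

lemma cyclic_set_decompose:
  assumes "cyclic_set \<Gamma> s"
  obtains S where "finite S" "\<And>c. c \<in> S \<Longrightarrow> cyclic_set \<Gamma> c \<and> is_circle \<Gamma> c"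
    "pairwise (independent_edges \<Gamma>) S" "\<Union>S = s"
proof -
  have "\<exists>S. finite S \<and> (\<forall>c\<in>S. cyclic_set \<Gamma> c \<and> is_circle \<Gamma> c) \<and>
    pairwise (independent_edges \<Gamma>) S \<and> \<Union>S = s"
    using assms
  proof (induction "card s" arbitrary: s rule: less_induct)
    case less
    show ?case
    proof (cases "s = {}")
      case True
      then show ?thesis
        by (intro exI[of _ "{}"]) auto
    next
      case False
      obtain c where c: "c \<subseteq> s" "is_circle \<Gamma> c"
        and closed: "\<forall>e\<in>c. \<forall>f\<in>s. ends \<Gamma> e \<inter> ends \<Gamma> f \<noteq> {} \<longrightarrow> f \<in> c"
        using cyclic_set_contains_circle[OF less.prems False] by blast
      have "cyclic_set \<Gamma> c"
        by (rule cyclic_set_restrict[OF less.prems c(1) closed])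
      have rest: "cyclic_set \<Gamma> (s - c)"
        by (rule cyclic_set_restrict[OF less.prems]) (use closed c(1) in blast)+
      have "card (s - c) < card s"
        using circle_subset_nonempty[OF c(2)] c(1) less.prems
        by (intro psubset_card_mono) (auto simp: cyclic_set_def)
      from less.hyps[OF this rest]
      obtain S where S: "finite S" "\<forall>c\<in>S. cyclic_set \<Gamma> c \<and> is_circle \<Gamma> c"
        "pairwise (independent_edges \<Gamma>) S" "\<Union>S = s - c"
        by (elim exE conjE) (rule that; assumption)
      have "independent_edges \<Gamma> c t \<and> independent_edges \<Gamma> t c" if "t \<in> S" for t
      proof -
        have "t \<subseteq> s - c"
          using that S(4) by blast
        then have "ends \<Gamma> e \<inter> ends \<Gamma> f = {}" if "e \<in> c" "f \<in> t" for e f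
          using closed that by (metis Diff_iff subsetD)
        then show ?thesis
          unfolding independent_edges_def by (metis Int_commute)
      qed
      then have "pairwise (independent_edges \<Gamma>) (insert c S)"
        using S(3) by (auto simp: pairwise_insert)
      then show ?thesis
        using S c \<open>cyclic_set \<Gamma> c\<close> by (intro exI[of _ "insert c S"]) auto
    qed
  qed
  then show ?thesis
    using that by blast
qed

subsection \<open>Alternating cycles\<close>

definition alternating :: "'e set \<Rightarrow> 'e set \<Rightarrow> bool" where
  "alternating A s \<longleftrightarrow> (\<forall>e\<in>s. \<forall>f\<in>s. e \<noteq> f \<longrightarrow> ends \<Gamma> e \<inter> ends \<Gamma> f \<noteq> {} \<longrightarrow> (e \<in> A \<longleftrightarrow> f \<notin> A))"

lemma alternatingD:
  "alternating A s \<Longrightarrow> e \<in> s \<Longrightarrow> f \<in> s \<Longrightarrow> e \<noteq> f \<Longrightarrow> v \<in> ends \<Gamma> e \<Longrightarrow> v \<in> ends \<Gamma> f \<Longrightarrow> e \<in> A \<longleftrightarrow> f \<notin> A"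
  unfolding alternating_def by blast

text \<open>
  Membership in \<open>A\<close> switches at each step around the circle, and it must return to its initial value.
\<close>

lemma even_alternating_circle:
  assumes s: "is_circle \<Gamma> s" and A: "alternating A s"
  shows "even (card s)"
proof -
  obtain vs es where c: "length vs = length es" "2 \<le> length es" "distinct es" "set es = s"
    "\<And>i. i < length es \<Longrightarrow> ends \<Gamma> (es ! i) = {vs ! i, vs ! (Suc i mod length vs)}"
    using s by (auto simp: is_circle_def)
  let ?n = "length es"
  have adj: "es ! i \<in> A \<longleftrightarrow> es ! (Suc i mod ?n) \<notin> A" if i: "i < ?n" for i
  proof (rule alternatingD[OF A])
    have j: "Suc i mod ?n < ?n"
      using c(2) by (intro mod_less_divisor) linarith
    show "es ! i \<in> s" "es ! (Suc i mod ?n) \<in> s"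
      using i j c(4) by auto
    have "i \<noteq> Suc i mod ?n"
      using i c(2) by (metis One_nat_def Suc_1 Suc_lessI Suc_n_not_le_n mod_less mod_self n_not_Suc_n)
    then show "es ! i \<noteq> es ! (Suc i mod ?n)"
      using i j c(3) by (simp add: nth_eq_iff_index_eq)
    show "vs ! (Suc i mod ?n) \<in> ends \<Gamma> (es ! i)" "vs ! (Suc i mod ?n) \<in> ends \<Gamma> (es ! (Suc i mod ?n))"
      using c(5)[OF i] c(5)[OF j] c(1) by auto
  qed
  have "es ! i \<in> A \<longleftrightarrow> (even i \<longleftrightarrow> es ! 0 \<in> A)" if "i < ?n" for i
    using that
  proof (induction i)
    case (Suc i)
    then show ?case
      using adj[of i] by auto
  qed simp
  moreover have "es ! (?n - 1) \<in> A \<longleftrightarrow> es ! 0 \<notin> A"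
  proof -
    have "?n - 1 < ?n" "Suc (?n - 1) = ?n"
      using c(2) by simp_all
    then show ?thesis
      using adj[of "?n - 1"] by simp
  qed
  ultimately have "odd (?n - 1)"
    using c(2) by (metis One_nat_def Suc_1 diff_less less_le_trans zero_less_Suc)
  then have "even ?n"
    using c(2) by simp
  then show ?thesis
    using c(3,4) distinct_card by fastforce
qed

text \<open>
  Passing to an adjacent edge switches membership in both sets, so agreement of \<open>A\<close> and \<open>B\<close> on one
  edge spreads along the circle, and so does disagreement.
\<close>

lemma alternating_same_or_opposite:
  assumes s: "is_circle \<Gamma> s" and A: "alternating A s" and B: "alternating B s" and e: "e \<in> s" "f \<in> s"
  shows "(e \<in> A \<longleftrightarrow> e \<in> B) \<longleftrightarrow> (f \<in> A \<longleftrightarrow> f \<in> B)"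
proof -
  have "(f \<in> A \<longleftrightarrow> f \<in> B) = (e \<in> A \<longleftrightarrow> e \<in> B)"
  proof (rule circle_induct[OF s e(1), of "\<lambda>f. (f \<in> A \<longleftrightarrow> f \<in> B) = (e \<in> A \<longleftrightarrow> e \<in> B)"])
    fix f g v assume "f \<in> s" "g \<in> s" "v \<in> ends \<Gamma> f" "v \<in> ends \<Gamma> g"
      and "(f \<in> A \<longleftrightarrow> f \<in> B) = (e \<in> A \<longleftrightarrow> e \<in> B)"
    then show "(g \<in> A \<longleftrightarrow> g \<in> B) = (e \<in> A \<longleftrightarrow> e \<in> B)"
      using alternatingD[OF A, of f g v] alternatingD[OF B, of f g v] by (cases "f = g") auto
  qed (use e in auto)
  then show ?thesis
    by blast
qed

subsection \<open>Gliding along cycles\<close>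

lemma comm_monoid_power_group: "comm_monoid (power_group E)"
  by (rule comm_monoidI) (auto simp: power_group_def)

lemma cycle_prod_Union:
  assumes "finite T" "\<And>s. s \<in> T \<Longrightarrow> s \<subseteq> E" "pairwise (independent_edges \<Gamma>) T"
  shows "cycle_prod \<Gamma> T = \<Union>T"
  using assms
proof (induction T rule: finite_induct)
  case empty
  interpret comm_monoid "power_group E"
    by (rule comm_monoid_power_group)
  show ?case
    by (simp add: cycle_prod_def) (simp add: power_group_def)
next
  case (insert s T)
  interpret comm_monoid "power_group E"
    by (rule comm_monoid_power_group)
  have disj: "s \<inter> t = {}" if "t \<in> T" for t
    using that insert by (intro independent_disjoint) (auto simp: pairwise_insert)
  have "cycle_prod \<Gamma> (insert s T) = s \<otimes>\<^bsub>power_group E\<^esub> cycle_prod \<Gamma> T"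
    unfolding cycle_prod_def
    by (rule finprod_insert) (use insert in \<open>auto simp: power_group_def\<close>)
  also have "\<dots> = s \<otimes>\<^bsub>power_group E\<^esub> \<Union>T"
    using insert by (simp add: pairwise_insert)
  also have "\<dots> = \<Union>(insert s T)"
    using disj by (auto simp: power_group_def)
  finally show ?case .
qed

lemma based_cubeD:
  assumes "(A, S) \<in> based_cubes \<Gamma>"
  shows "A \<subseteq> E" "finite S" "\<And>s. s \<in> S \<Longrightarrow> s \<subseteq> E" "\<And>s. s \<in> S \<Longrightarrow> is_circle \<Gamma> s"
    "\<And>s. s \<in> S \<Longrightarrow> cyclic_set \<Gamma> s" "pairwise (independent_edges \<Gamma>) S"
  using assms by (auto simp: based_cubes_def power_group_def even_cycle_def cyclic_set_def)

lemma glide_eq: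
  assumes AS: "(A, S) \<in> based_cubes \<Gamma>" and T: "T \<subseteq> S"
  shows "glide \<Gamma> T A = (\<Union>T - A) \<union> (A - \<Union>T)"
proof -
  have "cycle_prod \<Gamma> T = \<Union>T"
    by (rule cycle_prod_Union[OF finite_subset[OF T based_cubeD(2)[OF AS]] _
          pairwise_subset[OF based_cubeD(6)[OF AS] T]])
      (use based_cubeD(3)[OF AS] T in blast)
  then show ?thesis
    by (auto simp: glide_def power_group_def)
qed

lemma based_cube_subset: "(A, S) \<in> based_cubes \<Gamma> \<Longrightarrow> T \<subseteq> S \<Longrightarrow> (A, T) \<in> based_cubes \<Gamma>"
  using finite_subset pairwise_subset by (auto simp: based_cubes_def)

lemma based_cube_glide:
  assumes "(A, S) \<in> based_cubes \<Gamma>" "T \<subseteq> S"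
  shows "(glide \<Gamma> T A, S) \<in> based_cubes \<Gamma>"
proof -
  have "glide \<Gamma> T A \<subseteq> E"
    unfolding glide_eq[OF assms] using based_cubeD(1,3)[OF assms(1)] assms(2) by blast
  then show ?thesis
    using assms by (auto simp: based_cubes_def power_group_def)
qed

lemma in_one_cycle:
  assumes "(A, S) \<in> based_cubes \<Gamma>" "s \<in> S" "t \<in> S" "e \<in> s" "f \<in> t" "v \<in> ends \<Gamma> e" "v \<in> ends \<Gamma> f"
  shows "s = t"
  using assms(2-) based_cubeD(6)[OF assms(1)] unfolding pairwise_def independent_edges_def by blast

lemma in_one_cycle':
  assumes "(A, S) \<in> based_cubes \<Gamma>" "s \<in> S" "t \<in> S" "e \<in> s" "e \<in> t"
  shows "s = t"
  using in_one_cycle[OF assms] edge_vertex[of e] based_cubeD(3)[OF assms(1)] assms by blast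

definition dimer_cube :: "'e set \<Rightarrow> 'e set set \<Rightarrow> bool" where
  "dimer_cube A S \<longleftrightarrow> (A, S) \<in> based_cubes \<Gamma> \<and> (\<forall>T\<subseteq>S. glide \<Gamma> T A \<in> D)"

text \<open>
  That gliding along a single cycle \<open>s\<close> gives a dimer covering forces \<open>A\<close> to alternate on \<open>s\<close>. Conversely,
  gliding along alternating cycles exchanges, at each vertex on them, the unique edge of \<open>A\<close> with the other
  edge of the cycle; independence keeps the cycles from interfering.
\<close>

lemma dimer_cube_iff:
  "dimer_cube A S \<longleftrightarrow> (A, S) \<in> based_cubes \<Gamma> \<and> A \<in> D \<and> (\<forall>s\<in>S. alternating A s)"
proof (intro iffI conjI ballI)
  assume dc: "dimer_cube A S"
  then show AS: "(A, S) \<in> based_cubes \<Gamma>"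
    by (simp add: dimer_cube_def)
  have "glide \<Gamma> {} A \<in> D"
    using dc by (simp add: dimer_cube_def)
  then show A: "A \<in> D"
    by (simp add: glide_eq[OF AS])
  fix s assume s: "s \<in> S"
  then have B: "(s - A) \<union> (A - s) \<in> D"
    using dc glide_eq[OF AS, of "{s}"] by (auto simp: dimer_cube_def)
  show "alternating A s"
    unfolding alternating_def
  proof (intro ballI impI)
    fix e f assume e: "e \<in> s" "f \<in> s" "e \<noteq> f" "ends \<Gamma> e \<inter> ends \<Gamma> f \<noteq> {}"
    then obtain v where v: "v \<in> ends \<Gamma> e" "v \<in> ends \<Gamma> f" "v \<in> V"
      using ends_V based_cubeD(3)[OF AS s] by blast
    then show "e \<in> A \<longleftrightarrow> f \<notin> A"
      using e dimer_unique[OF A v(3), of e f] dimer_unique[OF B v(3), of e f] by blast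
  qed
next
  assume asm: "(A, S) \<in> based_cubes \<Gamma> \<and> A \<in> D \<and> (\<forall>s\<in>S. alternating A s)"
  then have AS: "(A, S) \<in> based_cubes \<Gamma>" and A: "A \<in> D" and alt: "\<And>s. s \<in> S \<Longrightarrow> alternating A s"
    by auto
  have "glide \<Gamma> T A \<in> D" if T: "T \<subseteq> S" for T
  proof -
    have "\<exists>!e. e \<in> glide \<Gamma> T A \<and> v \<in> ends \<Gamma> e" if v: "v \<in> V" for v
    proof (cases "\<exists>s\<in>T. \<exists>e\<in>s. v \<in> ends \<Gamma> e")
      case True
      then obtain s e where s: "s \<in> T" "e \<in> s" "v \<in> ends \<Gamma> e"
        by blast
      then have "s \<in> S"
        using T by blast
      then obtain f where f: "f \<in> s" "f \<noteq> e" "v \<in> ends \<Gamma> f" "{g \<in> s. v \<in> ends \<Gamma> g} = {e, f}"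
        using cyclic_set_pair[OF based_cubeD(5)[OF AS] s(2,3)] by blast
      have ef: "e \<in> A \<longleftrightarrow> f \<notin> A"
        using alternatingD[OF alt[OF \<open>s \<in> S\<close>] s(2) f(1) _ s(3) f(3)] f(2) by blast
      have in_s: "g \<in> {e, f}" if "g \<in> \<Union>T" "v \<in> ends \<Gamma> g" for g
        using that in_one_cycle[OF AS \<open>s \<in> S\<close> _ s(2) _ s(3)] T unfolding f(4)[symmetric] by blast
      have in_A: "g \<in> {e, f}" if "g \<in> A" "v \<in> ends \<Gamma> g" for g
        using that dimer_unique[OF A v] ef s(3) f(3) by blast
      have UT: "e \<in> \<Union>T" "f \<in> \<Union>T"
        using s f by auto
      show ?thesis
        unfolding glide_eq[OF AS T]
      proof (cases "e \<in> A")
        case True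
        then show "\<exists>!g. g \<in> \<Union>T - A \<union> (A - \<Union>T) \<and> v \<in> ends \<Gamma> g"
          using ef UT f(3) in_s in_A by (intro ex1I[of _ f]) blast+
      next
        case False
        then show "\<exists>!g. g \<in> \<Union>T - A \<union> (A - \<Union>T) \<and> v \<in> ends \<Gamma> g"
          using ef UT s(3) in_s in_A by (intro ex1I[of _ e]) blast+
      qed
    next
      case False
      then have "e \<in> glide \<Gamma> T A \<and> v \<in> ends \<Gamma> e \<longleftrightarrow> e \<in> A \<and> v \<in> ends \<Gamma> e" for e
        unfolding glide_eq[OF AS T] by blast
      then show ?thesis
        using A v by (simp add: dimer_coverings_def)
    qed
    moreover have "glide \<Gamma> T A \<subseteq> E"
      using based_cubeD(1)[OF based_cube_glide[OF AS T]] .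
    ultimately show ?thesis
      by (simp add: dimer_coverings_def)
  qed
  then show "dimer_cube A S"
    using AS by (simp add: dimer_cube_def)
qed

section \<open>The polyhedral model\<close>

definition matching_polytope :: "('e \<Rightarrow> real) set" where
  "matching_polytope = {w. (\<forall>e. 0 \<le> w e) \<and> (\<forall>e. e \<notin> E \<longrightarrow> w e = 0) \<and>
     (\<forall>v\<in>V. (\<Sum>e | e \<in> E \<and> v \<in> ends \<Gamma> e. w e) = 1)}"

text \<open>
  Besides the bound on the support at a vertex, a dimer covering inside the support is required. It
  excludes odd cycles all of whose edges have weight one half.
\<close>

definition model :: "('e \<Rightarrow> real) set" where
  "model = {w \<in> matching_polytope.
     (\<forall>v\<in>V. \<forall>e f g. 0 < w e \<longrightarrow> 0 < w f \<longrightarrow> 0 < w g \<longrightarrow>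
        v \<in> ends \<Gamma> e \<longrightarrow> v \<in> ends \<Gamma> f \<longrightarrow> v \<in> ends \<Gamma> g \<longrightarrow> e = f \<or> f = g \<or> e = g) \<and>
     (\<exists>A\<in>D. \<forall>e\<in>A. 0 < w e)}"

definition star :: "'e set \<Rightarrow> ('e \<Rightarrow> real) set" where
  "star A = {w \<in> model. \<forall>e\<in>A. 0 < w e}"

abbreviation mix :: "real \<Rightarrow> ('e \<Rightarrow> real) \<Rightarrow> ('e \<Rightarrow> real) \<Rightarrow> 'e \<Rightarrow> real" where
  "mix u x y \<equiv> \<lambda>e. (1 - u) * x e + u * y e"

lemma mix_polytope:
  assumes "x \<in> matching_polytope" "y \<in> matching_polytope" "0 \<le> u" "u \<le> 1"
  shows "mix u x y \<in> matching_polytope"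
  using assms unfolding matching_polytope_def
  by (simp add: sum.distrib sum_distrib_left[symmetric])

lemma mix_positive:
  fixes a b u :: real
  assumes "0 \<le> u" "u \<le> 1" "0 < a" "0 < b"
  shows "0 < (1 - u) * a + u * b"
  using assms by (cases "u = 0") (simp_all add: add_nonneg_pos)

text \<open>Mixing in \<open>y\<close> does not enlarge the support of \<open>x\<close>, so no vertex acquires a third edge.\<close>

lemma mix_model:
  assumes x: "x \<in> model" and y: "y \<in> model" and supp: "\<And>e. 0 < y e \<Longrightarrow> 0 < x e"
    and u: "0 \<le> u" "u \<le> 1"
  shows "mix u x y \<in> model"
proof -
  have nonneg: "0 \<le> y e" "0 \<le> x e" for e
    using x y by (auto simp: model_def matching_polytope_def)
  have pos: "0 < x e" if "0 < mix u x y e" for e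
  proof (rule ccontr)
    assume "\<not> 0 < x e"
    then have "x e = 0" "y e = 0"
      using nonneg[of e] supp[of e] by fastforce+
    then show False
      using that by simp
  qed
  obtain A where A: "A \<in> D" "\<And>e. e \<in> A \<Longrightarrow> 0 < y e"
    using y by (auto simp: model_def)
  have "\<forall>e\<in>A. 0 < mix u x y e"
    using mix_positive[OF u] A supp by blast
  then have "\<exists>A\<in>D. \<forall>e\<in>A. 0 < mix u x y e"
    using A(1) by blast
  moreover have "mix u x y \<in> matching_polytope"
    using x y u by (intro mix_polytope) (auto simp: model_def)
  ultimately show ?thesis
    using x pos unfolding model_def by blast
qed

lemma mix_star:
  assumes x: "x \<in> star A" and y: "y \<in> star A" and supp: "\<And>e. 0 < y e \<Longrightarrow> 0 < x e"
    and u: "0 \<le> u" "u \<le> 1"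
  shows "mix u x y \<in> star A"
proof -
  have "mix u x y \<in> model"
    using x y by (intro mix_model[OF _ _ supp u]) (auto simp: star_def)
  then show ?thesis
    using x y mix_positive[OF u] unfolding star_def by blast
qed

lemma sum_at_vertex:
  assumes "A \<in> D" "v \<in> V"
  shows "(\<Sum>e | e \<in> E \<and> v \<in> ends \<Gamma> e. indicat_real A e) = 1"
proof -
  have "{e \<in> E. v \<in> ends \<Gamma> e} \<inter> A = {edge_at \<Gamma> A v}"
    using edge_at[OF assms] edge_at_eq[OF assms] dimer_subset[OF assms(1)] by blast
  then have "(\<Sum>e | e \<in> E \<and> v \<in> ends \<Gamma> e. indicat_real A e) = (\<Sum>e\<in>{edge_at \<Gamma> A v}. 1)"
    using finite_E by (intro sum.mono_neutral_cong_right) (auto simp: indicator_def)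
  then show ?thesis
    by simp
qed

text \<open>
  With a repeated entry, \<open>barycentre A B B\<close> serves as a point with support \<open>A \<union> B\<close>, about which the
  intersection of two stars is star-shaped.
\<close>

definition barycentre :: "'e set \<Rightarrow> 'e set \<Rightarrow> 'e set \<Rightarrow> 'e \<Rightarrow> real" where
  "barycentre A B C e = (indicator A e + indicator B e + indicator C e) / 3"

lemma barycentre_pos: "0 < barycentre A B C e \<longleftrightarrow> e \<in> A \<union> B \<union> C"
  by (auto simp: barycentre_def indicator_def)

lemma barycentre_model:
  assumes flat: "flat_triple \<Gamma> A B C"
  shows "barycentre A B C \<in> model"
proof -
  have D: "A \<in> D" "B \<in> D" "C \<in> D"
    using flat by (auto simp: flat_triple_def)
  have "(\<Sum>e | e \<in> E \<and> v \<in> ends \<Gamma> e. barycentre A B C e) = 1" if "v \<in> V" for v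
    using sum_at_vertex[OF D(1) that] sum_at_vertex[OF D(2) that] sum_at_vertex[OF D(3) that]
    unfolding barycentre_def by (simp add: sum_divide_distrib[symmetric] sum.distrib)
  moreover have "barycentre A B C e = 0" if "e \<notin> E" for e
    using that D dimer_subset by (auto simp: barycentre_def indicator_def)
  moreover have "e = f \<or> f = g \<or> e = g"
    if v: "v \<in> V" and e: "0 < barycentre A B C e" "0 < barycentre A B C f" "0 < barycentre A B C g"
      "v \<in> ends \<Gamma> e" "v \<in> ends \<Gamma> f" "v \<in> ends \<Gamma> g" for v e f g
  proof -
    have "h \<in> {edge_at \<Gamma> A v, edge_at \<Gamma> B v, edge_at \<Gamma> C v}"
      if "0 < barycentre A B C h" "v \<in> ends \<Gamma> h" for h
      using that edge_at_eq[OF D(1) v] edge_at_eq[OF D(2) v] edge_at_eq[OF D(3) v]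
      by (auto simp: barycentre_pos)
    then have "e \<in> {edge_at \<Gamma> A v, edge_at \<Gamma> B v, edge_at \<Gamma> C v}"
      "f \<in> {edge_at \<Gamma> A v, edge_at \<Gamma> B v, edge_at \<Gamma> C v}"
      "g \<in> {edge_at \<Gamma> A v, edge_at \<Gamma> B v, edge_at \<Gamma> C v}"
      using e by blast+
    moreover have "edge_at \<Gamma> A v = edge_at \<Gamma> B v \<or> edge_at \<Gamma> B v = edge_at \<Gamma> C v \<or>
        edge_at \<Gamma> A v = edge_at \<Gamma> C v"
      using flat v by (simp add: flat_triple_def)
    ultimately show ?thesis
      by auto
  qed
  moreover have "0 \<le> barycentre A B C e" for e
    by (simp add: barycentre_def)
  moreover have "\<exists>A'\<in>D. \<forall>e\<in>A'. 0 < barycentre A B C e"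
    using D(1) by (intro bexI[of _ A]) (auto simp: barycentre_pos)
  ultimately show ?thesis
    unfolding model_def matching_polytope_def by blast
qed

lemma barycentre_star:
  "flat_triple \<Gamma> A B C \<Longrightarrow> barycentre A B C \<in> star A \<inter> star B \<inter> star C"
  using barycentre_model by (auto simp: star_def barycentre_pos)

lemma flat_degenerate: "A \<in> D \<Longrightarrow> B \<in> D \<Longrightarrow> flat_triple \<Gamma> A B B"
  by (simp add: flat_triple_def)

lemma barycentre_same: "barycentre A A A = indicator A"
  by (auto simp: barycentre_def)

text \<open>
  Among three edges of positive weight at a vertex two agree, for every weight in the model; applied
  to the edges of \<open>A\<close>, \<open>B\<close>, \<open>C\<close> at each vertex, a common point of the stars gives flatness.
\<close>

lemma flat_iff_stars_meet:
  "flat_triple \<Gamma> A B C \<longleftrightarrow> A \<in> D \<and> B \<in> D \<and> C \<in> D \<and> star A \<inter> star B \<inter> star C \<noteq> {}"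
proof
  assume flat: "flat_triple \<Gamma> A B C"
  show "A \<in> D \<and> B \<in> D \<and> C \<in> D \<and> star A \<inter> star B \<inter> star C \<noteq> {}"
    using barycentre_star[OF flat] flat unfolding flat_triple_def by blast
next
  assume asm: "A \<in> D \<and> B \<in> D \<and> C \<in> D \<and> star A \<inter> star B \<inter> star C \<noteq> {}"
  then obtain w where w: "w \<in> star A" "w \<in> star B" "w \<in> star C"
    by blast
  have three: "e = f \<or> f = g \<or> e = g"
    if "v \<in> V" "0 < w e" "0 < w f" "0 < w g" "v \<in> ends \<Gamma> e" "v \<in> ends \<Gamma> f" "v \<in> ends \<Gamma> g" for v e f g
    using w(1) that unfolding star_def model_def by blast
  have pos: "0 < w (edge_at \<Gamma> A v)" "0 < w (edge_at \<Gamma> B v)" "0 < w (edge_at \<Gamma> C v)" if "v \<in> V" for v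
    using w edge_at(1)[OF _ that] asm by (auto simp: star_def)
  have "edge_at \<Gamma> A v = edge_at \<Gamma> B v \<or> edge_at \<Gamma> B v = edge_at \<Gamma> C v \<or> edge_at \<Gamma> A v = edge_at \<Gamma> C v"
    if "v \<in> V" for v
    using three[OF that pos[OF that]] edge_at(2)[OF _ that] asm by blast
  then show "flat_triple \<Gamma> A B C"
    using asm by (simp add: flat_triple_def)
qed

lemma continuous_on_mix: "continuous_on ({0..1} \<times> S) (\<lambda>(u, w). mix u w c)"
  unfolding split_beta
  by (intro continuous_on_coordinatewise_then_product continuous_intros
      continuous_on_product_then_coordinatewise[OF continuous_on_snd[OF continuous_on_id]])

text \<open>
  Every point of the intersection has \<open>A \<union> B\<close> in its support, so mixing in the barycentre does not enlarge
  the support. The case \<open>A = B\<close> covers single stars.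
\<close>

lemma starshaped_Int:
  assumes D: "A \<in> D" "B \<in> D" and w: "w \<in> star A \<inter> star B" and u: "0 \<le> u" "u \<le> 1"
  shows "mix u w (barycentre A B B) \<in> star A \<inter> star B"
proof -
  have supp: "0 < w e" if "0 < barycentre A B B e" for e
    using that w by (auto simp: barycentre_pos star_def)
  show ?thesis
    using mix_star[of w A "barycentre A B B", OF _ _ supp u]
      mix_star[of w B "barycentre A B B", OF _ _ supp u]
      barycentre_star[OF flat_degenerate[OF D]] w by blast
qed

lemma path_connected_stars:
  assumes D: "A \<in> D" "B \<in> D"
  shows "path_connected (star A \<inter> star B)"
  unfolding path_connected_def
proof (intro ballI)
  let ?S = "star A \<inter> star B" and ?c = "barycentre A B B"
  have to_c: "path_in ?S (\<lambda>t. mix t x ?c) x ?c" if x: "x \<in> ?S" for x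
  proof -
    have "path (\<lambda>t. mix t x ?c)"
      unfolding path_def by (intro continuous_on_coordinatewise_then_product continuous_intros)
    moreover have "path_image (\<lambda>t. mix t x ?c) \<subseteq> ?S"
      using starshaped_Int[OF D x] by (auto simp: path_image_def)
    ultimately show ?thesis
      by (simp add: path_in_def pathstart_def pathfinish_def)
  qed
  fix x y assume "x \<in> ?S" "y \<in> ?S"
  from path_in_join[OF to_c[OF this(1)] path_in_reverse[OF to_c[OF this(2)]]]
  show "\<exists>g. path g \<and> path_image g \<subseteq> ?S \<and> pathstart g = x \<and> pathfinish g = y"
    unfolding path_in_def by blast
qed

lemma star_null_homotopic:
  assumes A: "A \<in> D" and p: "path_in (star A) p x y" and q: "path_in (star A) q x y"
  shows "homotopic_paths model p q"
proof (rule homotopic_paths_subset)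
  show "homotopic_paths (star A) p q"
  proof (rule homotopic_paths_contraction[OF continuous_on_mix _ _ _ p q])
    show "(\<lambda>(u, w). mix u w (indicat_real A)) \<in> {0..1} \<times> star A \<rightarrow> star A"
      using starshaped_Int[OF A A] by (auto simp: barycentre_same)
  qed auto
  show "star A \<subseteq> model"
    by (auto simp: star_def)
qed

lemma openin_star:
  assumes "A \<in> D"
  shows "openin (top_of_set model) (star A)"
proof -
  have "finite A"
    using assms dimer_subset finite_E finite_subset by blast
  moreover have "open {w :: 'e \<Rightarrow> real. 0 < w e}" for e
    by (intro open_Collect_less continuous_on_const continuous_on_product_coordinates)
  ultimately have "open (\<Inter>e\<in>A. {w :: 'e \<Rightarrow> real. 0 < w e})"
    by blast
  moreover have "star A = model \<inter> (\<Inter>e\<in>A. {w. 0 < w e})"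
    by (auto simp: star_def)
  ultimately show ?thesis
    by (auto simp: openin_open)
qed

lemma nerve_cover_model: "nerve_cover model D star (\<lambda>A. indicat_real A)"
proof
  fix A B assume "A \<in> D" "B \<in> D"
  then show "path_connected (star A \<inter> star B)" "star A \<inter> star B \<noteq> {}"
    using path_connected_stars barycentre_star[OF flat_degenerate] by blast+
next
  show "model \<subseteq> (\<Union>A\<in>D. star A)"
    by (auto simp: star_def model_def)
next
  fix A assume A: "A \<in> D"
  show "indicat_real A \<in> star A"
    using barycentre_star[OF flat_degenerate[OF A A]] by (simp add: barycentre_same)
  show "openin (top_of_set model) (star A)"
    by (rule openin_star[OF A])
  show "homotopic_paths model p q" if "path_in (star A) p x y" "path_in (star A) q x y" for p q x y
    by (rule star_null_homotopic[OF A that])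
qed

lemma triangle_rel_model:
  "nerve_cover.triangle_rel D star =
    {([((A, C), True)], [((A, B), True), ((B, C), True)]) | A B C. flat_triple \<Gamma> A B C}"
  unfolding nerve_cover.triangle_rel_def[OF nerve_cover_model] flat_iff_stars_meet ..

section \<open>The dimer complex is the polyhedral model\<close>

text \<open>
  The weight of an edge is affine in the coordinates. Since the cycles of a cube are disjoint, the sum
  has at most one term \<open>x s\<close>, and the value is \<open>1 - x s\<close> or \<open>x s\<close> according to whether the edge is in \<open>A\<close>
  (\<open>coords_in\<close>). Written as a sum, it is visibly continuous and makes sense off the cycles.
\<close>

definition coords :: "'e cube_point \<Rightarrow> 'e \<Rightarrow> real" where
  "coords = (\<lambda>((A, S), x) e. indicator A e + (1 - 2 * indicator A e) * (\<Sum>s | s \<in> S \<and> e \<in> s. x s))"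

lemma coords_in:
  assumes AS: "(A, S) \<in> based_cubes \<Gamma>" and e: "s \<in> S" "e \<in> s"
  shows "coords ((A, S), x) e = (if e \<in> A then 1 - x s else x s)"
proof -
  have "{t \<in> S. e \<in> t} = {s}"
    using in_one_cycle'[OF AS] e by blast
  then show ?thesis
    by (simp add: coords_def)
qed

lemma coords_out:
  assumes "e \<notin> \<Union>S"
  shows "coords ((A, S), x) e = indicator A e"
proof -
  have "(\<Sum>s | s \<in> S \<and> e \<in> s. x s) = 0"
    by (rule sum.neutral) (use assms in blast)
  then show ?thesis
    by (simp add: coords_def)
qed

text \<open>
  A zero coordinate contributes nothing, which settles faces. Rebasing exchanges membership in \<open>A\<close> on the
  cycles in \<open>T\<close> and at the same time replaces \<open>x s\<close> by \<open>1 - x s\<close>.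
\<close>

lemma coords_gluing_points:
  "(((A0, S0), x0), ((A1, S1), x1)) \<in> cube_gluing \<Gamma> \<Longrightarrow> coords ((A0, S0), x0) = coords ((A1, S1), x1)"
proof (induction rule: cube_gluing.induct)
  case (face A S S' x x')
  show ?case
  proof
    fix e
    consider s where "s \<in> S" "e \<in> s" | s where "s \<in> S' - S" "e \<in> s" | "e \<notin> \<Union>S'"
      by blast
    then show "coords ((A, S), x) e = coords ((A, S'), x') e"
    proof cases
      case 1
      then have "s \<in> S'"
        using face by blast
      then show ?thesis
        using 1 face by (simp add: coords_in)
    next
      case 2
      then have "e \<notin> \<Union>S"
        using in_one_cycle'[OF face.hyps(2)] face by blast
      then show ?thesis
        using 2 coords_in[OF face.hyps(2), of s e x'] face.hyps(7)[of s] by (simp add: coords_out)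
    next
      case 3
      then have "e \<notin> \<Union>S"
        using face by blast
      then show ?thesis
        using 3 by (simp add: coords_out)
    qed
  qed
next
  case (rebase A S T x x')
  note AS' = based_cube_glide[OF rebase.hyps(1,2)]
  show ?case
  proof
    fix e
    consider s where "s \<in> T" "e \<in> s" | s where "s \<in> S - T" "e \<in> s" | "e \<notin> \<Union>S"
      by blast
    then show "coords ((A, S), x) e = coords ((glide \<Gamma> T A, S), x') e"
    proof cases
      case 1
      then have "s \<in> S" "e \<in> \<Union>T"
        using rebase by auto
      moreover from this have "e \<in> glide \<Gamma> T A \<longleftrightarrow> e \<notin> A"
        unfolding glide_eq[OF rebase.hyps(1,2)] by blast
      ultimately show ?thesis
        using 1 rebase coords_in[OF AS', of s e] coords_in[OF rebase.hyps(1), of s e] by simp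
    next
      case 2
      then have "e \<notin> \<Union>T"
        using in_one_cycle'[OF rebase.hyps(1)] rebase.hyps(2) by blast
      then have "e \<in> glide \<Gamma> T A \<longleftrightarrow> e \<in> A"
        unfolding glide_eq[OF rebase.hyps(1,2)] by blast
      then show ?thesis
        using 2 rebase coords_in[OF AS', of s e] coords_in[OF rebase.hyps(1), of s e] by simp
    next
      case 3
      then have "e \<in> glide \<Gamma> T A \<longleftrightarrow> e \<in> A"
        unfolding glide_eq[OF rebase.hyps(1,2)] using rebase.hyps(2) by blast
      then show ?thesis
        using 3 by (simp add: coords_out indicator_def)
    qed
  qed
qed

lemma coords_gluing: "(p, p') \<in> cube_gluing \<Gamma> \<Longrightarrow> coords p = coords p'"
  by (metis coords_gluing_points prod.exhaust)

lemma coords_equiv: "(p, p') \<in> cube_equiv \<Gamma> \<Longrightarrow> coords p = coords p'"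
  unfolding cube_equiv_def
proof (induction rule: rtrancl_induct)
  case (step p' p'')
  then show ?case
    using coords_gluing by fastforce
qed simp

lemma equiv_cube_equiv: "equiv UNIV (cube_equiv \<Gamma>)"
  unfolding cube_equiv_def
  by (rule equivI) (auto intro: refl_rtrancl trans_rtrancl sym_rtrancl simp: sym_Un_converse)

lemma cube_gluing_equiv: "(p, p') \<in> cube_gluing \<Gamma> \<Longrightarrow> (p, p') \<in> cube_equiv \<Gamma>"
  unfolding cube_equiv_def by blast

lemma cube_equiv_sym: "(p, p') \<in> cube_equiv \<Gamma> \<Longrightarrow> (p', p) \<in> cube_equiv \<Gamma>"
  using equiv_cube_equiv by (meson equivE symD)

lemma cube_equiv_trans: "(p, p') \<in> cube_equiv \<Gamma> \<Longrightarrow> (p', p'') \<in> cube_equiv \<Gamma> \<Longrightarrow> (p, p'') \<in> cube_equiv \<Gamma>"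
  using equiv_cube_equiv by (meson equivE transD)

definition dimer_points :: "'e cube_point set" where
  "dimer_points = {((A, S), x) | A S x. dimer_cube A S \<and> x \<in> S \<rightarrow>\<^sub>E {0..1}}"

definition interior_point :: "'e set \<Rightarrow> 'e set set \<Rightarrow> ('e set \<Rightarrow> real) \<Rightarrow> bool" where
  "interior_point A S x \<longleftrightarrow> dimer_cube A S \<and> x \<in> S \<rightarrow>\<^sub>E {0..1} \<and> (\<forall>s\<in>S. 0 < x s \<and> x s < 1)"

lemma dimer_cube_based: "dimer_cube A S \<Longrightarrow> (A, S) \<in> based_cubes \<Gamma>"
  by (simp add: dimer_cube_def)

lemma dimer_cube_glide:
  assumes AS: "dimer_cube A S" and T: "T \<subseteq> S"
  shows "dimer_cube (glide \<Gamma> T A) S"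
proof -
  note b = dimer_cube_based[OF AS]
  have "alternating (glide \<Gamma> T A) s" if s: "s \<in> S" for s
  proof -
    have "e \<in> \<Union>T \<longleftrightarrow> s \<in> T" if "e \<in> s" for e
      using in_one_cycle'[OF b] s T that by blast
    then have "e \<in> glide \<Gamma> T A \<longleftrightarrow> (e \<in> A \<longleftrightarrow> s \<notin> T)" if "e \<in> s" for e
      unfolding glide_eq[OF b T] using that by blast
    moreover have "alternating A s"
      using AS s by (simp add: dimer_cube_iff)
    ultimately show ?thesis
      unfolding alternating_def by blast
  qed
  then show ?thesis
    using AS T based_cube_glide[OF b T] unfolding dimer_cube_iff by (simp add: dimer_cube_def[of A S, unfolded dimer_cube_iff])
qed

lemma dimer_cube_subset: "dimer_cube A S \<Longrightarrow> R \<subseteq> S \<Longrightarrow> dimer_cube A R"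
  using based_cube_subset unfolding dimer_cube_iff by blast

text \<open>
  Every point lies in the interior of some cube: rebasing turns the coordinates \<open>1\<close> into \<open>0\<close>, and zero
  coordinates are dropped by passing to a face.
\<close>

lemma interior_representative:
  assumes p: "p \<in> dimer_points"
  obtains A S x where "interior_point A S x" "(p, ((A, S), x)) \<in> cube_equiv \<Gamma>"
proof -
  obtain A S x where px: "p = ((A, S), x)" and AS: "dimer_cube A S" and x: "x \<in> S \<rightarrow>\<^sub>E {0..1}"
    using p by (auto simp: dimer_points_def)
  note b = dimer_cube_based[OF AS]
  have x01: "0 \<le> x s" "x s \<le> 1" if "s \<in> S" for s
    using PiE_mem[OF x that] by auto
  define T where "T = {s \<in> S. x s = 1}"
  define R where "R = {s \<in> S. x s \<noteq> 0 \<and> x s \<noteq> 1}"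
  define x1 where "x1 = restrict (\<lambda>s. if x s = 1 then 0 else x s) S"
  let ?A = "glide \<Gamma> T A" and ?y = "restrict x1 R"
  have TS: "T \<subseteq> S" and RS: "R \<subseteq> S"
    by (auto simp: T_def R_def)
  have x1: "x1 \<in> S \<rightarrow>\<^sub>E {0..1}"
    using x01 by (auto simp: x1_def)
  have y: "?y \<in> R \<rightarrow>\<^sub>E {0..1}"
    using x1 RS by (auto simp: PiE_iff)
  have A': "dimer_cube ?A S"
    by (rule dimer_cube_glide[OF AS TS])
  have "(p, ((?A, S), x1)) \<in> cube_gluing \<Gamma>"
    unfolding px by (rule cube_gluing.rebase[OF b TS x x1]) (auto simp: T_def x1_def)
  moreover have "(((?A, R), ?y), ((?A, S), x1)) \<in> cube_gluing \<Gamma>"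
    by (rule cube_gluing.face[OF dimer_cube_based[OF dimer_cube_subset[OF A' RS]]
          dimer_cube_based[OF A'] RS y x1]) (auto simp: R_def x1_def)
  ultimately have "(p, ((?A, R), ?y)) \<in> cube_equiv \<Gamma>"
    by (meson cube_equiv_sym cube_equiv_trans cube_gluing_equiv)
  moreover have "0 < ?y s \<and> ?y s < 1" if "s \<in> R" for s
    using that x01[of s] by (auto simp: R_def x1_def)
  then have "interior_point ?A R ?y"
    using y dimer_cube_subset[OF A' RS] by (simp add: interior_point_def)
  ultimately show ?thesis
    using that by blast
qed

text \<open>
  A cycle through \<open>v\<close> contains the edge of \<open>A\<close> at \<open>v\<close>, since \<open>A\<close> alternates on it. So either this edge is on a
  cycle and shares the weight 1 with the other edge of the cycle at \<open>v\<close>, or no cycle passes through \<open>v\<close> and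
  it carries all the weight; in the second case \<open>a\<close> and \<open>b\<close> coincide.
\<close>

lemma interior_point_vertex:
  assumes p: "interior_point A S x" and v: "v \<in> V"
  obtains a b where "a \<in> E" "b \<in> E" "v \<in> ends \<Gamma> a" "v \<in> ends \<Gamma> b"
    "(\<Sum>e\<in>{a, b}. coords ((A, S), x) e) = 1"
    "\<And>e. v \<in> ends \<Gamma> e \<Longrightarrow> e \<noteq> a \<Longrightarrow> e \<noteq> b \<Longrightarrow> coords ((A, S), x) e = 0"
proof -
  let ?w = "coords ((A, S), x)"
  have dc: "(A, S) \<in> based_cubes \<Gamma>" "A \<in> D" "\<And>s. s \<in> S \<Longrightarrow> alternating A s"
    using p by (auto simp: interior_point_def dimer_cube_iff)
  let ?a = "edge_at \<Gamma> A v"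
  note a = edge_at[OF dc(2) v]
  have notA: "e \<notin> A" if "v \<in> ends \<Gamma> e" "e \<noteq> ?a" for e
    using edge_at_eq[OF dc(2) v] that by blast
  have aE: "?a \<in> E"
    using a dimer_subset[OF dc(2)] by blast
  show ?thesis
  proof (cases "?a \<in> \<Union>S")
    case True
    then obtain s where s: "s \<in> S" "?a \<in> s"
      by blast
    obtain f where f: "f \<in> s" "f \<noteq> ?a" "v \<in> ends \<Gamma> f" "{g \<in> s. v \<in> ends \<Gamma> g} = {?a, f}"
      using cyclic_set_pair[OF based_cubeD(5)[OF dc(1) s(1)] s(2) a(2)] .
    have "?w e = 0" if e: "v \<in> ends \<Gamma> e" "e \<noteq> ?a" "e \<noteq> f" for e
    proof -
      have "e \<notin> \<Union>S"
      proof
        assume "e \<in> \<Union>S"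
        then obtain t where t: "t \<in> S" "e \<in> t" by blast
        then have "s = t"
          by (rule in_one_cycle[OF dc(1) s(1) _ s(2) _ a(2) e(1)])
        then have "e \<in> {?a, f}"
          unfolding f(4)[symmetric] using t e by simp
        then show False
          using e by simp
      qed
      then show ?thesis
        using notA[OF e(1,2)] by (simp add: coords_out)
    qed
    moreover have "(\<Sum>e\<in>{?a, f}. ?w e) = 1"
      using coords_in[OF dc(1) s, of x] coords_in[OF dc(1) s(1) f(1), of x] a notA[OF f(3,2)] f(2) by simp
    ultimately show ?thesis
      using that[of ?a f] a aE f based_cubeD(3)[OF dc(1) s(1)] by blast
  next
    case False
    have "?w e = 0" if e: "v \<in> ends \<Gamma> e" "e \<noteq> ?a" for e
    proof -
      have "e \<notin> \<Union>S"
      proof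
        assume "e \<in> \<Union>S"
        then obtain t where t: "t \<in> S" "e \<in> t" by blast
        then obtain g where g: "g \<in> t" "g \<noteq> e" "v \<in> ends \<Gamma> g"
          using cyclic_set_pair[OF based_cubeD(5)[OF dc(1) t(1)] t(2) e(1)] by blast
        then have "g \<in> A"
          using alternatingD[OF dc(3)[OF t(1)] t(2) g(1) _ e(1) g(3)] notA[OF e] by blast
        then have "g = ?a"
          using notA[OF g(3)] by blast
        then show False
          using False g t by blast
      qed
      then show ?thesis
        using notA[OF e] by (simp add: coords_out)
    qed
    moreover have "(\<Sum>e\<in>{?a, ?a}. ?w e) = 1"
      using False a by (simp add: coords_out)
    ultimately show ?thesis
      using that[of ?a ?a] a aE by blast
  qed
qed

lemma interior_point_model:
  assumes p: "interior_point A S x"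
  shows "coords ((A, S), x) \<in> model"
proof -
  let ?w = "coords ((A, S), x)"
  have dc: "(A, S) \<in> based_cubes \<Gamma>" "A \<in> D"
    using p by (auto simp: interior_point_def dimer_cube_iff)
  have x01: "0 < x s" "x s < 1" if "s \<in> S" for s
    using p that by (auto simp: interior_point_def)
  have nonneg: "0 \<le> ?w e" for e
  proof (cases "e \<in> \<Union>S")
    case True
    then show ?thesis
      using coords_in[OF dc(1), of _ e x] x01 by (force simp: less_imp_le)
  qed (simp add: coords_out)
  have pos: "0 < ?w e" if "e \<in> A" for e
  proof (cases "e \<in> \<Union>S")
    case True
    then show ?thesis
      using coords_in[OF dc(1), of _ e x] x01 that by force
  qed (use that in \<open>simp add: coords_out\<close>)
  have off: "?w e = 0" if "e \<notin> E" for e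
  proof -
    have "e \<notin> \<Union>S" "e \<notin> A"
      using based_cubeD(1,3)[OF dc(1)] that by blast+
    then show ?thesis
      by (simp add: coords_out)
  qed
  have vertex: "(\<Sum>e | e \<in> E \<and> v \<in> ends \<Gamma> e. ?w e) = 1 \<and>
      (\<forall>e f g. 0 < ?w e \<longrightarrow> 0 < ?w f \<longrightarrow> 0 < ?w g \<longrightarrow>
        v \<in> ends \<Gamma> e \<longrightarrow> v \<in> ends \<Gamma> f \<longrightarrow> v \<in> ends \<Gamma> g \<longrightarrow> e = f \<or> f = g \<or> e = g)" if v: "v \<in> V" for v
  proof -
    obtain a b where ab: "a \<in> E" "b \<in> E" "v \<in> ends \<Gamma> a" "v \<in> ends \<Gamma> b" "(\<Sum>e\<in>{a, b}. ?w e) = 1"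
      "\<And>e. v \<in> ends \<Gamma> e \<Longrightarrow> e \<noteq> a \<Longrightarrow> e \<noteq> b \<Longrightarrow> ?w e = 0"
      using interior_point_vertex[OF p v] by metis
    have "(\<Sum>e | e \<in> E \<and> v \<in> ends \<Gamma> e. ?w e) = (\<Sum>e\<in>{a, b}. ?w e)"
      using ab finite_E by (intro sum.mono_neutral_right) auto
    moreover have "e \<in> {a, b}" if "0 < ?w e" "v \<in> ends \<Gamma> e" for e
      using ab(6)[OF that(2)] that(1) by auto
    then have "\<forall>e f g. 0 < ?w e \<longrightarrow> 0 < ?w f \<longrightarrow> 0 < ?w g \<longrightarrow>
        v \<in> ends \<Gamma> e \<longrightarrow> v \<in> ends \<Gamma> f \<longrightarrow> v \<in> ends \<Gamma> g \<longrightarrow> e = f \<or> f = g \<or> e = g"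
      by blast
    ultimately show ?thesis
      using ab(5) by simp
  qed
  have poly: "?w \<in> matching_polytope"
    using nonneg off vertex by (simp add: matching_polytope_def)
  have three: "\<forall>v\<in>V. \<forall>e f g. 0 < ?w e \<longrightarrow> 0 < ?w f \<longrightarrow> 0 < ?w g \<longrightarrow>
      v \<in> ends \<Gamma> e \<longrightarrow> v \<in> ends \<Gamma> f \<longrightarrow> v \<in> ends \<Gamma> g \<longrightarrow> e = f \<or> f = g \<or> e = g"
    using vertex by (intro ballI) (rule conjunct2)
  have "\<exists>A\<in>D. \<forall>e\<in>A. 0 < ?w e"
    using pos dc(2) by (intro bexI[of _ A]) auto
  with poly three show ?thesis
    unfolding model_def by (intro CollectI conjI)
qed

text \<open>
  The union of the cycles is the set of edges of fractional weight, and the cycles are its components.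
  On each cycle the two base coverings agree or are opposite; rebasing along the cycles where they are
  opposite identifies them, and then the weights determine the coordinates.
\<close>

lemma interior_points_equiv:
  assumes p: "interior_point A S x" and p': "interior_point A' S' x'"
    and eq: "coords ((A, S), x) = coords ((A', S'), x')"
  shows "(((A, S), x), ((A', S'), x')) \<in> cube_equiv \<Gamma>"
proof -
  have dc: "(A, S) \<in> based_cubes \<Gamma>" "A \<in> D" "\<And>s. s \<in> S \<Longrightarrow> alternating A s"
    using p by (auto simp: interior_point_def dimer_cube_iff)
  have dc': "(A', S') \<in> based_cubes \<Gamma>" "A' \<in> D" "\<And>s. s \<in> S' \<Longrightarrow> alternating A' s"
    using p' by (auto simp: interior_point_def dimer_cube_iff)
  have frac: "\<Union>S = {e. 0 < coords ((A, S), x) e \<and> coords ((A, S), x) e < 1}"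
    if "interior_point A S x" for A S x
  proof (intro Set.set_eqI iffI)
    fix e assume "e \<in> \<Union>S"
    then obtain s where "s \<in> S" "e \<in> s" by blast
    then show "e \<in> {e. 0 < coords ((A, S), x) e \<and> coords ((A, S), x) e < 1}"
      using that coords_in[of A S s e x] by (auto simp: interior_point_def dimer_cube_iff)
  next
    fix e assume "e \<in> {e. 0 < coords ((A, S), x) e \<and> coords ((A, S), x) e < 1}"
    then show "e \<in> \<Union>S"
      using coords_out[of e S A x] by (cases "e \<in> \<Union>S") (auto simp: indicator_def of_bool_def split: if_splits)
  qed
  have U: "\<Union>S = \<Union>S'"
    using frac[OF p] frac[OF p'] eq by simp
  have SS': "S = S'"
    using independent_circles_subset[OF based_cubeD(4,6)[OF dc(1)] based_cubeD(4,6)[OF dc'(1)] U]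
      independent_circles_subset[OF based_cubeD(4,6)[OF dc'(1)] based_cubeD(4,6)[OF dc(1)] U[symmetric]]
    by blast
  define T where "T = {s \<in> S. \<exists>e\<in>s. (e \<in> A) \<noteq> (e \<in> A')}"
  have TS: "T \<subseteq> S"
    by (auto simp: T_def)
  have same: "(e \<in> A) = (e \<in> A') \<longleftrightarrow> s \<notin> T" if "s \<in> S" "e \<in> s" for s e
    using alternating_same_or_opposite[OF based_cubeD(4)[OF dc(1) that(1)] dc(3)[OF that(1)]
        dc'(3)[folded SS', OF that(1)]] that unfolding T_def by blast
  have A': "A' = glide \<Gamma> T A"
  proof (intro Set.set_eqI)
    fix e
    show "e \<in> A' \<longleftrightarrow> e \<in> glide \<Gamma> T A"
    proof (cases "e \<in> \<Union>S")
      case True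
      then obtain s where s: "s \<in> S" "e \<in> s" by blast
      then have "e \<in> \<Union>T \<longleftrightarrow> s \<in> T"
        using in_one_cycle'[OF dc(1)] TS by blast
      then show ?thesis
        unfolding glide_eq[OF dc(1) TS] using same[OF s] by blast
    next
      case False
      then have "indicat_real A e = indicator A' e"
        using fun_cong[OF eq, of e] U by (simp add: coords_out)
      moreover have "e \<notin> \<Union>T"
        using False TS by blast
      ultimately show ?thesis
        unfolding glide_eq[OF dc(1) TS] by (auto simp: indicator_def split: if_splits)
    qed
  qed
  have val: "(if e \<in> A then 1 - x s else x s) = (if e \<in> A' then 1 - x' s else x' s)"
    if "s \<in> S" "e \<in> s" for s e
    using fun_cong[OF eq, of e] coords_in[OF dc(1) that, of x] coords_in[OF dc'(1), of s e x'] that SS'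
    by simp
  have x': "x' s = (if s \<in> T then 1 - x s else x s)" if s: "s \<in> S" for s
  proof -
    obtain e where "e \<in> s"
      using circle_subset_nonempty[OF based_cubeD(4)[OF dc(1) s]] by blast
    then show ?thesis
      using val[OF s, of e] same[OF s, of e] by (auto split: if_splits)
  qed
  have "(((A, S), x), ((glide \<Gamma> T A, S), x')) \<in> cube_gluing \<Gamma>"
    by (rule cube_gluing.rebase[OF dc(1) TS])
      (use p p' SS' x' TS in \<open>auto simp: interior_point_def\<close>)
  then show ?thesis
    using cube_gluing_equiv SS' A' by simp
qed

text \<open>
  The edge of \<open>A\<close> at \<open>v\<close> has positive weight. Either it carries the whole weight at \<open>v\<close>, or exactly one
  further edge has positive weight and carries the remainder.
\<close>

lemma model_vertex:
  assumes w: "w \<in> model" and A: "A \<in> D" "\<And>e. e \<in> A \<Longrightarrow> 0 < w e" and v: "v \<in> V"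
  shows "w (edge_at \<Gamma> A v) = 1 \<and> (\<forall>g. v \<in> ends \<Gamma> g \<longrightarrow> g \<noteq> edge_at \<Gamma> A v \<longrightarrow> w g = 0) \<or>
    (\<exists>f\<in>E. f \<notin> A \<and> v \<in> ends \<Gamma> f \<and> 0 < w f \<and> w f < 1 \<and> w (edge_at \<Gamma> A v) = 1 - w f \<and>
      (\<forall>g. v \<in> ends \<Gamma> g \<longrightarrow> g \<noteq> edge_at \<Gamma> A v \<longrightarrow> g \<noteq> f \<longrightarrow> w g = 0))"
proof -
  let ?a = "edge_at \<Gamma> A v"
  note a = edge_at[OF A(1) v]
  have aE: "?a \<in> E"
    using a dimer_subset[OF A(1)] by blast
  have nonneg: "\<And>e. 0 \<le> w e" and off: "\<And>e. e \<notin> E \<Longrightarrow> w e = 0"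
    and sum: "(\<Sum>e | e \<in> E \<and> v \<in> ends \<Gamma> e. w e) = 1"
    using w v by (auto simp: model_def matching_polytope_def)
  have three: "e = f \<or> f = g \<or> e = g"
    if "0 < w e" "0 < w f" "0 < w g" "v \<in> ends \<Gamma> e" "v \<in> ends \<Gamma> f" "v \<in> ends \<Gamma> g" for e f g
    using w v that unfolding model_def by blast
  show ?thesis
  proof (cases "\<exists>f. v \<in> ends \<Gamma> f \<and> f \<noteq> ?a \<and> w f \<noteq> 0")
    case True
    then obtain f where f: "v \<in> ends \<Gamma> f" "f \<noteq> ?a" "w f \<noteq> 0" by blast
    have fE: "f \<in> E"
      using off f(3) by blast
    have pos: "0 < w f" "0 < w ?a"
      using nonneg[of f] f(3) A(2)[OF a(1)] by auto
    have others: "w g = 0" if "v \<in> ends \<Gamma> g" "g \<noteq> ?a" "g \<noteq> f" for g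
      using three[OF pos(2,1) _ a(2) f(1) that(1)] that f(2) nonneg[of g] by force
    have "(\<Sum>e | e \<in> E \<and> v \<in> ends \<Gamma> e. w e) = (\<Sum>e\<in>{?a, f}. w e)"
      using a f aE fE finite_E others by (intro sum.mono_neutral_right) auto
    then have "w ?a + w f = 1"
      using sum f(2) by auto
    moreover have "f \<notin> A"
      using edge_at_eq[OF A(1) v _ f(1)] f(2) by blast
    ultimately show ?thesis
      using f fE pos others by (intro disjI2 bexI[of _ f]) auto
  next
    case False
    then have others: "w g = 0" if "v \<in> ends \<Gamma> g" "g \<noteq> ?a" for g
      using that by blast
    have "(\<Sum>e | e \<in> E \<and> v \<in> ends \<Gamma> e. w e) = (\<Sum>e\<in>{?a}. w e)"
      using a aE finite_E others by (intro sum.mono_neutral_right) auto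
    then show ?thesis
      using sum others by auto
  qed
qed

text \<open>
  The edges of fractional weight form a cyclic set on which \<open>A\<close> alternates. On each of its circles the
  weights alternate between a number and its complement to 1, so the weight of the edges outside \<open>A\<close> is a
  well-defined coordinate.
\<close>

lemma model_point:
  assumes w: "w \<in> model"
  obtains p where "p \<in> dimer_points" "coords p = w"
proof -
  obtain A where A: "A \<in> D" "\<And>e. e \<in> A \<Longrightarrow> 0 < w e"
    using w by (auto simp: model_def)
  define F where "F = {e \<in> E. 0 < w e \<and> w e < 1}"
  have pair: "{e \<in> F. v \<in> ends \<Gamma> e} = {} \<or>
      (\<exists>a f. a \<in> A \<and> f \<notin> A \<and> w a = 1 - w f \<and> {e \<in> F. v \<in> ends \<Gamma> e} = {a, f})" if v: "v \<in> V" for v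
  proof -
    let ?a = "edge_at \<Gamma> A v"
    note a = edge_at[OF A(1) v]
    from model_vertex[OF w A v] show ?thesis
    proof
      assume "w ?a = 1 \<and> (\<forall>g. v \<in> ends \<Gamma> g \<longrightarrow> g \<noteq> ?a \<longrightarrow> w g = 0)"
      then have "e \<notin> F" if "v \<in> ends \<Gamma> e" for e
        using that unfolding F_def by (cases "e = ?a") auto
      then show ?thesis
        by blast
    next
      assume "\<exists>f\<in>E. f \<notin> A \<and> v \<in> ends \<Gamma> f \<and> 0 < w f \<and> w f < 1 \<and> w ?a = 1 - w f \<and>
        (\<forall>g. v \<in> ends \<Gamma> g \<longrightarrow> g \<noteq> ?a \<longrightarrow> g \<noteq> f \<longrightarrow> w g = 0)"
      then obtain f where f: "f \<in> E" "f \<notin> A" "v \<in> ends \<Gamma> f" "0 < w f" "w f < 1" "w ?a = 1 - w f"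
        "\<And>g. v \<in> ends \<Gamma> g \<Longrightarrow> g \<noteq> ?a \<Longrightarrow> g \<noteq> f \<Longrightarrow> w g = 0"
        by blast
      have "?a \<in> F" "f \<in> F"
        using f a dimer_subset[OF A(1)] by (auto simp: F_def)
      moreover have "e \<in> {?a, f}" if "e \<in> F" "v \<in> ends \<Gamma> e" for e
        using f(7)[OF that(2)] that(1) by (auto simp: F_def)
      ultimately have "{e \<in> F. v \<in> ends \<Gamma> e} = {?a, f}"
        using a f by blast
      then show ?thesis
        using a f by blast
    qed
  qed
  have "cyclic_set \<Gamma> F"
    unfolding cyclic_set_def
  proof (intro conjI ballI)
    show "F \<subseteq> E" "finite F"
      using finite_E by (auto simp: F_def)
    fix v assume "v \<in> V"
    from pair[OF this] show "card {e \<in> F. v \<in> ends \<Gamma> e} = 2 \<or> {e \<in> F. v \<in> ends \<Gamma> e} = {}"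
    proof
      assume "\<exists>a f. a \<in> A \<and> f \<notin> A \<and> w a = 1 - w f \<and> {e \<in> F. v \<in> ends \<Gamma> e} = {a, f}"
      then obtain a f where "a \<noteq> f" "{e \<in> F. v \<in> ends \<Gamma> e} = {a, f}"
        by metis
      then show ?thesis
        by simp
    qed blast
  qed
  then obtain S where S: "finite S" "\<And>c. c \<in> S \<Longrightarrow> cyclic_set \<Gamma> c \<and> is_circle \<Gamma> c"
    "pairwise (independent_edges \<Gamma>) S" "\<Union>S = F"
    using cyclic_set_decompose by metis
  have adjacent: "(e \<in> A \<longleftrightarrow> f \<notin> A) \<and> w e = 1 - w f"
    if "s \<in> S" "e \<in> s" "f \<in> s" "e \<noteq> f" "v \<in> ends \<Gamma> e" "v \<in> ends \<Gamma> f" for s e f v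
  proof -
    have ef: "e \<in> {e \<in> F. v \<in> ends \<Gamma> e}" "f \<in> {e \<in> F. v \<in> ends \<Gamma> e}"
      using that S(4) by auto
    moreover have "v \<in> V"
      using ef ends_V by (auto simp: F_def)
    ultimately obtain a g where "a \<in> A" "g \<notin> A" "w a = 1 - w g" "{e \<in> F. v \<in> ends \<Gamma> e} = {a, g}"
      using pair by blast
    then show ?thesis
      using ef that(4) by auto
  qed
  have alt: "alternating A s" if "s \<in> S" for s
    unfolding alternating_def using adjacent[OF that] by blast
  have AS: "(A, S) \<in> based_cubes \<Gamma>"
    using S dimer_subset[OF A(1)] even_alternating_circle[OF _ alt]
    by (auto simp: based_cubes_def power_group_def even_cycle_def)
  have dc: "dimer_cube A S"
    using AS A alt by (simp add: dimer_cube_iff)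
  \<comment> \<open>the coordinate of the circle through \<open>e\<close>, as seen from \<open>e\<close>\<close>
  define val where "val e = (if e \<in> A then 1 - w e else w e)" for e
  have val: "val e = val f" if s: "s \<in> S" "e \<in> s" "f \<in> s" for s e f
  proof (rule circle_induct[OF based_cubeD(4)[OF AS s(1)] s(2), of "\<lambda>f. val e = val f"])
    fix f g v assume fg: "f \<in> s" "g \<in> s" "v \<in> ends \<Gamma> f" "v \<in> ends \<Gamma> g" and "val e = val f"
    moreover have "val f = val g"
    proof (cases "f = g")
      case False
      then show ?thesis
        using adjacent[OF s(1) fg(1,2) _ fg(3,4)] by (auto simp: val_def)
    qed simp
    ultimately show "val e = val g" by simp
  qed (use s in auto)
  define x where "x = restrict (\<lambda>s. val (SOME e. e \<in> s)) S"
  have x: "x s = val e" if "s \<in> S" "e \<in> s" for s e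
    using val[OF that(1) someI[of "\<lambda>e. e \<in> s", OF that(2)] that(2)] that by (simp add: x_def)
  have "x s \<in> {0..1}" if s: "s \<in> S" for s
  proof -
    obtain e where e: "e \<in> s"
      using circle_subset_nonempty[OF based_cubeD(4)[OF AS s]] by blast
    then have "e \<in> F"
      using S(4) s by blast
    then show ?thesis
      unfolding x[OF s e] by (auto simp: val_def F_def)
  qed
  then have "((A, S), x) \<in> dimer_points"
    using dc by (auto simp: dimer_points_def x_def)
  moreover have "coords ((A, S), x) e = w e" for e
  proof (cases "e \<in> \<Union>S")
    case True
    then obtain s where s: "s \<in> S" "e \<in> s" by blast
    then show ?thesis
      using coords_in[OF AS s, of x] x[OF s] by (simp add: val_def)
  next
    case False
    then have eF: "e \<notin> F"
      using S(4) by simp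
    have "w e = indicator A e"
    proof (cases "e \<in> E")
      case True
      then obtain v where v: "v \<in> ends \<Gamma> e" "v \<in> V"
        using edge_vertex by blast
      show ?thesis
      proof (cases "e \<in> A")
        case True
        then have "edge_at \<Gamma> A v = e"
          using edge_at_eq[OF A(1) v(2)] v(1) by blast
        then show ?thesis
          using model_vertex[OF w A v(2)] eF \<open>e \<in> A\<close> \<open>e \<in> E\<close> by (auto simp: F_def)
      next
        case False
        then have "edge_at \<Gamma> A v \<noteq> e"
          using edge_at(1)[OF A(1) v(2)] by blast
        then show ?thesis
          using model_vertex[OF w A v(2)] eF False v(1) \<open>e \<in> E\<close> by (auto simp: F_def)
      qed
    next
      case False
      then show ?thesis
        using w dimer_subset[OF A(1)] by (auto simp: model_def matching_polytope_def indicator_def)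
    qed
    then show ?thesis
      using False by (simp add: coords_out)
  qed
  ultimately show ?thesis
    using that by blast
qed


abbreviation point_class :: "'e cube_point \<Rightarrow> 'e cube_point set" where
  "point_class p \<equiv> cube_equiv \<Gamma> `` {p}"

lemma topspace_cubes_space:
  "topspace (cubes_space \<Gamma>) = {((A, S), x) | A S x. (A, S) \<in> based_cubes \<Gamma> \<and> x \<in> S \<rightarrow>\<^sub>E {0..1}}"
  by (auto simp: cubes_space_def)

lemma dimer_complex_eq:
  "dimer_complex \<Gamma> = subtopology (cubed_complex \<Gamma>) (point_class ` dimer_points)"
proof -
  have "{cube_equiv \<Gamma> `` {((A, S), x)} | A S x. (A, S) \<in> based_cubes \<Gamma> \<and> x \<in> S \<rightarrow>\<^sub>E {0..1} \<and>
        (\<forall>T\<subseteq>S. glide \<Gamma> T A \<in> D)} = point_class ` dimer_points"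
    unfolding dimer_points_def dimer_cube_def by blast
  then show ?thesis
    unfolding dimer_complex_def by simp
qed

lemma topspace_dimer_complex: "topspace (dimer_complex \<Gamma>) = point_class ` dimer_points"
proof -
  have "dimer_points \<subseteq> topspace (cubes_space \<Gamma>)"
    unfolding topspace_cubes_space dimer_points_def dimer_cube_def by blast
  then have "point_class ` dimer_points \<subseteq> topspace (cubed_complex \<Gamma>)"
    unfolding cubed_complex_def topspace_quotient_space by (auto intro: quotientI)
  then show ?thesis
    unfolding dimer_complex_eq by auto
qed

lemma continuous_coords: "continuous_map (cubes_space \<Gamma>) euclidean coords"
proof -
  have comp: "continuous_map (product_topology (\<lambda>_. top_of_set {0..1::real}) S) euclidean
      (\<lambda>x. coords ((A, S), x))" if "(A, S) \<in> based_cubes \<Gamma>" for A S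
  proof -
    have proj: "continuous_map (product_topology (\<lambda>_. top_of_set {0..1::real}) S) euclideanreal (\<lambda>x. x s)"
      if "s \<in> S" for s
      using continuous_map_product_projection[OF that, of "\<lambda>_. top_of_set {0..1::real}"]
      by (simp add: continuous_map_in_subtopology)
    have "finite S"
      using based_cubeD(2)[OF that] .
    then have "continuous_map (product_topology (\<lambda>_. top_of_set {0..1::real}) S) euclideanreal
        (\<lambda>x. coords ((A, S), x) e)" for e
      unfolding coords_def prod.case
      by (intro continuous_map_add continuous_map_real_mult continuous_map_sum proj) auto
    then show ?thesis
      unfolding euclidean_product_topology[symmetric] by (simp add: continuous_map_componentwise_UNIV)
  qed
  show ?thesis
    unfolding continuous_map_def
  proof (intro conjI allI impI)
    fix U :: "('e \<Rightarrow> real) set" assume U: "openin euclidean U"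
    have "openin (product_topology (\<lambda>_. top_of_set {0..1::real}) S)
        {x. ((A, S), x) \<in> {p \<in> topspace (cubes_space \<Gamma>). coords p \<in> U}}"
      if "(A, S) \<in> based_cubes \<Gamma>" for A S
    proof -
      have "{x. ((A, S), x) \<in> {p \<in> topspace (cubes_space \<Gamma>). coords p \<in> U}} =
          {x \<in> topspace (product_topology (\<lambda>_. top_of_set {0..1::real}) S). coords ((A, S), x) \<in> U}"
        using that by (auto simp: topspace_cubes_space)
      then show ?thesis
        using comp[OF that] U by (simp add: continuous_map_def)
    qed
    then show "openin (cubes_space \<Gamma>) {p \<in> topspace (cubes_space \<Gamma>). coords p \<in> U}"
      unfolding cubes_space_def openin_sum_topology by (auto simp: topspace_sum_topology)
  qed simp
qed

definition class_coords :: "'e cube_point set \<Rightarrow> 'e \<Rightarrow> real" where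
  "class_coords C = coords (SOME p. p \<in> C)"

lemma class_coords: "class_coords (point_class p) = coords p"
proof -
  have "p \<in> point_class p"
    using equiv_class_self[OF equiv_cube_equiv] by simp
  then have "(SOME p'. p' \<in> point_class p) \<in> point_class p"
    by (rule someI)
  then show ?thesis
    unfolding class_coords_def using coords_equiv by fastforce
qed

lemma continuous_class_coords: "continuous_map (cubed_complex \<Gamma>) euclidean class_coords"
  unfolding cubed_complex_def
  by (rule continuous_compose_quotient_map[OF quotient_map_quotient_space])
    (simp add: o_def class_coords continuous_coords)

lemma class_coords_image: "class_coords ` point_class ` dimer_points = model"
proof -
  have "coords p \<in> model" if p: "p \<in> dimer_points" for p
  proof -
    obtain A S x where "interior_point A S x" "(p, ((A, S), x)) \<in> cube_equiv \<Gamma>"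
      using interior_representative[OF p] .
    then show ?thesis
      using interior_point_model coords_equiv by metis
  qed
  moreover have "w \<in> coords ` dimer_points" if "w \<in> model" for w
    using model_point[OF that] by (metis imageI)
  ultimately show ?thesis
    by (auto simp: image_image class_coords)
qed

lemma inj_class_coords: "inj_on class_coords (point_class ` dimer_points)"
proof (rule inj_onI)
  fix C C' assume "C \<in> point_class ` dimer_points" "C' \<in> point_class ` dimer_points"
    and eq: "class_coords C = class_coords C'"
  then obtain p p' where p: "p \<in> dimer_points" "C = point_class p"
    and p': "p' \<in> dimer_points" "C' = point_class p'"
    by blast
  obtain A S x where q: "interior_point A S x" "(p, ((A, S), x)) \<in> cube_equiv \<Gamma>"
    using interior_representative[OF p(1)] .
  obtain A' S' x' where q': "interior_point A' S' x'" "(p', ((A', S'), x')) \<in> cube_equiv \<Gamma>"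
    using interior_representative[OF p'(1)] .
  have "coords ((A, S), x) = coords ((A', S'), x')"
    using eq p p' coords_equiv[OF q(2)] coords_equiv[OF q'(2)] by (simp add: class_coords)
  then have "(((A, S), x), ((A', S'), x')) \<in> cube_equiv \<Gamma>"
    by (rule interior_points_equiv[OF q(1) q'(1)])
  then have "(p, p') \<in> cube_equiv \<Gamma>"
    using q(2) q'(2) cube_equiv_sym cube_equiv_trans by meson
  then show "C = C'"
    unfolding p(2) p'(2) by (rule equiv_class_eq[OF equiv_cube_equiv])
qed

text \<open>
  A finite graph has finitely many based cubes, and the complex is the image of the finite disjoint union
  of the compact dimer cubes.
\<close>

lemma compact_dimer_complex: "compact_space (dimer_complex \<Gamma>)"
proof -
  let ?X = "\<lambda>(A, S). product_topology (\<lambda>_. top_of_set {0..1::real}) S"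
  let ?C = "{(A, S). dimer_cube A S}"
  have "finite ?C"
  proof (rule finite_subset)
    show "?C \<subseteq> Pow E \<times> Pow (Pow E)"
      using based_cubeD(1,3)[OF dimer_cube_based] by blast
  qed (use finite_E in simp)
  have "compactin (cubes_space \<Gamma>) (Pair c ` topspace (?X c))" if "c \<in> ?C" for c
  proof (rule image_compactin)
    have "compact_space (?X c)"
      by (cases c) (simp add: compact_space_product_topology compact_space_subtopology)
    then show "compactin (?X c) (topspace (?X c))"
      by (simp add: compact_space_def)
    show "continuous_map (?X c) (cubes_space \<Gamma>) (Pair c)"
      unfolding cubes_space_def
      by (rule continuous_map_component_injection) (use that dimer_cube_based in auto)
  qed
  then have "compactin (cubes_space \<Gamma>) (\<Union>c\<in>?C. Pair c ` topspace (?X c))"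
    using \<open>finite ?C\<close> by (intro compactin_Union) auto
  moreover have "(\<Union>c\<in>?C. Pair c ` topspace (?X c)) = dimer_points"
    by (auto simp: dimer_points_def)
  ultimately have "compactin (cubes_space \<Gamma>) dimer_points"
    by simp
  moreover have "continuous_map (cubes_space \<Gamma>) (cubed_complex \<Gamma>) point_class"
    unfolding cubed_complex_def by (rule quotient_imp_continuous_map[OF quotient_map_quotient_space])
  ultimately have "compactin (cubed_complex \<Gamma>) (point_class ` dimer_points)"
    by (rule image_compactin)
  then show ?thesis
    unfolding dimer_complex_eq by (rule compact_space_subtopology)
qed

lemma homeomorphic_dimer_complex: "homeomorphic_map (dimer_complex \<Gamma>) (top_of_set model) class_coords"
proof (rule continuous_imp_homeomorphic_map)
  show "compact_space (dimer_complex \<Gamma>)"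
    by (rule compact_dimer_complex)
  show "Hausdorff_space (top_of_set model)"
  proof (rule Hausdorff_space_subtopology)
    show "Hausdorff_space (euclidean :: ('e \<Rightarrow> real) topology)"
      unfolding euclidean_product_topology[symmetric] by (simp add: Hausdorff_space_product_topology)
  qed
  show "continuous_map (dimer_complex \<Gamma>) (top_of_set model) class_coords"
    unfolding continuous_map_in_subtopology
  proof
    show "continuous_map (dimer_complex \<Gamma>) euclidean class_coords"
      unfolding dimer_complex_def
      by (rule continuous_map_from_subtopology[OF continuous_class_coords])
    show "class_coords \<in> topspace (dimer_complex \<Gamma>) \<rightarrow> model"
      using class_coords_image by (simp add: topspace_dimer_complex image_subset_iff_funcset[symmetric])
  qed
  show "class_coords ` topspace (dimer_complex \<Gamma>) = topspace (top_of_set model)"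
    using class_coords_image topspace_dimer_complex by simp
  show "inj_on class_coords (topspace (dimer_complex \<Gamma>))"
    using inj_class_coords topspace_dimer_complex by simp
qed

lemma dimer_vertex: "A \<in> D \<Longrightarrow> ((A, {}), \<lambda>_. undefined) \<in> dimer_points"
  using dimer_subset by (auto simp: dimer_points_def dimer_cube_iff based_cubes_def power_group_def)

lemma class_coords_zero_cell: "class_coords (zero_cell \<Gamma> A) = indicator A"
  unfolding zero_cell_def class_coords by (auto simp: coords_out)

theorem dimer_groupoid_presentation:
  "\<exists>z. groupoid_presentation (dimer_groupoid \<Gamma>) (D \<times> D) fst snd z
    {([((A, C), True)], [((A, B), True), ((B, C), True)]) | A B C. flat_triple \<Gamma> A B C}"
proof -
  obtain g where g: "homeomorphic_maps (top_of_set model) (dimer_complex \<Gamma>) g class_coords"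
    using homeomorphic_dimer_complex homeomorphic_maps_sym unfolding homeomorphic_map_maps by blast
  have ind: "indicat_real A \<in> model" if "A \<in> D" for A
    using nerve_cover.pt_in[OF nerve_cover_model that] by (simp add: star_def)
  have vertex: "g (indicator A) = zero_cell \<Gamma> A" if "A \<in> D" for A
  proof -
    have "zero_cell \<Gamma> A \<in> topspace (dimer_complex \<Gamma>)"
      unfolding topspace_dimer_complex zero_cell_def using dimer_vertex[OF that] by blast
    then have "g (class_coords (zero_cell \<Gamma> A)) = zero_cell \<Gamma> A"
      using g by (simp add: homeomorphic_maps_def)
    then show ?thesis
      by (simp add: class_coords_zero_cell)
  qed
  have "groupoid_iso (fundamental_groupoid (top_of_set model) D indicator)
      (fundamental_groupoid (dimer_complex \<Gamma>) D (g \<circ> indicator))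
      (\<lambda>A B P. \<Union>p\<in>P. path_homotopy (dimer_complex \<Gamma>) (g (indicator A)) (g (indicator B)) `` {g \<circ> p})"
    by (rule fundamental_groupoid_homeomorphic[OF g ind])
  then have "groupoid_iso (fundamental_groupoid (top_of_set model) D indicator) (dimer_groupoid \<Gamma>)
      (\<lambda>A B P. \<Union>p\<in>P. path_homotopy (dimer_complex \<Gamma>) (g (indicator A)) (g (indicator B)) `` {g \<circ> p})"
    unfolding dimer_groupoid_def by (rule groupoid_iso_base_cong) (simp add: vertex)
  from groupoid_presentation_iso[OF nerve_cover.nerve_presentation[OF nerve_cover_model] this]
  show ?thesis
    unfolding triangle_rel_model by blast
qed

end


theorem theorem9p4:
  fixes \<Gamma> :: "('v, 'e) mgraph"
  assumes "finite_graph \<Gamma>"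
  shows "\<exists>z. groupoid_presentation (dimer_groupoid \<Gamma>)
    (dimer_coverings \<Gamma> \<times> dimer_coverings \<Gamma>) fst snd z
    {([((A, C), True)], [((A, B), True), ((B, C), True)]) | A B C. flat_triple \<Gamma> A B C}"
  using assms by (rule fin_graph.dimer_groupoid_presentation[OF fin_graph.intro])

end
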